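(* Let $\nu>0$, let $\omega\subset\mathbb{T}^3$ be measurable with associated nonnegative localization function $\chi_\omega\in L^\infty(\mathbb{T}^3)$, and let $K_{\min}\ge 0$. Assume that there exists $\alpha_\omega>0$ such that $$\nu\|\nabla v\|_{L^2}^2+K_{\min}\|\chi_\omega^{1/2}v\|_{L^2}^2\ge\alpha_\omega\|v\|_{L^2}^2,\qquad\forall v\in V.$$ Then the semigroup generated by $A_0-D_{K_{\min}}$ on $H$ is exponentially stable in $L^2$: for every $v_0\in H$, the function $v(t)=e^{t(A_0-D_{K_{\min}})}v_0$ satisfies $$\|v(t)\|_{L^2}\le e^{-\alpha_\omega t}\|v_0\|_{L^2},\qquad\forall t\ge 0.$$
   Context: $\mathbb{T}^3=(\mathbb{R}/\mathbb{Z})^3$. $H:=\{v\in L^2(\mathbb{T}^3;\mathbb{R}^3): \nabla\cdot v=0,\ \int_{\mathbb{T}^3}v\,dx=0\}$ with the $L^2$ inner product, and $V:=H^1(\mathbb{T}^3;\mathbb{R}^3)\cap H$. $P:L^2(\mathbb{T}^3;\mathbb{R}^3)\to H$ is the orthogonal (Leray) projector onto $H$. The Stokes operator is $A_0:=\nu P\Delta$ with domain $D(A_0):=H^2(\mathbb{T}^3;\mathbb{R}^3)\cap H$, and $D_{K_{\min}}v:=P(K_{\min}\chi_\omega v)$ is a bounded operator on $H$. The function $\chi_\omega$ is typically the indicator function of $\omega$ or a smooth cutoff supported in $\omega$. *)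

theory Defs
  imports "HOL-Analysis.Analysis"
begin

text \<open>
  The torus \<open>(\<real>/\<int>)^3\<close> is represented by its fundamental domain \<open>[0,1)^3\<close> with Lebesgue
  measure. The identification of opposite faces enters through the test functions below,
  which are smooth and \<open>\<int>^3\<close>-periodic functions on \<open>\<real>^3\<close>.
\<close>

definition torus :: "(real^3) measure" where
  "torus = lebesgue_on {x. \<forall>i. 0 \<le> x $ i \<and> x $ i < 1}"

definition square_integrable :: "(real^3 \<Rightarrow> real^3) \<Rightarrow> bool" where
  "square_integrable f \<longleftrightarrow>
     f \<in> borel_measurable torus \<and> integrable torus (\<lambda>x. (norm (f x))\<^sup>2)"

definition ae_eq :: "(real^3 \<Rightarrow> real^3) \<Rightarrow> (real^3 \<Rightarrow> real^3) \<Rightarrow> bool" where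
  "ae_eq f g \<longleftrightarrow> square_integrable f \<and> square_integrable g \<and> (AE x in torus. f x = g x)"

lemma square_integrable_zero: "square_integrable (\<lambda>x. 0)"
  by (simp add: square_integrable_def)

lemma square_integrable_scaleR:
  "square_integrable f \<Longrightarrow> square_integrable (\<lambda>x. c *\<^sub>R f x)"
  by (auto simp: square_integrable_def power_mult_distrib)

lemma square_integrable_add:
  assumes f: "square_integrable f" and g: "square_integrable g"
  shows "square_integrable (\<lambda>x. f x + g x)"
  unfolding square_integrable_def
proof
  have [measurable]: "f \<in> borel_measurable torus" "g \<in> borel_measurable torus"
    using f g by (auto simp: square_integrable_def)
  show "(\<lambda>x. f x + g x) \<in> borel_measurable torus" by measurable
  show "integrable torus (\<lambda>x. (norm (f x + g x))\<^sup>2)"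
  proof (rule Bochner_Integration.integrable_bound)
    show "integrable torus (\<lambda>x. 2 * (norm (f x))\<^sup>2 + 2 * (norm (g x))\<^sup>2)"
      using f g by (auto simp: square_integrable_def)
    have "(norm (a + b))\<^sup>2 \<le> 2 * (norm a)\<^sup>2 + 2 * (norm b)\<^sup>2" for a b :: "real^3"
      using zero_le_power2[of "norm (a - b)"]
      by (simp add: power2_norm_eq_inner inner_simps inner_commute)
    then show "AE x in torus. norm ((norm (f x + g x))\<^sup>2)
        \<le> norm (2 * (norm (f x))\<^sup>2 + 2 * (norm (g x))\<^sup>2)"
      by simp
  qed measurable
qed

lemma square_integrable_inner:
  assumes f: "square_integrable f" and g: "square_integrable g"
  shows "integrable torus (\<lambda>x. f x \<bullet> g x)"
proof (rule Bochner_Integration.integrable_bound)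
  have [measurable]: "f \<in> borel_measurable torus" "g \<in> borel_measurable torus"
    using f g by (auto simp: square_integrable_def)
  show "(\<lambda>x. f x \<bullet> g x) \<in> borel_measurable torus" by measurable
  show "integrable torus (\<lambda>x. (norm (f x))\<^sup>2 + (norm (g x))\<^sup>2)"
    using f g by (auto simp: square_integrable_def)
  have "\<bar>a \<bullet> b\<bar> \<le> (norm a)\<^sup>2 + (norm b)\<^sup>2" for a b :: "real^3"
    using Cauchy_Schwarz_ineq2[of a b] sum_squares_bound[of "norm a" "norm b"]
      norm_ge_zero[of a] norm_ge_zero[of b] mult_nonneg_nonneg[of "norm a" "norm b"]
    by linarith
  then show "AE x in torus. norm (f x \<bullet> g x) \<le> norm ((norm (f x))\<^sup>2 + (norm (g x))\<^sup>2)"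
    by simp
qed

quotient_type L2 = "real^3 \<Rightarrow> real^3" / partial: ae_eq
proof (rule part_equivpI)
  show "\<exists>f. ae_eq f f"
    using square_integrable_zero by (auto simp: ae_eq_def)
  show "symp ae_eq"
    by (rule sympI) (auto simp: ae_eq_def eq_commute)
  show "transp ae_eq"
    by (rule transpI) (auto simp: ae_eq_def)
qed

lemma ae_eq_integral_inner:
  assumes "ae_eq f f'" "ae_eq g g'"
  shows "(LINT x|torus. f x \<bullet> g x) = (LINT x|torus. f' x \<bullet> g' x)"
proof (rule integral_cong_AE)
  have [measurable]: "f \<in> borel_measurable torus" "g \<in> borel_measurable torus"
    "f' \<in> borel_measurable torus" "g' \<in> borel_measurable torus"
    using assms by (auto simp: ae_eq_def square_integrable_def)
  show "(\<lambda>x. f x \<bullet> g x) \<in> borel_measurable torus" "(\<lambda>x. f' x \<bullet> g' x) \<in> borel_measurable torus"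
    by measurable
  show "AE x in torus. f x \<bullet> g x = f' x \<bullet> g' x"
    using assms by (auto simp: ae_eq_def)
qed

instantiation L2 :: real_inner
begin

lift_definition zero_L2 :: L2 is "\<lambda>x. 0"
  by (simp add: ae_eq_def square_integrable_zero)

lift_definition plus_L2 :: "L2 \<Rightarrow> L2 \<Rightarrow> L2" is "\<lambda>f g x. f x + g x"
  by (auto simp: ae_eq_def square_integrable_add)

lift_definition scaleR_L2 :: "real \<Rightarrow> L2 \<Rightarrow> L2" is "\<lambda>c f x. c *\<^sub>R f x"
  by (auto simp: ae_eq_def square_integrable_scaleR)

definition uminus_L2 :: "L2 \<Rightarrow> L2" where "uminus_L2 v = (-1) *\<^sub>R v"

definition minus_L2 :: "L2 \<Rightarrow> L2 \<Rightarrow> L2" where "minus_L2 v w = v + (-1) *\<^sub>R w"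

lift_definition inner_L2 :: "L2 \<Rightarrow> L2 \<Rightarrow> real" is "\<lambda>f g. LINT x|torus. f x \<bullet> g x"
  by (rule ae_eq_integral_inner)

definition norm_L2 :: "L2 \<Rightarrow> real" where "norm_L2 v = sqrt (inner v v)"

definition sgn_L2 :: "L2 \<Rightarrow> L2" where "sgn_L2 v = inverse (norm v) *\<^sub>R v"

definition dist_L2 :: "L2 \<Rightarrow> L2 \<Rightarrow> real" where "dist_L2 v w = norm (v - w)"

definition uniformity_L2 :: "(L2 \<times> L2) filter" where
  "uniformity_L2 = (INF e\<in>{0<..}. principal {(x, y). dist x y < e})"

definition open_L2 :: "L2 set \<Rightarrow> bool" where
  "open_L2 U = (\<forall>x\<in>U. eventually (\<lambda>(x', y). x' = x \<longrightarrow> y \<in> U) uniformity)"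

instance
proof
  fix a b c :: L2 and r s :: real and U :: "L2 set"
  show "a + b + c = a + (b + c)"
    by transfer (auto simp: ae_eq_def square_integrable_add add.assoc)
  show "a + b = b + a"
    by transfer (auto simp: ae_eq_def square_integrable_add add.commute)
  show "0 + a = a"
    by transfer (auto simp: ae_eq_def)
  show "- a + a = 0"
    unfolding uminus_L2_def
    by transfer (auto simp: ae_eq_def square_integrable_zero)
  show "a - b = a + - b"
    by (simp add: minus_L2_def uminus_L2_def)
  show "r *\<^sub>R (a + b) = r *\<^sub>R a + r *\<^sub>R b"
    by transfer (auto simp: ae_eq_def square_integrable_add square_integrable_scaleR scaleR_add_right)
  show "(r + s) *\<^sub>R a = r *\<^sub>R a + s *\<^sub>R a"
    by transfer (auto simp: ae_eq_def square_integrable_add square_integrable_scaleR scaleR_add_left)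
  show "r *\<^sub>R s *\<^sub>R a = (r * s) *\<^sub>R a"
    by transfer (auto simp: ae_eq_def square_integrable_scaleR)
  show "1 *\<^sub>R a = a"
    by transfer (auto simp: ae_eq_def)
  show "dist a b = norm (a - b)" by (rule dist_L2_def)
  show "sgn a = inverse (norm a) *\<^sub>R a" by (rule sgn_L2_def)
  show "uniformity = (INF e\<in>{0<..}. principal {(x::L2, y). dist x y < e})"
    by (rule uniformity_L2_def)
  show "open U = (\<forall>x\<in>U. eventually (\<lambda>(x', y). x' = x \<longrightarrow> y \<in> U) uniformity)"
    by (rule open_L2_def)
  show "inner a b = inner b a"
    by transfer (simp add: inner_commute)
  show "inner (a + b) c = inner a c + inner b c"
    by transfer (simp add: ae_eq_def inner_add_left square_integrable_inner)
  show "inner (r *\<^sub>R a) b = r * inner a b"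
    by transfer simp
  show "0 \<le> inner a a"
    by transfer (simp add: integral_nonneg_AE)
  show "inner a a = 0 \<longleftrightarrow> a = 0"
  proof transfer
    fix f assume "ae_eq f f"
    then have f: "square_integrable f" by (simp add: ae_eq_def)
    have "(LINT x|torus. f x \<bullet> f x) = 0 \<longleftrightarrow> (AE x in torus. f x \<bullet> f x = 0)"
      by (rule integral_nonneg_eq_0_iff_AE) (auto simp: square_integrable_inner f)
    then show "(LINT x|torus. f x \<bullet> f x) = 0 \<longleftrightarrow> ae_eq f (\<lambda>x. 0)"
      by (simp add: ae_eq_def f square_integrable_zero)
  qed
  show "norm a = sqrt (inner a a)" by (rule norm_L2_def)
qed

end

definition partial_deriv :: "3 \<Rightarrow> (real^3 \<Rightarrow> real) \<Rightarrow> real^3 \<Rightarrow> real" where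
  "partial_deriv i f x = frechet_derivative f (at x) (axis i 1)"

primrec C_k :: "nat \<Rightarrow> (real^3 \<Rightarrow> real) \<Rightarrow> bool" where
  "C_k 0 f \<longleftrightarrow> continuous_on UNIV f"
| "C_k (Suc k) f \<longleftrightarrow> (\<forall>x. f differentiable (at x)) \<and> (\<forall>i. C_k k (partial_deriv i f))"

definition test_function :: "(real^3 \<Rightarrow> real) \<Rightarrow> bool" where
  "test_function \<phi> \<longleftrightarrow> (\<forall>k. C_k k \<phi>) \<and> (\<forall>i x. \<phi> (x + axis i 1) = \<phi> x)"

text \<open>\<open>rep_L2 v\<close> is some representative of the class \<open>v\<close>; it only occurs where its choice
  is irrelevant, i.e. under an integral or below \<open>abs_L2\<close>.\<close>

definition has_weak_deriv :: "3 \<Rightarrow> L2 \<Rightarrow> L2 \<Rightarrow> bool" where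
  "has_weak_deriv i v g \<longleftrightarrow> (\<forall>\<phi>. test_function \<phi> \<longrightarrow>
     (LINT x|torus. partial_deriv i \<phi> x *\<^sub>R rep_L2 v x) = - (LINT x|torus. \<phi> x *\<^sub>R rep_L2 g x))"

definition weak_deriv :: "3 \<Rightarrow> L2 \<Rightarrow> L2" where
  "weak_deriv i v = (THE g. has_weak_deriv i v g)"

definition H1 :: "L2 set" where
  "H1 = {v. \<forall>i. \<exists>g. has_weak_deriv i v g}"

definition H2 :: "L2 set" where
  "H2 = {v \<in> H1. \<forall>i. weak_deriv i v \<in> H1}"

definition norm_grad :: "L2 \<Rightarrow> real" where
  "norm_grad v = sqrt (\<Sum>i\<in>UNIV. (norm (weak_deriv i v))\<^sup>2)"

definition laplacian :: "L2 \<Rightarrow> L2" where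
  "laplacian v = (\<Sum>i\<in>UNIV. weak_deriv i (weak_deriv i v))"

definition divergence_free :: "L2 \<Rightarrow> bool" where
  "divergence_free v \<longleftrightarrow> (\<forall>\<phi>. test_function \<phi> \<longrightarrow>
     (LINT x|torus. (\<Sum>i\<in>UNIV. partial_deriv i \<phi> x * rep_L2 v x $ i)) = 0)"

definition H :: "L2 set" where
  "H = {v. divergence_free v \<and> (LINT x|torus. rep_L2 v x) = 0}"

definition V :: "L2 set" where
  "V = H1 \<inter> H"

definition orthogonal_projector :: "'a::real_inner set \<Rightarrow> 'a \<Rightarrow> 'a" where
  "orthogonal_projector X v = (THE u. u \<in> X \<and> (\<forall>w\<in>X. inner (v - u) w = 0))"

definition P :: "L2 \<Rightarrow> L2" where
  "P = orthogonal_projector H"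

definition L_infinity :: "(real^3 \<Rightarrow> real) \<Rightarrow> bool" where
  "L_infinity g \<longleftrightarrow> g \<in> borel_measurable torus \<and> (\<exists>C. AE x in torus. \<bar>g x\<bar> \<le> C)"

text \<open>Pointwise multiplication; only meaningful if \<open>g\<close> is in \<open>L^\<infinity>\<close>.\<close>

definition multiply :: "(real^3 \<Rightarrow> real) \<Rightarrow> L2 \<Rightarrow> L2" where
  "multiply g v = abs_L2 (\<lambda>x. g x *\<^sub>R rep_L2 v x)"

definition dom_A0 :: "L2 set" where
  "dom_A0 = H2 \<inter> H"

definition A0 :: "real \<Rightarrow> L2 \<Rightarrow> L2" where
  "A0 \<nu> v = \<nu> *\<^sub>R P (laplacian v)"

definition damping :: "real \<Rightarrow> (real^3 \<Rightarrow> real) \<Rightarrow> L2 \<Rightarrow> L2" where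
  "damping K chi v = P (multiply (\<lambda>x. K * chi x) v)"

text \<open>Operators on a subspace \<open>X\<close> are functions on the ambient type of which only the values
  on \<open>X\<close> matter; likewise only times \<open>t \<ge> 0\<close> matter.\<close>

definition C0_semigroup :: "'a::real_normed_vector set \<Rightarrow> (real \<Rightarrow> 'a \<Rightarrow> 'a) \<Rightarrow> bool" where
  "C0_semigroup X S \<longleftrightarrow>
     (\<forall>t\<ge>0. \<forall>x\<in>X. S t x \<in> X) \<and>
     (\<forall>t\<ge>0. \<forall>x\<in>X. \<forall>y\<in>X. \<forall>a b. S t (a *\<^sub>R x + b *\<^sub>R y) = a *\<^sub>R S t x + b *\<^sub>R S t y) \<and>
     (\<forall>t\<ge>0. \<exists>M. \<forall>x\<in>X. norm (S t x) \<le> M * norm x) \<and>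
     (\<forall>x\<in>X. S 0 x = x) \<and>
     (\<forall>s\<ge>0. \<forall>t\<ge>0. \<forall>x\<in>X. S (s + t) x = S s (S t x)) \<and>
     (\<forall>x\<in>X. ((\<lambda>t. S t x) \<longlongrightarrow> x) (at_right 0))"

definition generator :: "'a::real_normed_vector set \<Rightarrow> (real \<Rightarrow> 'a \<Rightarrow> 'a) \<Rightarrow> ('a \<times> 'a) set" where
  "generator X S =
     {(x, y). x \<in> X \<and> y \<in> X \<and> ((\<lambda>h. (S h x - x) /\<^sub>R h) \<longlongrightarrow> y) (at_right 0)}"

definition generates ::
  "'a::real_normed_vector set \<Rightarrow> 'a set \<Rightarrow> ('a \<Rightarrow> 'a) \<Rightarrow> (real \<Rightarrow> 'a \<Rightarrow> 'a) \<Rightarrow> bool" where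
  "generates X D A S \<longleftrightarrow> C0_semigroup X S \<and> generator X S = {(x, A x) | x. x \<in> D}"

end

theory Submission
  imports Defs
begin

text \<open>
  The functions \<open>cas (2\<pi> k\<cdot>x) e\<^sub>j\<close> with \<open>cas = cos + sin\<close>, \<open>k \<in> \<int>\<^sup>3\<close>, form a real orthonormal basis of
  \<open>L\<^sup>2\<close> of the torus; orthogonality follows from translation invariance, completeness from
  Stone--Weierstrass. Since \<open>\<partial>\<^sub>i\<close> sends the mode \<open>k\<close> to \<open>2\<pi> k\<^sub>i\<close> times the mode \<open>-k\<close>, weak derivatives,
  \<open>H\<close>, \<open>P\<close> and \<open>A\<^sub>0\<close> are all described by coefficients, and \<open>A\<^sub>0\<close> is the restriction to \<open>H\<close> of the
  generator of a diagonal contraction semigroup. The damping is a bounded perturbation, so Duhamel's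
  formula yields the semigroup of \<open>A\<^sub>0 - D\<close>. The coercivity hypothesis says
  \<open>\<langle>(A\<^sub>0 - D) v, v\<rangle> \<le> - \<alpha> \<parallel>v\<parallel>\<^sup>2\<close> on the domain. Hence \<open>e\<^bsup>2\<alpha>t\<^esup> \<parallel>v(t)\<parallel>\<^sup>2\<close> is nonincreasing for initial data in the
  domain, for every semigroup with this generator, and the domain is dense in \<open>H\<close>.
\<close>

section \<open>Orthonormal bases and diagonal semigroups\<close>

text \<open>\<open>C0_semigroup\<close> bounds each operator \<open>S t\<close> separately, and the
  decay estimate concerns an arbitrary \<open>S\<close> with the given generator. The left
  difference quotients of an orbit apply \<open>S (t - h)\<close> at varying times, so a bound
  uniform over compact time intervals has to come first. This is where Baire's theorem enters, and
  completeness of \<open>L2\<close> serves it as well as the orthogonal series and the Duhamel fixed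
  point. The semigroup is built on the whole type \<open>L2\<close> and then restricted to
  \<open>H\<close>: multipliers depending on the frequency k alone preserve the divergence
  condition, and the damping takes values in \<open>H\<close>. The generator must have exactly the
  domain \<open>H2 \<inter> H\<close>. This rests on the inequalities |k_i k_l| <= |k|^2 and |k_i|
  <= |k|^2 for integer vectors k: as soon as the formal coefficients of the Laplacian belong to a
  vector of \<open>L2\<close>, all first and second weak derivatives exist. The existence half of
  the theorem keeps the universally quantified estimate from being vacuous.\<close>

locale orthonormal_basis =
  fixes e :: "'i \<Rightarrow> 'a::{real_inner,banach}"
  assumes orthonormal: "inner (e i) (e j) = (if i = j then 1 else 0)"
    and total: "(\<And>i. inner x (e i) = 0) \<Longrightarrow> x = 0"
begin

lemma norm_sum_squared:
  assumes "finite F"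
  shows "(norm (\<Sum>i\<in>F. c i *\<^sub>R e i))\<^sup>2 = (\<Sum>i\<in>F. (c i)\<^sup>2)"
proof -
  have "(norm (\<Sum>i\<in>F. c i *\<^sub>R e i))\<^sup>2 = (\<Sum>i\<in>F. \<Sum>j\<in>F. c i * (c j * (if i = j then 1 else 0)))"
    by (simp add: power2_norm_eq_inner inner_sum_left inner_sum_right orthonormal
        eq_commute sum_distrib_left)
  also have "\<dots> = (\<Sum>i\<in>F. (c i)\<^sup>2)"
    using assms by (simp add: power2_eq_square if_distrib cong: if_cong)
  finally show ?thesis .
qed

lemma bessel:
  assumes "finite F"
  shows "(\<Sum>i\<in>F. (inner x (e i))\<^sup>2) \<le> (norm x)\<^sup>2"
proof -
  let ?s = "\<Sum>i\<in>F. inner x (e i) *\<^sub>R e i"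
  have "inner x ?s = (\<Sum>i\<in>F. (inner x (e i))\<^sup>2)"
    by (simp add: inner_sum_right power2_eq_square)
  moreover have "inner ?s ?s = (\<Sum>i\<in>F. (inner x (e i))\<^sup>2)"
    using norm_sum_squared[OF assms, of "\<lambda>i. inner x (e i)"] by (simp add: power2_norm_eq_inner)
  ultimately have "(norm (x - ?s))\<^sup>2 = (norm x)\<^sup>2 - (\<Sum>i\<in>F. (inner x (e i))\<^sup>2)"
    by (simp add: power2_norm_eq_inner inner_diff_left inner_diff_right inner_commute)
  then show ?thesis
    by (metis diff_ge_0_iff_ge zero_le_power2)
qed

lemma summable_squares: "(\<lambda>i. (inner x (e i))\<^sup>2) summable_on UNIV"
  by (rule nonneg_bdd_above_summable_on) (auto intro!: bdd_aboveI2 bessel)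

text \<open>Orthonormality turns the squared distance between the partial sums over
  \<open>F0\<close> and over a larger \<open>F\<close> into a block of the series of squares, so the
  net of finite partial sums is Cauchy.\<close>

lemma summable_series:
  assumes c: "(\<lambda>i. (c i)\<^sup>2) summable_on UNIV"
  shows "(\<lambda>i. c i *\<^sub>R e i) summable_on UNIV"
proof -
  let ?f = "\<lambda>i. c i *\<^sub>R e i"
  have "\<exists>P. eventually P (finite_subsets_at_top UNIV) \<and>
      (\<forall>F1 F2. P F1 \<and> P F2 \<longrightarrow> dist (sum ?f F1) (sum ?f F2) < \<epsilon>)" if "\<epsilon> > 0" for \<epsilon> :: real
  proof -
    let ?d = "(\<epsilon> / 2)\<^sup>2"
    obtain F0 where F0: "finite F0"
      "dist (\<Sum>i\<in>F0. (c i)\<^sup>2) (infsum (\<lambda>i. (c i)\<^sup>2) UNIV) \<le> ?d / 2"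
      using infsum_finite_approximation[OF c, of "?d / 2"] \<open>\<epsilon> > 0\<close> by auto
    have near: "dist (sum ?f F) (sum ?f F0) < \<epsilon> / 2" if F: "finite F" "F0 \<subseteq> F" for F
    proof -
      have "dist (sum ?f F) (sum ?f F0) = norm (sum ?f (F - F0))"
        using F by (simp add: dist_norm sum_diff)
      moreover have "(norm (sum ?f (F - F0)))\<^sup>2 < ?d"
      proof -
        have "(norm (sum ?f (F - F0)))\<^sup>2 = (\<Sum>i\<in>F. (c i)\<^sup>2) - (\<Sum>i\<in>F0. (c i)\<^sup>2)"
          using F sum_diff[of F F0 "\<lambda>i. (c i)\<^sup>2"]
          by (simp add: norm_sum_squared del: sum_diff)
        also have "\<dots> \<le> infsum (\<lambda>i. (c i)\<^sup>2) UNIV - (\<Sum>i\<in>F0. (c i)\<^sup>2)"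
          using finite_sum_le_infsum[OF c, of F] F by simp
        also have "\<dots> \<le> ?d / 2"
          using F0(2) unfolding dist_real_def by linarith
        also have "\<dots> < ?d"
          using \<open>\<epsilon> > 0\<close> by simp
        finally show ?thesis .
      qed
      ultimately have "(dist (sum ?f F) (sum ?f F0))\<^sup>2 < ?d"
        by simp
      then show ?thesis
        by (rule power2_less_imp_less) (use \<open>\<epsilon> > 0\<close> in simp)
    qed
    have "dist (sum ?f F1) (sum ?f F2) < \<epsilon>"
      if "finite F1" "F0 \<subseteq> F1" "finite F2" "F0 \<subseteq> F2" for F1 F2
      using near[OF that(1,2)] near[OF that(3,4)] by (rule dist_triangle_half_l)
    moreover have "eventually (\<lambda>F. finite F \<and> F0 \<subseteq> F) (finite_subsets_at_top UNIV)"
      using F0(1) by (auto simp: eventually_finite_subsets_at_top)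
    ultimately show ?thesis
      by blast
  qed
  then have "cauchy_filter (filtermap (sum ?f) (finite_subsets_at_top UNIV))"
    by (simp add: cauchy_filter_metric_filtermap)
  moreover have "complete (UNIV :: 'a set)"
    by (rule complete_UNIV)
  ultimately obtain L where "(sum ?f \<longlongrightarrow> L) (finite_subsets_at_top UNIV)"
    using complete_uniform[where S="UNIV :: 'a set"] by (force simp add: filterlim_def)
  then show ?thesis
    using summable_on_def has_sum_def by blast
qed

lemma riesz_fischer:
  assumes "(\<lambda>i. (c i)\<^sup>2) summable_on UNIV"
  obtains x where "((\<lambda>i. c i *\<^sub>R e i) has_sum x) UNIV" "\<And>i. inner x (e i) = c i"
proof -
  obtain x where x: "((\<lambda>i. c i *\<^sub>R e i) has_sum x) UNIV"
    using summable_series[OF assms] by (auto simp: summable_on_def)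
  have "inner x (e j) = c j" for j
  proof -
    have "((\<lambda>i. inner (c i *\<^sub>R e i) (e j)) has_sum inner x (e j)) UNIV"
      by (rule has_sum_bounded_linear[OF bounded_linear_inner_left x])
    moreover have "((\<lambda>i. inner (c i *\<^sub>R e i) (e j)) has_sum c j) UNIV"
      by (rule has_sum_finite_neutralI[where B="{j}"]) (auto simp: orthonormal)
    ultimately show ?thesis
      by (rule has_sum_unique)
  qed
  with x show ?thesis
    using that by blast
qed

lemma eqI:
  assumes "\<And>i. inner x (e i) = inner y (e i)"
  shows "x = y"
  using total[of "x - y"] assms by (simp add: inner_diff_left)

lemma has_sum_expansion: "((\<lambda>i. inner x (e i) *\<^sub>R e i) has_sum x) UNIV"
proof -
  obtain y where "((\<lambda>i. inner x (e i) *\<^sub>R e i) has_sum y) UNIV"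
    "\<And>i. inner y (e i) = inner x (e i)"
    using riesz_fischer[OF summable_squares[of x]] by blast
  then show ?thesis
    using eqI[of y x] by simp
qed

lemma parseval: "((\<lambda>i. inner x (e i) * inner y (e i)) has_sum inner x y) UNIV"
  using has_sum_bounded_linear[OF bounded_linear_inner_left has_sum_expansion, of y x]
  by (simp add: inner_commute mult.commute)

lemma parseval_norm: "((\<lambda>i. (inner x (e i))\<^sup>2) has_sum (norm x)\<^sup>2) UNIV"
  using parseval[of x x] by (simp add: power2_eq_square dot_square_norm)

text \<open>Serves the Fourier-side operators below: \<open>\<sigma>\<close> is the identity for
  multipliers, the reflection of k to -k for first derivatives, and a cyclic shift of the component
  for the Leray projector.\<close>

lemma weighted_permutation_exists:
  assumes \<sigma>: "bij \<sigma>" and m: "\<And>i. \<bar>m i\<bar> \<le> C"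
  obtains y where "\<And>i. inner y (e i) = m i * inner x (e (\<sigma> i))"
proof -
  have "(\<lambda>i. (inner x (e (\<sigma> i)))\<^sup>2) summable_on UNIV"
    using summable_squares[of x] summable_on_reindex_bij_betw[OF \<sigma>, of "\<lambda>i. (inner x (e i))\<^sup>2"] by simp
  then have "(\<lambda>i. C\<^sup>2 * (inner x (e (\<sigma> i)))\<^sup>2) summable_on UNIV"
    by (rule summable_on_cmult_right)
  moreover have "(m i * a)\<^sup>2 \<le> C\<^sup>2 * a\<^sup>2" for i a
    using power_mono[OF m[of i], of 2] by (simp add: power_mult_distrib mult_right_mono)
  ultimately have "(\<lambda>i. (m i * inner x (e (\<sigma> i)))\<^sup>2) summable_on UNIV"
    by (rule summable_on_comparison_test) auto
  from riesz_fischer[OF this] show ?thesis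
    using that by blast
qed

lemma multiplier_norm_le:
  assumes m: "\<And>i. \<bar>m i\<bar> \<le> C" and y: "\<And>i. inner y (e i) = m i * inner x (e i)"
  shows "norm y \<le> C * norm x"
proof -
  have "C \<ge> 0"
    using m[of undefined] by linarith
  have "(norm y)\<^sup>2 \<le> C\<^sup>2 * (norm x)\<^sup>2"
  proof (rule has_sum_mono[OF parseval_norm has_sum_cmult_right[OF parseval_norm]])
    show "(inner y (e i))\<^sup>2 \<le> C\<^sup>2 * (inner x (e i))\<^sup>2" for i
      using power_mono[OF m[of i], of 2] by (simp add: y power_mult_distrib mult_right_mono)
  qed
  then show ?thesis
    using \<open>C \<ge> 0\<close> by (simp flip: power_mult_distrib)
qed

text \<open>Dominated convergence for coefficients: finitely many indices carry all but
  \<open>\<delta>\<close> of the squared norm of \<open>x\<close>; on these the pointwise limits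
  suffice, elsewhere the uniform bound \<open>C\<close> does. Strong continuity, the generator and
  the density of the domain all come from it.\<close>

lemma multiplier_tendsto_0:
  fixes m :: "'h \<Rightarrow> 'i \<Rightarrow> real"
  assumes lim: "\<And>i. ((\<lambda>h. m h i) \<longlongrightarrow> 0) G"
    and m: "eventually (\<lambda>h. \<forall>i. \<bar>m h i\<bar> \<le> C) G"
    and y: "eventually (\<lambda>h. \<forall>i. inner (y h) (e i) = m h i * inner x (e i)) G"
  shows "(y \<longlongrightarrow> 0) G"
proof -
  have "((\<lambda>h. (norm (y h))\<^sup>2) \<longlongrightarrow> 0) G"
  proof (rule tendstoI)
    fix \<epsilon> :: real assume "\<epsilon> > 0"
    let ?s = "\<lambda>i. (inner x (e i))\<^sup>2"
    \<comment> \<open>Makes the tail contribution \<open>C\<^sup>2 * \<delta>\<close> at most half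
      of \<open>\<epsilon>\<close>; the summand 1 covers \<open>C = 0\<close>.\<close>
    define \<delta> where "\<delta> = \<epsilon> / (2 * (C\<^sup>2 + 1))"
    have pos: "2 * (C\<^sup>2 + 1) > 0"
      by (simp add: add_nonneg_pos)
    then have "\<delta> > 0"
      using \<open>\<epsilon> > 0\<close> by (simp add: \<delta>_def)
    then obtain F where F: "finite F" "dist (sum ?s F) ((norm x)\<^sup>2) \<le> \<delta>"
      using has_sum_finite_approximation[OF parseval_norm, of \<delta> x] by auto
    have "((\<lambda>h. \<Sum>i\<in>F. (m h i)\<^sup>2 * ?s i) \<longlongrightarrow> (\<Sum>i\<in>F. 0\<^sup>2 * ?s i)) G"
      by (intro tendsto_intros lim)
    then have "((\<lambda>h. \<Sum>i\<in>F. (m h i)\<^sup>2 * ?s i) \<longlongrightarrow> 0) G"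
      by simp
    then have "eventually (\<lambda>h. (\<Sum>i\<in>F. (m h i)\<^sup>2 * ?s i) < \<epsilon> / 2) G"
      using \<open>\<epsilon> > 0\<close> by (intro order_tendstoD(2)[of _ 0]) auto
    with m y show "eventually (\<lambda>h. dist ((norm (y h))\<^sup>2) 0 < \<epsilon>) G"
    proof eventually_elim
      case (elim h)
      have tail: "(?s has_sum ((norm x)\<^sup>2 - sum ?s F)) (UNIV - F)"
        by (rule has_sum_Diff[OF parseval_norm]) (auto simp: F(1))
      have ynorm: "((\<lambda>i. (m h i)\<^sup>2 * ?s i) has_sum (norm (y h))\<^sup>2) UNIV"
        using parseval_norm[of "y h"] elim by (simp add: power_mult_distrib)
      have ytail: "((\<lambda>i. (m h i)\<^sup>2 * ?s i) has_sum
          ((norm (y h))\<^sup>2 - (\<Sum>i\<in>F. (m h i)\<^sup>2 * ?s i))) (UNIV - F)"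
        by (rule has_sum_Diff[OF ynorm]) (auto simp: F(1))
      have "(norm (y h))\<^sup>2 - (\<Sum>i\<in>F. (m h i)\<^sup>2 * ?s i) \<le> C\<^sup>2 * ((norm x)\<^sup>2 - sum ?s F)"
      proof (rule has_sum_mono[OF ytail has_sum_cmult_right[OF tail]])
        show "(m h i)\<^sup>2 * ?s i \<le> C\<^sup>2 * ?s i" for i
          using power_mono[of "\<bar>m h i\<bar>" C 2] elim by (simp add: mult_right_mono)
      qed
      also have "\<dots> \<le> C\<^sup>2 * \<delta>"
        using F(2) by (intro mult_left_mono) (auto simp: dist_real_def)
      also have "\<dots> \<le> (C\<^sup>2 + 1) * \<delta>"
        using \<open>\<delta> > 0\<close> by (intro mult_right_mono) auto
      also have "\<dots> = \<epsilon> / 2"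
        using pos by (simp add: \<delta>_def field_simps)
      finally show ?case
        using elim by (simp add: dist_real_def)
    qed
  qed
  then have "((\<lambda>h. sqrt ((norm (y h))\<^sup>2)) \<longlongrightarrow> sqrt 0) G"
    by (rule tendsto_real_sqrt)
  then show ?thesis
    by (simp add: tendsto_norm_zero_iff)
qed

section \<open>Diagonal contraction semigroups and their generators\<close>

text \<open>For nonnegative \<open>\<Lambda>\<close> the truncation \<open>max 0 t\<close> keeps the
  weights between 0 and 1 at every time, so a vector with these coefficients always exists; it is
  unique by \<open>eqI\<close>.\<close>

definition diagonal_semigroup :: "('i \<Rightarrow> real) \<Rightarrow> real \<Rightarrow> 'a \<Rightarrow> 'a" where
  "diagonal_semigroup \<Lambda> t x =
     (SOME y. \<forall>i. inner y (e i) = exp (- max 0 t * \<Lambda> i) * inner x (e i))"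

lemma inner_diagonal_semigroup:
  assumes "\<And>i. \<Lambda> i \<ge> 0" "t \<ge> 0"
  shows "inner (diagonal_semigroup \<Lambda> t x) (e i) = exp (- t * \<Lambda> i) * inner x (e i)"
proof -
  obtain y where "\<And>i. inner y (e i) = exp (- max 0 t * \<Lambda> i) * inner x (e i)"
    by (rule weighted_permutation_exists[OF bij_id, of "\<lambda>i. exp (- max 0 t * \<Lambda> i)" 1 x])
       (use assms in auto)
  then have "\<forall>i. inner (diagonal_semigroup \<Lambda> t x) (e i) = exp (- max 0 t * \<Lambda> i) * inner x (e i)"
    unfolding diagonal_semigroup_def by (rule_tac someI) blast
  with assms(2) show ?thesis
    by simp
qed

lemma norm_diagonal_semigroup_le:
  assumes "\<And>i. \<Lambda> i \<ge> 0" "t \<ge> 0"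
  shows "norm (diagonal_semigroup \<Lambda> t x) \<le> norm x"
  using multiplier_norm_le[of "\<lambda>i. exp (- t * \<Lambda> i)" 1 "diagonal_semigroup \<Lambda> t x" x]
    inner_diagonal_semigroup[of \<Lambda> t x, OF assms] assms by simp

lemma C0_diagonal_semigroup:
  assumes \<Lambda>: "\<And>i. \<Lambda> i \<ge> 0"
  shows "C0_semigroup UNIV (diagonal_semigroup \<Lambda>)"
  unfolding C0_semigroup_def
proof (intro conjI allI impI ballI)
  let ?T = "diagonal_semigroup \<Lambda>"
  note T = inner_diagonal_semigroup[of \<Lambda>, OF \<Lambda>]
  show "?T t x \<in> UNIV" for t x by simp
  show "?T t (a *\<^sub>R x + b *\<^sub>R y) = a *\<^sub>R ?T t x + b *\<^sub>R ?T t y" if "t \<ge> 0" for t a b x y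
    by (rule eqI) (use that in \<open>simp add: T inner_add_left algebra_simps\<close>)
  show "\<exists>M. \<forall>x\<in>UNIV. norm (?T t x) \<le> M * norm x" if "t \<ge> 0" for t
    by (rule exI[of _ 1]) (use norm_diagonal_semigroup_le \<Lambda> that in auto)
  show "?T 0 x = x" for x
    by (rule eqI) (simp add: T)
  show "?T (s + t) x = ?T s (?T t x)" if "s \<ge> 0" "t \<ge> 0" for s t x
    proof (rule eqI)
    have "exp (- (s + t) * \<Lambda> i) = exp (- s * \<Lambda> i) * exp (- t * \<Lambda> i)" for i
      by (simp add: algebra_simps flip: exp_add)
    then show "inner (?T (s + t) x) (e i) = inner (?T s (?T t x)) (e i)" for i
      using that by (simp add: T)
  qed
  show "((\<lambda>t. ?T t x) \<longlongrightarrow> x) (at_right 0)" for x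
  proof (rule Lim_null[THEN iffD2], rule multiplier_tendsto_0[where C=1 and x=x])
    show "((\<lambda>t. exp (- t * \<Lambda> i) - 1) \<longlongrightarrow> 0) (at_right 0)" for i
      by (rule tendsto_eq_intros refl | simp)+
    have "\<bar>exp (- t * \<Lambda> i) - 1\<bar> \<le> 1" if "t > 0" for t i
      using \<Lambda>[of i] that by (simp add: abs_le_iff add_increasing2 order_trans[of _ 1])
    then show "eventually (\<lambda>t. \<forall>i. \<bar>exp (- t * \<Lambda> i) - 1\<bar> \<le> 1) (at_right 0)"
      by (auto simp: eventually_at_filter)
    show "eventually (\<lambda>t. \<forall>i. inner (?T t x - x) (e i) = (exp (- t * \<Lambda> i) - 1) * inner x (e i))
        (at_right 0)"
      by (auto simp: eventually_at_filter T inner_diff_left algebra_simps)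
  qed
qed

text \<open>The domain is the largest conceivable one: all \<open>x\<close> whose formal image
  coefficients belong to a vector. Taking coefficients gives one inclusion; for the other, the error
  of the difference quotient is a bounded multiplier applied to \<open>y\<close> rather than to
  \<open>x\<close>.\<close>

lemma generator_diagonal_semigroup:
  assumes \<Lambda>: "\<And>i. \<Lambda> i \<ge> 0"
  shows "generator UNIV (diagonal_semigroup \<Lambda>) =
    {(x, y). \<forall>i. inner y (e i) = - \<Lambda> i * inner x (e i)}"
proof -
  let ?T = "diagonal_semigroup \<Lambda>"
  note T = inner_diagonal_semigroup[of \<Lambda>, OF \<Lambda>]
  have deriv: "((\<lambda>h. (exp (- h * l) - 1) / h) \<longlongrightarrow> - l) (at_right 0)" for l :: real
  proof -
    have "((\<lambda>h. exp (- h * l)) has_real_derivative - l) (at 0)"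
      by (rule derivative_eq_intros refl | simp)+
    then have "((\<lambda>h. (exp (- h * l) - 1) / h) \<longlongrightarrow> - l) (at 0)"
      by (simp add: DERIV_def)
    then show ?thesis
      by (rule filterlim_mono) (simp_all add: at_le)
  qed
  have "inner y (e i) = - \<Lambda> i * inner x (e i)"
    if lim: "((\<lambda>h. (?T h x - x) /\<^sub>R h) \<longlongrightarrow> y) (at_right 0)" for x y i
  proof -
    have "((\<lambda>h. inner ((?T h x - x) /\<^sub>R h) (e i)) \<longlongrightarrow> inner y (e i)) (at_right 0)"
      by (intro tendsto_intros lim)
    moreover have "((\<lambda>h. (exp (- h * \<Lambda> i) - 1) / h * inner x (e i)) \<longlongrightarrow> - \<Lambda> i * inner x (e i)) (at_right 0)"
      by (intro tendsto_intros deriv)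
    then have "((\<lambda>h. inner ((?T h x - x) /\<^sub>R h) (e i)) \<longlongrightarrow> - \<Lambda> i * inner x (e i)) (at_right 0)"
      by (rule Lim_transform_eventually)
         (auto simp: eventually_at_filter T inner_diff_left field_simps)
    ultimately show ?thesis
      by (rule tendsto_unique[OF trivial_limit_at_right_real])
  qed
  moreover have "((\<lambda>h. (?T h x - x) /\<^sub>R h) \<longlongrightarrow> y) (at_right 0)"
    if y: "\<And>i. inner y (e i) = - \<Lambda> i * inner x (e i)" for x y
  proof (rule Lim_null[THEN iffD2])
    \<comment> \<open>Relative error of the difference quotient, as a factor on the coefficients of
      \<open>y\<close>. For h > 0 it lies in [-1, 0], since 0 <= 1 - exp (-p) <= p for p >= 0. Where
      \<open>\<Lambda> i = 0\<close> the coefficient of \<open>y\<close> vanishes, so 0 is a correct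
      factor.\<close>
    define m where "m h i = (if \<Lambda> i = 0 then 0 else (1 - exp (- h * \<Lambda> i)) / (h * \<Lambda> i) - 1)" for h i
    show "((\<lambda>h. (?T h x - x) /\<^sub>R h - y) \<longlongrightarrow> 0) (at_right 0)"
    proof (rule multiplier_tendsto_0[where C=1 and x=y and m=m])
      show "((\<lambda>h. m h i) \<longlongrightarrow> 0) (at_right 0)" for i
      proof (cases "\<Lambda> i = 0")
        case False
        have "((\<lambda>h. ((exp (- h * \<Lambda> i) - 1) / h) / (- \<Lambda> i) - 1) \<longlongrightarrow> (- \<Lambda> i) / (- \<Lambda> i) - 1) (at_right 0)"
          using False by (intro tendsto_intros deriv) auto
        moreover have "((exp (- h * \<Lambda> i) - 1) / h) / (- \<Lambda> i) - 1 = m h i" for h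
          using False by (cases "h = 0") (auto simp: m_def field_simps)
        ultimately show ?thesis
          using False by simp
      qed (simp add: m_def)
      have "\<bar>m h i\<bar> \<le> 1" if "h > 0" for h i
      proof (cases "\<Lambda> i = 0")
        case False
        then have p: "h * \<Lambda> i > 0"
          using \<Lambda>[of i] that by (simp add: less_le)
        have "1 - exp (- h * \<Lambda> i) \<le> h * \<Lambda> i"
          using exp_ge_add_one_self[of "- h * \<Lambda> i"] by simp
        moreover have "0 \<le> 1 - exp (- h * \<Lambda> i)"
          using p by simp
        ultimately have "0 \<le> (1 - exp (- h * \<Lambda> i)) / (h * \<Lambda> i)" "(1 - exp (- h * \<Lambda> i)) / (h * \<Lambda> i) \<le> 1"
          using p by (auto simp del: mult_minus_left)
        then show ?thesis
          using False by (simp add: m_def)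
      qed (simp add: m_def)
      then show "eventually (\<lambda>h. \<forall>i. \<bar>m h i\<bar> \<le> 1) (at_right 0)"
        by (auto simp: eventually_at_filter)
      have "inner ((?T h x - x) /\<^sub>R h - y) (e i) = m h i * inner y (e i)" if "h > 0" for h i
      proof -
        have "inner ((?T h x - x) /\<^sub>R h - y) (e i) =
            (exp (- h * \<Lambda> i) - 1) * inner x (e i) / h + \<Lambda> i * inner x (e i)"
          using that by (simp add: T inner_diff_left y divide_inverse algebra_simps)
        also have "\<dots> = m h i * inner y (e i)"
          using that by (simp add: y m_def field_simps)
        finally show ?thesis .
      qed
      then show "eventually (\<lambda>h. \<forall>i. inner ((?T h x - x) /\<^sub>R h - y) (e i) = m h i * inner y (e i)) (at_right 0)"
        by (auto simp: eventually_at_filter)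
    qed
  qed
  ultimately show ?thesis
    unfolding generator_def by blast
qed

end

section \<open>Bounded perturbations of contraction semigroups\<close>

locale perturbed_contraction_semigroup =
  fixes T :: "real \<Rightarrow> 'a::banach \<Rightarrow> 'a" and B :: "'a \<Rightarrow> 'a"
  assumes semigroup: "C0_semigroup UNIV T"
    and contraction: "t \<ge> 0 \<Longrightarrow> norm (T t x) \<le> norm x"
    and B: "bounded_linear B"
begin

lemma T_linear: "t \<ge> 0 \<Longrightarrow> T t (a *\<^sub>R x + b *\<^sub>R y) = a *\<^sub>R T t x + b *\<^sub>R T t y"
  and T_0: "T 0 x = x"
  and T_add: "s \<ge> 0 \<Longrightarrow> t \<ge> 0 \<Longrightarrow> T (s + t) x = T s (T t x)"
  and T_tendsto: "((\<lambda>t. T t x) \<longlongrightarrow> x) (at_right 0)"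
  using semigroup by (auto simp: C0_semigroup_def)

lemma bounded_linear_T:
  assumes "t \<ge> 0"
  shows "bounded_linear (T t)"
proof (rule bounded_linear_intro)
  show "T t (x + y) = T t x + T t y" for x y
    using T_linear[OF assms, of 1 x 1 y] by simp
  show "T t (r *\<^sub>R x) = r *\<^sub>R T t x" for r x
    using T_linear[OF assms, of r x 0 x] by simp
  show "norm (T t x) \<le> norm x * 1" for x
    using contraction[OF assms] by simp
qed

text \<open>Contractivity reduces joint continuity in time and space to the displacement of the
  single orbit of \<open>y\<close> during the short time |t - s|.\<close>

lemma T_diff_le:
  assumes "s \<ge> 0" "t \<ge> 0"
  shows "norm (T t x - T s y) \<le> norm (x - y) + norm (T \<bar>t - s\<bar> y - y)"
proof -
  have *: "norm (T (r + d) y - T r y) \<le> norm (T d y - y)" if "r \<ge> 0" "d \<ge> 0" for r d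
    using contraction[OF that(1), of "T d y - y"] that
    by (simp add: T_add linear_diff[OF bounded_linear.linear[OF bounded_linear_T]])
  have "norm (T t y - T s y) \<le> norm (T \<bar>t - s\<bar> y - y)"
    using *[of s "t - s"] *[of t "s - t"] assms by (cases "s \<le> t") (auto simp: norm_minus_commute)
  moreover have "norm (T t x - T t y) \<le> norm (x - y)"
    using contraction[OF assms(2), of "x - y"]
    by (simp add: linear_diff[OF bounded_linear.linear[OF bounded_linear_T[OF assms(2)]]])
  ultimately show ?thesis
    using norm_triangle_ineq[of "T t x - T t y" "T t y - T s y"] by simp
qed

text \<open>No axiom constrains \<open>T\<close> at negative times; the truncation gives continuity
  on the whole product space, so that Duhamel integrands can be treated on full rectangles.\<close>

lemma continuous_T: "continuous_on UNIV (\<lambda>(t, x). T (max 0 t) x)"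
proof -
  have "((\<lambda>p. T (max 0 (fst p)) (snd p)) \<longlongrightarrow> T (max 0 s) y) (at (s, y))" for s y
  proof (rule Lim_null[THEN iffD2], rule Lim_null_comparison)
    show "eventually (\<lambda>p. norm (T (max 0 (fst p)) (snd p) - T (max 0 s) y)
        \<le> norm (snd p - y) + norm (T \<bar>max 0 (fst p) - max 0 s\<bar> y - y)) (at (s, y))"
      by (simp add: T_diff_le)
    have cont: "continuous (at 0 within {0..}) (\<lambda>t. norm (T t y - y))"
      using T_tendsto[of y, THEN Lim_null[THEN iffD1]]
      by (simp add: continuous_within T_0 at_within_Ici_at_right tendsto_norm_zero)
    have "((\<lambda>p::real \<times> 'a. \<bar>max 0 (fst p) - max 0 s\<bar>) \<longlongrightarrow> \<bar>max 0 (fst (s, y)) - max 0 s\<bar>) (at (s, y))"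
      by (intro tendsto_intros)
    then have lim: "((\<lambda>p::real \<times> 'a. \<bar>max 0 (fst p) - max 0 s\<bar>) \<longlongrightarrow> 0) (at (s, y))"
      by simp
    have "((\<lambda>p::real \<times> 'a. norm (T \<bar>max 0 (fst p) - max 0 s\<bar> y - y)) \<longlongrightarrow>
        norm (T 0 y - y)) (at (s, y))"
      by (rule continuous_within_tendsto_compose[OF cont _ lim]) simp
    moreover have "((\<lambda>p. norm (snd p - y)) \<longlongrightarrow> norm (snd (s, y) - y)) (at (s, y))"
      by (intro tendsto_intros)
    ultimately have "((\<lambda>p. norm (snd p - y) + norm (T \<bar>max 0 (fst p) - max 0 s\<bar> y - y)) \<longlongrightarrow>
        norm (snd (s, y) - y) + norm (T 0 y - y)) (at (s, y))"
      by (rule tendsto_add[rotated])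
    then show "((\<lambda>p. norm (snd p - y) + norm (T \<bar>max 0 (fst p) - max 0 s\<bar> y - y)) \<longlongrightarrow> 0) (at (s, y))"
      by (simp add: T_0)
  qed
  then show ?thesis
    by (auto simp: continuous_on_def case_prod_unfold)
qed

lemma continuous_T_compose:
  assumes f: "continuous_on X f" and g: "continuous_on X g" and "\<And>x. x \<in> X \<Longrightarrow> f x \<ge> 0"
  shows "continuous_on X (\<lambda>x. T (f x) (g x))"
proof -
  have "continuous_on X (\<lambda>x. T (max 0 (f x)) (g x))"
    using continuous_on_compose2[OF continuous_T continuous_on_Pair[OF f g]] by simp
  then show ?thesis
    by (rule continuous_on_cong[THEN iffD1, rotated 2]) (use assms(3) in auto)
qed

lemmas continuous_B_compose = bounded_linear.continuous_on[OF B]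

definition duhamel :: "(real \<Rightarrow> 'a) \<Rightarrow> real \<Rightarrow> 'a" where
  "duhamel u t = integral {0..t} (\<lambda>s. T (t - s) (B (u s)))"

lemma integrable_duhamel:
  assumes "continuous_on {0..t} u"
  shows "(\<lambda>s. T (t - s) (B (u s))) integrable_on {0..t}"
  by (intro integrable_continuous_interval continuous_T_compose continuous_B_compose
      continuous_intros assms) auto

text \<open>Here t is both the upper limit and a parameter of the integrand. With the truncated time
  \<open>max 0 (t - s)\<close> the integral extends to a fixed interval [0, a]; on the added piece
  [t, a] the semigroup is the identity, so the excess is a plain indefinite integral of
  \<open>B (u s)\<close>, which is subtracted again.\<close>

lemma continuous_duhamel:
  assumes u: "continuous_on {0..} u"
  shows "continuous_on {0..} (duhamel u)"
proof -
  have on: "continuous_on {0..a} (duhamel u)" if "a \<ge> 0" for a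
  proof -
    have u': "continuous_on {0..a} u"
      by (rule continuous_on_subset[OF u]) auto
    let ?F = "\<lambda>t s. T (max 0 (t - s)) (B (u s))"
    have "continuous_on ({0..a} \<times> cbox 0 a) (\<lambda>(t, s). ?F t s)"
      unfolding case_prod_unfold
      by (intro continuous_T_compose continuous_B_compose continuous_on_compose2[OF u'] continuous_intros) auto
    then have 1: "continuous_on {0..a} (\<lambda>t. integral {0..a} (?F t))"
      using integral_continuous_on_param[of "{0..a}" 0 a ?F] by simp
    have "(\<lambda>s. B (u s)) integrable_on {0..a}"
      by (intro integrable_continuous_interval continuous_B_compose u')
    then have 2: "continuous_on {0..a} (\<lambda>t. integral {t..a} (\<lambda>s. B (u s)))"
      by (rule indefinite_integral_continuous_1')
    have "integral {0..a} (?F t) - integral {t..a} (\<lambda>s. B (u s)) = duhamel u t" if "t \<in> {0..a}" for t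
    proof -
      have "?F t integrable_on {0..a}"
        by (intro integrable_continuous_interval continuous_T_compose continuous_B_compose
            continuous_intros u') auto
      then have "integral {0..a} (?F t) = integral {0..t} (?F t) + integral {t..a} (?F t)"
        using Henstock_Kurzweil_Integration.integral_combine[where f="?F t" and a=0 and c=t and b=a] that by simp
      moreover have "integral {0..t} (?F t) = duhamel u t"
        unfolding duhamel_def by (rule integral_cong) auto
      moreover have "integral {t..a} (?F t) = integral {t..a} (\<lambda>s. B (u s))"
        by (rule integral_cong) (auto simp: T_0)
      ultimately show ?thesis
        by simp
    qed
    with continuous_on_diff[OF 1 2] show ?thesis
      by (rule continuous_on_eq)
  qed
  have "continuous (at t within {0..}) (duhamel u)" if "t \<ge> 0" for t
  proof -
    have "at t within {0..} = at t within {0..t + 1}"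
      by (rule at_within_nhd[where S="{..<t + 1}"]) auto
    with on[of "t + 1"] that show ?thesis
      by (simp add: continuous_on_eq_continuous_within)
  qed
  then show ?thesis
    by (simp add: continuous_on_eq_continuous_within)
qed

text \<open>The growth rate \<open>L\<close> is chosen so large that \<^const>\<open>duhamel\<close> halves the weighted norm
  \<open>sup exp (- L * t) * norm (u t)\<close>.\<close>

definition L :: real where
  "L = 2 * (SOME K. 0 < K \<and> (\<forall>x. norm (B x) \<le> norm x * K))"

lemma L_pos: "L > 0" and norm_B_le: "norm (B x) \<le> L / 2 * norm x"
proof -
  have "\<exists>K. 0 < K \<and> (\<forall>x. norm (B x) \<le> norm x * K)"
    using bounded_linear.pos_bounded[OF B] by blast
  from someI_ex[OF this] have "0 < L / 2 \<and> (\<forall>x. norm (B x) \<le> norm x * (L / 2))"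
    by (simp add: L_def)
  then show "L > 0" "norm (B x) \<le> L / 2 * norm x"
    by (auto simp: mult.commute)
qed

text \<open>The integrand is at most L N / 2 times exp (L s), whose integral over [0, t] is N / 2
  times exp (L t) - 1.\<close>

lemma norm_duhamel_le:
  assumes u: "continuous_on {0..t} u" and t: "t \<ge> 0"
    and N: "\<And>s. s \<in> {0..t} \<Longrightarrow> norm (u s) \<le> N * exp (L * s)"
  shows "norm (duhamel u t) \<le> N / 2 * exp (L * t)"
proof -
  have N0: "N \<ge> 0"
    using N[of 0] t norm_ge_zero[of "u 0"] by (auto simp del: norm_ge_zero intro: order_trans)
  have int: "((\<lambda>s. L * N / 2 * exp (L * s)) has_integral (N / 2 * exp (L * t) - N / 2 * exp (L * 0))) {0..t}"
    using t by (intro fundamental_theorem_of_calculus)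
      (auto intro!: derivative_eq_intros simp flip: has_real_derivative_iff_has_vector_derivative)
  have "norm (duhamel u t) \<le> integral {0..t} (\<lambda>s. L * N / 2 * exp (L * s))"
    unfolding duhamel_def
  proof (rule integral_norm_bound_integral[OF integrable_duhamel[OF u] has_integral_integrable[OF int]])
    show "norm (T (t - s) (B (u s))) \<le> L * N / 2 * exp (L * s)" if "s \<in> {0..t}" for s
    proof -
      have "norm (T (t - s) (B (u s))) \<le> L / 2 * norm (u s)"
        using contraction[of "t - s" "B (u s)"] norm_B_le[of "u s"] that by simp
      also have "\<dots> \<le> L / 2 * (N * exp (L * s))"
        using N[OF that] L_pos by (intro mult_left_mono) auto
      finally show ?thesis
        by simp
    qed
  qed
  then show ?thesis
    using N0 unfolding integral_unique[OF int] by simp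
qed

text \<open>Plays the part of Gronwall's inequality: the weighted norm attains its maximum
  \<open>N\<close> on [0, t], and the halving property gives N <= c + N / 2. The choice c = 0 yields
  uniqueness, c = \<open>norm x\<close> the growth bound.\<close>

lemma duhamel_growth:
  assumes u: "continuous_on {0..} u" and t: "t \<ge> 0"
    and c: "\<And>s. s \<ge> 0 \<Longrightarrow> norm (u s - duhamel u s) \<le> c * exp (L * s)"
  shows "norm (u t) \<le> 2 * c * exp (L * t)"
proof -
  have u': "continuous_on {0..s} u" for s
    by (rule continuous_on_subset[OF u]) auto
  have "continuous_on {0..t} (\<lambda>s. exp (- L * s) * norm (u s))"
    by (intro continuous_intros u')
  then obtain r where r: "r \<in> {0..t}"
    "\<And>s. s \<in> {0..t} \<Longrightarrow> exp (- L * s) * norm (u s) \<le> exp (- L * r) * norm (u r)"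
    using continuous_attains_sup[of "{0..t}"] t by force
  define N where "N = exp (- L * r) * norm (u r)"
  have N: "norm (u s) \<le> N * exp (L * s)" if "s \<in> {0..t}" for s
    using mult_right_mono[OF r(2)[OF that], of "exp (L * s)"] by (simp add: N_def exp_minus field_simps)
  have "norm (u r) \<le> norm (u r - duhamel u r) + norm (duhamel u r)"
    using norm_triangle_ineq[of "u r - duhamel u r" "duhamel u r"] by simp
  also have "\<dots> \<le> c * exp (L * r) + N / 2 * exp (L * r)"
    using r(1) by (intro add_mono c norm_duhamel_le u' N) auto
  finally have "N \<le> c + N / 2"
    by (simp add: N_def exp_minus field_simps)
  then have "N \<le> 2 * c"
    by simp
  then have "N * exp (L * t) \<le> 2 * c * exp (L * t)"
    by (intro mult_right_mono) auto
  then show ?thesis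
    using N[of t] t by (auto intro: order_trans)
qed

lemma duhamel_linear:
  assumes u: "continuous_on {0..t} u" and v: "continuous_on {0..t} v"
  shows "duhamel (\<lambda>s. a *\<^sub>R u s + b *\<^sub>R v s) t = a *\<^sub>R duhamel u t + b *\<^sub>R duhamel v t"
proof -
  have "duhamel (\<lambda>s. a *\<^sub>R u s + b *\<^sub>R v s) t =
      integral {0..t} (\<lambda>s. a *\<^sub>R T (t - s) (B (u s)) + b *\<^sub>R T (t - s) (B (v s)))"
    unfolding duhamel_def
    by (rule integral_cong)
       (simp add: T_linear linear_add[OF bounded_linear.linear[OF B]] linear_cmul[OF bounded_linear.linear[OF B]])
  also have "\<dots> = a *\<^sub>R duhamel u t + b *\<^sub>R duhamel v t"
    unfolding duhamel_def
    by (simp add: integral_add integrable_cmul integrable_duhamel u v)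
  finally show ?thesis .
qed

definition mild_solution :: "'a \<Rightarrow> (real \<Rightarrow> 'a) \<Rightarrow> bool" where
  "mild_solution x u \<longleftrightarrow> continuous_on {0..} u \<and> (\<forall>t\<ge>0. u t = T t x + duhamel u t)"

lemma mild_solution_unique:
  assumes u: "mild_solution x u" and v: "mild_solution x v" and t: "t \<ge> 0"
  shows "u t = v t"
proof -
  have c: "continuous_on {0..} u" "continuous_on {0..} v"
    using u v by (auto simp: mild_solution_def)
  have "norm (1 *\<^sub>R u t + (-1) *\<^sub>R v t) \<le> 2 * 0 * exp (L * t)"
  proof (rule duhamel_growth[OF _ t])
    show "continuous_on {0..} (\<lambda>t. 1 *\<^sub>R u t + (-1) *\<^sub>R v t)"
      by (intro continuous_intros c)
    have "duhamel (\<lambda>t. 1 *\<^sub>R u t + (-1) *\<^sub>R v t) s = 1 *\<^sub>R duhamel u s + (-1) *\<^sub>R duhamel v s" for s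
      by (rule duhamel_linear) (auto intro: continuous_on_subset[OF c(1)] continuous_on_subset[OF c(2)])
    then show "norm (1 *\<^sub>R u s + (-1) *\<^sub>R v s - duhamel (\<lambda>t. 1 *\<^sub>R u t + (-1) *\<^sub>R v t) s) \<le> 0 * exp (L * s)"
      if "s \<ge> 0" for s
      using u v that by (simp add: mild_solution_def)
  qed
  then show ?thesis
    by simp
qed

lemma mild_solution_growth:
  assumes u: "mild_solution x u" and t: "t \<ge> 0"
  shows "norm (u t) \<le> 2 * norm x * exp (L * t)"
proof (rule duhamel_growth[OF _ t])
  show "continuous_on {0..} u"
    using u by (simp add: mild_solution_def)
  show "norm (u s - duhamel u s) \<le> norm x * exp (L * s)" if "s \<ge> 0" for s
  proof -
    have "u s - duhamel u s = T s x"
      using u that by (simp add: mild_solution_def)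
    moreover have "norm x \<le> norm x * exp (L * s)"
      using L_pos that by (simp add: mult_le_cancel_left1)
    ultimately show ?thesis
      using contraction[OF that, of x] by simp
  qed
qed

text \<open>Banach's fixed point theorem for the weighted unknown
  \<open>w t = exp (- L * t) *\<^sub>R u t\<close>; the weight gives a contraction on the entire
  half-line at once. Bounded continuous functions live on all of the reals, hence the constant
  extension to negative times through \<open>max 0 t\<close>.\<close>

lemma mild_solution_exists:
  obtains u where "mild_solution x u"
proof -
  define lift where "lift w s = exp (L * s) *\<^sub>R w s" for w :: "real \<Rightarrow>\<^sub>C 'a" and s
  define \<Phi> where "\<Phi> w t = exp (- L * max 0 t) *\<^sub>R (T (max 0 t) x + duhamel (lift w) (max 0 t))" for w t
  have lift: "continuous_on X (lift w)" for X w
    unfolding lift_def by (intro continuous_intros continuous_on_apply_bcontfun)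
  have cont: "continuous_on UNIV (\<Phi> w)" for w
  proof -
    have "continuous_on UNIV (\<lambda>t. duhamel (lift w) (max 0 t))"
      by (rule continuous_on_compose2[OF continuous_duhamel[OF lift]]) (auto intro!: continuous_intros)
    then show ?thesis
      unfolding \<Phi>_def by (intro continuous_intros continuous_T_compose) auto
  qed
  have weight: "exp (- L * s) * (N * exp (L * s)) = N" for N s
    by (simp add: exp_minus field_simps)
  have bound: "norm (\<Phi> w t) \<le> norm x + norm w / 2" for w t
  proof -
    let ?s = "max 0 t"
    have "norm (T ?s x) \<le> norm x * exp (L * ?s)"
      using contraction[of ?s x] L_pos by (simp add: order_trans mult_le_cancel_left1)
    moreover have "norm (duhamel (lift w) ?s) \<le> norm w / 2 * exp (L * ?s)"
      by (rule norm_duhamel_le[OF lift]) (auto simp: lift_def mult.commute norm_bounded)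
    ultimately have "norm (T ?s x + duhamel (lift w) ?s) \<le> (norm x + norm w / 2) * exp (L * ?s)"
      by (intro norm_triangle_le) (simp add: algebra_simps)
    then have "norm (\<Phi> w t) \<le> exp (- L * ?s) * ((norm x + norm w / 2) * exp (L * ?s))"
      unfolding \<Phi>_def norm_scaleR abs_exp_cancel by (intro mult_left_mono) auto
    then show ?thesis
      unfolding weight .
  qed
  then have \<Phi>: "apply_bcontfun (Bcontfun (\<Phi> w)) = \<Phi> w" for w
    by (intro Bcontfun_inverse bcontfun_normI[OF cont])
  have "dist (Bcontfun (\<Phi> w)) (Bcontfun (\<Phi> w')) \<le> 1 / 2 * dist w w'" for w w'
  proof (rule dist_bound)
    fix t :: real
    let ?s = "max 0 t"
    have "duhamel (lift w) ?s - duhamel (lift w') ?s = duhamel (\<lambda>s. 1 *\<^sub>R lift w s + (-1) *\<^sub>R lift w' s) ?s"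
      by (subst duhamel_linear) (auto intro: lift)
    also have "norm \<dots> \<le> dist w w' / 2 * exp (L * ?s)"
    proof (rule norm_duhamel_le)
      show "norm (1 *\<^sub>R lift w s + (-1) *\<^sub>R lift w' s) \<le> dist w w' * exp (L * s)" for s
        using mult_left_mono[OF dist_bounded[of w s w'], of "exp (L * s)"]
        by (simp add: lift_def dist_norm mult.commute flip: scaleR_diff_right)
    qed (auto intro!: continuous_intros lift)
    finally have *: "norm (duhamel (lift w) ?s - duhamel (lift w') ?s) \<le> dist w w' / 2 * exp (L * ?s)" .
    have "dist (\<Phi> w t) (\<Phi> w' t) = exp (- L * ?s) * norm (duhamel (lift w) ?s - duhamel (lift w') ?s)"
      by (simp add: \<Phi>_def dist_norm flip: scaleR_diff_right)
    also have "\<dots> \<le> exp (- L * ?s) * (dist w w' / 2 * exp (L * ?s))"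
      by (intro mult_left_mono *) simp
    finally have "dist (\<Phi> w t) (\<Phi> w' t) \<le> dist w w' / 2"
      unfolding weight .
    then show "dist (apply_bcontfun (Bcontfun (\<Phi> w)) t) (apply_bcontfun (Bcontfun (\<Phi> w')) t) \<le> 1 / 2 * dist w w'"
      by (simp add: \<Phi>)
  qed
  then have "\<exists>!w. Bcontfun (\<Phi> w) = w"
    by (intro banach_fix_type[of "1 / 2"]) auto
  then obtain w where "Bcontfun (\<Phi> w) = w"
    by blast
  then have w: "apply_bcontfun w t = \<Phi> w t" for t
    using \<Phi>[of w] by metis
  have "lift w t = T t x + duhamel (lift w) t" if "t \<ge> 0" for t
    using w[of t] that by (simp add: lift_def[of w t] \<Phi>_def exp_minus max_absorb2)
  then have "mild_solution x (lift w)"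
    by (simp add: mild_solution_def lift)
  then show ?thesis
    by (rule that)
qed

definition S :: "real \<Rightarrow> 'a \<Rightarrow> 'a" where
  "S t x = (SOME u. mild_solution x u) t"

lemma mild_solution_S: "mild_solution x (\<lambda>t. S t x)"
  unfolding S_def by (metis mild_solution_exists someI)

lemma S_continuous: "continuous_on {0..} (\<lambda>t. S t x)"
  and S_eq: "t \<ge> 0 \<Longrightarrow> S t x = T t x + duhamel (\<lambda>s. S s x) t"
  using mild_solution_S[of x] by (auto simp: mild_solution_def)

lemma S_0: "S 0 x = x"
  using S_eq[of 0 x] by (simp add: T_0 duhamel_def)

lemma S_linear:
  assumes "t \<ge> 0"
  shows "S t (a *\<^sub>R x + b *\<^sub>R y) = a *\<^sub>R S t x + b *\<^sub>R S t y"
proof (rule mild_solution_unique[OF mild_solution_S _ assms])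
  have "duhamel (\<lambda>t. a *\<^sub>R S t x + b *\<^sub>R S t y) t = a *\<^sub>R duhamel (\<lambda>t. S t x) t + b *\<^sub>R duhamel (\<lambda>t. S t y) t" for t
    by (rule duhamel_linear) (auto intro: continuous_on_subset[OF S_continuous])
  moreover have "T t (a *\<^sub>R x + b *\<^sub>R y) = a *\<^sub>R (S t x - duhamel (\<lambda>t. S t x) t)
      + b *\<^sub>R (S t y - duhamel (\<lambda>t. S t y) t)" if "t \<ge> 0" for t
    using S_eq[OF that, of x] S_eq[OF that, of y] that by (simp add: T_linear)
  ultimately show "mild_solution (a *\<^sub>R x + b *\<^sub>R y) (\<lambda>t. a *\<^sub>R S t x + b *\<^sub>R S t y)"
    by (auto simp: mild_solution_def scaleR_diff_right intro!: continuous_intros S_continuous)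
qed

text \<open>By uniqueness it suffices that the orbit of \<open>x\<close> shifted by t is the mild
  solution starting at \<open>S t x\<close>: the Duhamel integral is split at time t and
  \<open>T s\<close> is pulled out of the first piece.\<close>

lemma S_add:
  assumes s: "s \<ge> 0" and t: "t \<ge> 0"
  shows "S (s + t) x = S s (S t x)"
proof (rule mild_solution_unique[OF _ mild_solution_S s])
  have "S (s + t) x = T s (S t x) + duhamel (\<lambda>s. S (s + t) x) s" if s: "s \<ge> 0" for s
  proof -
    let ?f = "\<lambda>r. T (s + t - r) (B (S r x))"
    have int: "?f integrable_on {0..s + t}"
      by (rule integrable_duhamel) (rule continuous_on_subset[OF S_continuous], auto)
    have "duhamel (\<lambda>r. S r x) (s + t) = integral {0..t} ?f + integral {t..s + t} ?f"
      unfolding duhamel_def using Henstock_Kurzweil_Integration.integral_combine[where f="?f" and a=0 and c=t and b="s + t"] s t int by simp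
    also have "integral {t..s + t} ?f = duhamel (\<lambda>r. S (r + t) x) s"
      using integral_shift_real_ivl[of t t "s + t" ?f] by (simp add: duhamel_def algebra_simps)
    also have "integral {0..t} ?f = integral {0..t} (T s \<circ> (\<lambda>r. T (t - r) (B (S r x))))"
      using s by (intro integral_cong) (simp add: algebra_simps flip: T_add)
    also have "\<dots> = T s (duhamel (\<lambda>r. S r x) t)"
      unfolding duhamel_def
      by (intro integral_linear integrable_duhamel bounded_linear_T s)
         (rule continuous_on_subset[OF S_continuous], auto)
    finally have "S (s + t) x = T (s + t) x + (T s (duhamel (\<lambda>r. S r x) t) + duhamel (\<lambda>r. S (r + t) x) s)"
      using s t by (simp add: S_eq[of "s + t" x])
    moreover have "T (s + t) x + T s (duhamel (\<lambda>r. S r x) t) = T s (S t x)"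
      using s t by (simp add: T_add S_eq[of t x] linear_add[OF bounded_linear.linear[OF bounded_linear_T]])
    ultimately show ?thesis
      by simp
  qed
  moreover have "continuous_on {0..} (\<lambda>s. S (s + t) x)"
    by (rule continuous_on_compose2[OF S_continuous]) (use t in \<open>auto intro!: continuous_intros\<close>)
  ultimately show "mild_solution (S t x) (\<lambda>s. S (s + t) x)"
    by (simp add: mild_solution_def)
qed

lemma C0_semigroup_S: "C0_semigroup UNIV S"
  unfolding C0_semigroup_def
proof (intro conjI allI impI ballI)
  show "S t x \<in> UNIV" for t x by simp
  show "\<exists>M. \<forall>x\<in>UNIV. norm (S t x) \<le> M * norm x" if "t \<ge> 0" for t
    using mild_solution_growth[OF mild_solution_S that]
    by (intro exI[of _ "2 * exp (L * t)"]) (simp add: mult_ac)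
  show "((\<lambda>t. S t x) \<longlongrightarrow> x) (at_right 0)" for x
    using S_continuous[of x] by (auto simp: continuous_on_def S_0 at_within_Ici_at_right dest: bspec[of _ _ 0])
qed (simp_all add: S_linear S_0 S_add)

text \<open>The integrand is jointly continuous in (h, s) and equals \<open>B x\<close> at the
  origin, so its mean over [0, h] tends to that value.\<close>

lemma duhamel_average_tendsto: "((\<lambda>h. duhamel (\<lambda>s. S s x) h /\<^sub>R h) \<longlongrightarrow> B x) (at_right 0)"
proof (rule tendstoI)
  fix \<epsilon> :: real assume "\<epsilon> > 0"
  let ?F = "\<lambda>p. T (max 0 (fst p - snd p)) (B (S (max 0 (snd p)) x))"
  have "continuous_on UNIV ?F"
    by (intro continuous_T_compose continuous_B_compose continuous_on_compose2[OF S_continuous] continuous_intros) auto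
  then have "isCont ?F (0, 0)"
    by (simp add: continuous_on_eq_continuous_at)
  then obtain \<delta> where \<delta>: "\<delta> > 0" "\<And>p. dist p (0, 0) < \<delta> \<Longrightarrow> dist (?F p) (?F (0, 0)) < \<epsilon> / 2"
    using \<open>\<epsilon> > 0\<close> unfolding continuous_at_eps_delta by (metis half_gt_zero)
  have "dist (duhamel (\<lambda>s. S s x) h /\<^sub>R h) (B x) < \<epsilon>" if h: "0 < h" "h < \<delta> / 2" for h
  proof -
    let ?f = "\<lambda>s. T (h - s) (B (S s x))"
    have near: "norm (?f s - B x) \<le> \<epsilon> / 2" if s: "s \<in> cbox 0 h" for s
    proof -
      have "dist (h, s) (0, 0) \<le> h + s"
        using sqrt_sum_squares_le_sum[of h s] s h by (simp add: dist_Pair_Pair)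
      then show ?thesis
        using \<delta>(2)[of "(h, s)"] s h by (simp add: dist_norm T_0 S_0)
    qed
    have int: "?f integrable_on {0..h}"
      by (rule integrable_duhamel) (rule continuous_on_subset[OF S_continuous], auto)
    then have "((\<lambda>s. ?f s - B x) has_integral (duhamel (\<lambda>s. S s x) h - h *\<^sub>R B x)) (cbox 0 h)"
      unfolding duhamel_def using h has_integral_const_real[of "B x" 0 h]
      by (intro has_integral_diff) (auto simp: integrable_integral)
    from has_integral_bound[OF _ this near] have "norm (duhamel (\<lambda>s. S s x) h - h *\<^sub>R B x) \<le> \<epsilon> / 2 * h"
      using h \<open>\<epsilon> > 0\<close> by simp
    moreover have avg: "duhamel (\<lambda>s. S s x) h /\<^sub>R h - B x = (duhamel (\<lambda>s. S s x) h - h *\<^sub>R B x) /\<^sub>R h"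
      using h by (simp add: scaleR_diff_right)
    have "dist (duhamel (\<lambda>s. S s x) h /\<^sub>R h) (B x) = norm (duhamel (\<lambda>s. S s x) h - h *\<^sub>R B x) / h"
      unfolding dist_norm avg norm_scaleR using h by (simp only: abs_inverse abs_of_pos divide_inverse mult.commute)
    ultimately have "dist (duhamel (\<lambda>s. S s x) h /\<^sub>R h) (B x) \<le> \<epsilon> / 2"
      using h by (simp only: pos_divide_le_eq)
    then show ?thesis
      using \<open>\<epsilon> > 0\<close> by simp
  qed
  then show "eventually (\<lambda>h. dist (duhamel (\<lambda>s. S s x) h /\<^sub>R h) (B x) < \<epsilon>) (at_right 0)"
    unfolding eventually_at_right_field using \<delta>(1) by (intro exI[of _ "\<delta> / 2"]) auto
qed

text \<open>The difference quotients of \<open>S\<close> and \<open>T\<close> differ by the Duhamel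
  average, which always converges; hence one converges exactly when the other does, and the domains
  agree.\<close>

lemma generator_S: "generator UNIV S = {(x, y + B x) | x y. (x, y) \<in> generator UNIV T}"
proof -
  have *: "((\<lambda>h. (S h x - x) /\<^sub>R h) \<longlongrightarrow> y + B x) (at_right 0) \<longleftrightarrow>
      ((\<lambda>h. (T h x - x) /\<^sub>R h) \<longlongrightarrow> y) (at_right 0)" (is "?l \<longleftrightarrow> ?r") for x y
  proof -
    let ?T = "\<lambda>h. (T h x - x) /\<^sub>R h" and ?D = "\<lambda>h. duhamel (\<lambda>s. S s x) h /\<^sub>R h"
    have eq: "(S h x - x) /\<^sub>R h = ?T h + ?D h" if "h > 0" for h
    proof -
      have "S h x - x = (T h x - x) + duhamel (\<lambda>s. S s x) h"
        using S_eq[of h x] that by simp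
      then show ?thesis
        by (simp only: scaleR_add_right)
    qed
    have "?l \<longleftrightarrow> ((\<lambda>h. ?T h + ?D h) \<longlongrightarrow> y + B x) (at_right 0)"
      using eventually_at_right_less[of "0::real"] by (intro tendsto_cong) (rule eventually_mono, assumption, rule eq)
    also have "\<dots> \<longleftrightarrow> ?r"
    proof
      assume "((\<lambda>h. ?T h + ?D h) \<longlongrightarrow> y + B x) (at_right 0)"
      from tendsto_diff[OF this duhamel_average_tendsto[of x]] show ?r
        by (simp only: add_diff_cancel_right')
    qed (intro tendsto_add duhamel_average_tendsto)
    finally show ?thesis .
  qed
  show ?thesis
  proof (intro set_eqI iffI)
    fix p assume "p \<in> generator UNIV S"
    then obtain x z where p: "p = (x, z)" "((\<lambda>h. (S h x - x) /\<^sub>R h) \<longlongrightarrow> z) (at_right 0)"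
      by (auto simp: generator_def)
    then have "(x, z - B x) \<in> generator UNIV T"
      using *[of x "z - B x"] by (simp add: generator_def)
    then show "p \<in> {(x, y + B x) | x y. (x, y) \<in> generator UNIV T}"
      using p(1) by (intro CollectI exI[of _ x] exI[of _ "z - B x"]) simp
  qed (auto simp: generator_def *)
qed

end

section \<open>Decay of semigroups with dissipative generator\<close>

lemma C0_semigroupD:
  assumes "C0_semigroup X S"
  shows C0_semigroup_closed: "t \<ge> 0 \<Longrightarrow> x \<in> X \<Longrightarrow> S t x \<in> X"
    and C0_semigroup_linear: "t \<ge> 0 \<Longrightarrow> x \<in> X \<Longrightarrow> y \<in> X \<Longrightarrow> S t (a *\<^sub>R x + b *\<^sub>R y) = a *\<^sub>R S t x + b *\<^sub>R S t y"
    and C0_semigroup_bounded: "t \<ge> 0 \<Longrightarrow> \<exists>M. \<forall>x\<in>X. norm (S t x) \<le> M * norm x"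
    and C0_semigroup_0: "x \<in> X \<Longrightarrow> S 0 x = x"
    and C0_semigroup_add: "s \<ge> 0 \<Longrightarrow> t \<ge> 0 \<Longrightarrow> x \<in> X \<Longrightarrow> S (s + t) x = S s (S t x)"
    and C0_semigroup_tendsto: "x \<in> X \<Longrightarrow> ((\<lambda>t. S t x) \<longlongrightarrow> x) (at_right 0)"
  using assms unfolding C0_semigroup_def by blast+

lemma C0_semigroup_diff:
  assumes "C0_semigroup X S" "t \<ge> 0" "x \<in> X" "y \<in> X"
  shows "S t (x - y) = S t x - S t y"
  using C0_semigroup_linear[OF assms, of 1 "-1"] by simp

lemma C0_semigroup_scaleR:
  assumes "C0_semigroup X S" "t \<ge> 0" "x \<in> X"
  shows "S t (c *\<^sub>R x) = c *\<^sub>R S t x"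
  using C0_semigroup_linear[OF assms assms(3), of c 0] by simp

lemma C0_semigroup_continuous_on:
  assumes S: "C0_semigroup X S" and X: "subspace X" and t: "t \<ge> 0"
  shows "continuous_on X (S t)"
proof -
  obtain M where M: "\<And>x. x \<in> X \<Longrightarrow> norm (S t x) \<le> M * norm x"
    using C0_semigroup_bounded[OF S t] by blast
  have "((\<lambda>y. S t y) \<longlongrightarrow> S t x) (at x within X)" if x: "x \<in> X" for x
  proof (rule Lim_null[THEN iffD2], rule Lim_null_comparison)
    have "norm (S t y - S t x) \<le> M * norm (y - x)" if "y \<in> X" for y
      using M[OF subspace_diff[OF X that x]] C0_semigroup_diff[OF S t that x] by simp
    then show "eventually (\<lambda>y. norm (S t y - S t x) \<le> M * norm (y - x)) (at x within X)"
      by (simp add: eventually_at_filter)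
    have "((\<lambda>y. M * norm (y - x)) \<longlongrightarrow> M * norm (x - x)) (at x within X)"
      by (intro tendsto_intros)
    then show "((\<lambda>y. M * norm (y - x)) \<longlongrightarrow> 0) (at x within X)"
      by simp
  qed
  then show ?thesis
    by (simp add: continuous_on_def)
qed

text \<open>Uniform boundedness by the Baire category theorem: \<open>X\<close> is the union of the closed sets
  \<open>E n\<close> of points whose orbit is bounded by \<open>n\<close> up to time \<open>1 / (n + 1)\<close>.\<close>

lemma C0_semigroup_bounded_near_0:
  fixes X :: "'a::banach set"
  assumes S: "C0_semigroup X S" and X: "subspace X" "closed X"
  obtains \<delta> M where "\<delta> > 0" "M \<ge> 0" "\<And>t x. 0 \<le> t \<Longrightarrow> t \<le> \<delta> \<Longrightarrow> x \<in> X \<Longrightarrow> norm (S t x) \<le> M * norm x"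
proof -
  define E where "E n = {x \<in> X. \<forall>t\<in>{0..1 / real (Suc n)}. norm (S t x) \<le> real n}" for n
  have "closed (E n)" for n
  proof -
    have "closed {x \<in> X. norm (S t x) \<le> real n}" if "t \<ge> 0" for t
      using continuous_closed_preimage[OF continuous_on_norm[OF C0_semigroup_continuous_on[OF S X(1) that]] X(2), of "{..real n}"]
      by (simp add: vimage_def Int_def)
    then have "closed (X \<inter> (\<Inter>t\<in>{0..1 / real (Suc n)}. {x \<in> X. norm (S t x) \<le> real n}))"
      using X(2) by (intro closed_Int closed_INT) auto
    also have "X \<inter> (\<Inter>t\<in>{0..1 / real (Suc n)}. {x \<in> X. norm (S t x) \<le> real n}) = E n"
      by (auto simp: E_def)
    finally show ?thesis .
  qed
  then have closedin: "closedin (top_of_set X) (E n)" for n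
    by (intro closed_subset) (auto simp: E_def)
  have "X \<subseteq> (\<Union>n. E n)"
  proof
    fix x assume x: "x \<in> X"
    have "eventually (\<lambda>t. dist (S t x) x < 1) (at_right 0)"
      using C0_semigroup_tendsto[OF S x] by (rule tendstoD) simp
    then obtain b where b: "b > 0" "\<And>t. 0 < t \<Longrightarrow> t < b \<Longrightarrow> dist (S t x) x < 1"
      unfolding eventually_at_right_field by auto
    obtain n1 where n1: "1 / real (Suc n1) < b"
      using nat_approx_posE[OF b(1)] by blast
    obtain n2 where n2: "norm x + 1 \<le> real n2"
      using real_arch_simple by blast
    define n where "n = max n1 n2"
    have n: "1 / real (Suc n) < b" "norm x + 1 \<le> real n"
      using n1 n2 le_less_trans[OF _ n1, of "1 / real (Suc n)"] by (auto simp: n_def frac_le)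
    have "norm (S t x) \<le> real n" if "0 \<le> t" "t \<le> 1 / real (Suc n)" for t
    proof (cases "t = 0")
      case False
      then have "dist (S t x) x < 1"
        using that n by (intro b) auto
      then have "norm (S t x) < norm x + 1"
        using norm_triangle_ineq2[of "S t x" x] by (simp add: dist_norm)
      then show ?thesis
        using n by simp
    qed (use n C0_semigroup_0[OF S x] in simp)
    then have "x \<in> E n"
      using x by (simp add: E_def)
    then show "x \<in> (\<Union>n. E n)"
      by blast
  qed
  then have "\<Union>(range E) = X"
    by (auto simp: E_def)
  then have int: "(top_of_set X) interior_of (\<Union>(range E)) = X"
    using interior_of_topspace[of "top_of_set X"] by simp
  have "X \<noteq> {}"
    using subspace_0[OF X(1)] by blast
  have complete: "completely_metrizable_space (top_of_set X)"
    by (rule completely_metrizable_space_closedin[OF completely_metrizable_space_euclidean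
          closed_closedin[THEN iffD1, OF X(2)]])
  have "\<exists>n. top_of_set X interior_of E n \<noteq> {}"
  proof (rule ccontr)
    assume "\<nexists>n. top_of_set X interior_of E n \<noteq> {}"
    then have "top_of_set X interior_of \<Union>(range E) = {}"
      by (intro Baire_category_alt disjI1 complete) (use closedin in auto)
    with int \<open>X \<noteq> {}\<close> show False
      by simp
  qed
  then obtain n where "top_of_set X interior_of E n \<noteq> {}"
    by blast
  then obtain x0 U where "openin (top_of_set X) U" "x0 \<in> U" "U \<subseteq> E n"
    by (auto simp: interior_of_def)
  then obtain r where r: "r > 0" "ball x0 r \<inter> X \<subseteq> E n" "x0 \<in> E n"
    by (meson in_mono openin_contains_ball order_trans)
  have bound: "norm (S t x) \<le> (4 * real n / r) * norm x"
    if t: "0 \<le> t" "t \<le> 1 / real (Suc n)" and x: "x \<in> X" for t x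
  proof (cases "x = 0")
    case True
    then show ?thesis
      using C0_semigroup_scaleR[OF S t(1) x, of 0] by simp
  next
    case False
    \<comment> \<open>Scales \<open>x\<close> to norm r / 2, inside the ball around
      \<open>x0\<close>. Subtracting the orbit of \<open>x0\<close> leaves the bound 2 n / c, which
      is the claimed 4 n / r times \<open>norm x\<close>.\<close>
    define c where "c = r / (2 * norm x)"
    have c: "c > 0" "c * norm x < r"
      using r(1) False by (auto simp: c_def)
    have cx: "c *\<^sub>R x \<in> X"
      by (rule subspace_scale[OF X(1) x])
    have x0: "x0 \<in> X"
      using r(3) by (simp add: E_def)
    have "x0 + c *\<^sub>R x \<in> E n"
      using c r subspace_add[OF X(1) x0 cx] by (auto simp: dist_norm)
    then have "norm (S t (x0 + c *\<^sub>R x)) \<le> real n" "norm (S t x0) \<le> real n"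
      using r(3) t by (auto simp: E_def)
    moreover have "S t (x0 + c *\<^sub>R x) = S t x0 + c *\<^sub>R S t x"
      using C0_semigroup_linear[OF S t(1) x0 x, of 1 c] by simp
    ultimately have "norm (c *\<^sub>R S t x) \<le> 2 * real n"
      using norm_triangle_ineq4[of "S t x0 + c *\<^sub>R S t x" "S t x0"] by simp
    then have "norm (S t x) \<le> 2 * real n / c"
      using c by (simp add: pos_le_divide_eq mult.commute)
    then show ?thesis
      using False r(1) by (simp add: c_def field_simps)
  qed
  show ?thesis
    by (rule that[of "1 / real (Suc n)" "4 * real n / r"]) (use bound r(1) in auto)
qed

lemma C0_semigroup_locally_bounded:
  fixes X :: "'a::banach set"
  assumes S: "C0_semigroup X S" and X: "subspace X" "closed X"
  obtains M where "M \<ge> 0" "\<And>t x. 0 \<le> t \<Longrightarrow> t \<le> a \<Longrightarrow> x \<in> X \<Longrightarrow> norm (S t x) \<le> M * norm x"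
proof -
  obtain \<delta> M where \<delta>: "\<delta> > 0" "M \<ge> 0"
    "\<And>t x. 0 \<le> t \<Longrightarrow> t \<le> \<delta> \<Longrightarrow> x \<in> X \<Longrightarrow> norm (S t x) \<le> M * norm x"
    using C0_semigroup_bounded_near_0[OF assms] by blast
  have "\<exists>M'\<ge>0. \<forall>t x. 0 \<le> t \<longrightarrow> t \<le> real n * \<delta> \<longrightarrow> x \<in> X \<longrightarrow> norm (S t x) \<le> M' * norm x" for n
  proof (induction n)
    case 0
    then show ?case
      using \<delta> by (intro exI[of _ M]) auto
  next
    case (Suc n)
    then obtain M' where M': "M' \<ge> 0"
      "\<And>t x. 0 \<le> t \<Longrightarrow> t \<le> real n * \<delta> \<Longrightarrow> x \<in> X \<Longrightarrow> norm (S t x) \<le> M' * norm x"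
      by blast
    \<comment> \<open>The summand 1 in \<open>M + 1\<close> makes the new constant dominate
      \<open>M'\<close>, so it also covers the times treated before.\<close>
    have "norm (S t x) \<le> (M' * (M + 1)) * norm x" if t: "0 \<le> t" "t \<le> real (Suc n) * \<delta>" and x: "x \<in> X" for t x
    proof (cases "t \<le> real n * \<delta>")
      case True
      have "M' * norm x \<le> (M' * (M + 1)) * norm x"
        using M'(1) \<delta>(2) by (intro mult_right_mono) (auto simp: algebra_simps)
      then show ?thesis
        using M'(2)[OF t(1) True x] by simp
    next
      case False
      have n\<delta>: "0 \<le> real n * \<delta>"
        using \<delta>(1) by simp
      define d where "d = t - real n * \<delta>"
      have d: "0 \<le> d" "d \<le> \<delta>"
        using False t by (auto simp: d_def algebra_simps)
      have "norm (S t x) = norm (S (real n * \<delta>) (S d x))"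
        using C0_semigroup_add[OF S n\<delta> d(1) x] by (simp add: d_def)
      also have "\<dots> \<le> M' * norm (S d x)"
        by (rule M'(2)[OF n\<delta> order_refl C0_semigroup_closed[OF S d(1) x]])
      also have "\<dots> \<le> M' * (M * norm x)"
        using M'(1) \<delta>(3)[OF d x] by (intro mult_left_mono) auto
      also have "\<dots> \<le> (M' * (M + 1)) * norm x"
        using M'(1) by (simp add: algebra_simps)
      finally show ?thesis .
    qed
    then show ?case
      using M'(1) \<delta>(2) by (intro exI[of _ "M' * (M + 1)"]) auto
  qed
  moreover obtain n where "a / \<delta> \<le> real n"
    using real_arch_simple by blast
  then have "a \<le> real n * \<delta>"
    using \<delta>(1) by (simp add: pos_divide_le_eq)
  ultimately show ?thesis
    using that by (meson order_trans)
qed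

text \<open>The point of this form is that the time \<open>r h\<close> may vary with h; strong
  continuity at a fixed time would not allow that.\<close>

lemma C0_semigroup_tendsto_0:
  fixes X :: "'a::banach set"
  assumes S: "C0_semigroup X S" and X: "subspace X" "closed X"
    and z: "(z \<longlongrightarrow> 0) F" "eventually (\<lambda>h. z h \<in> X) F" and r: "eventually (\<lambda>h. 0 \<le> r h \<and> r h \<le> a) F"
  shows "((\<lambda>h. S (r h) (z h)) \<longlongrightarrow> 0) F"
proof -
  obtain M where M: "M \<ge> 0" "\<And>t x. 0 \<le> t \<Longrightarrow> t \<le> a \<Longrightarrow> x \<in> X \<Longrightarrow> norm (S t x) \<le> M * norm x"
    using C0_semigroup_locally_bounded[OF S X] by blast
  show ?thesis
  proof (rule Lim_null_comparison)
    show "eventually (\<lambda>h. norm (S (r h) (z h)) \<le> M * norm (z h)) F"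
      using z(2) r by eventually_elim (use M in auto)
    show "((\<lambda>h. M * norm (z h)) \<longlongrightarrow> 0) F"
      using tendsto_mult_right_zero[OF tendsto_norm_zero[OF z(1)]] .
  qed
qed

text \<open>On the right, the quotient at time t is \<open>S t\<close> applied to the quotient at
  time 0. On the left the operator in front depends on h, so the local uniform bound is
  used.\<close>

lemma generator_orbit:
  fixes X :: "'a::banach set"
  assumes S: "C0_semigroup X S" and X: "subspace X" "closed X"
    and xy: "(x, y) \<in> generator X S" and t: "t \<ge> 0"
  shows generator_orbit_right: "((\<lambda>h. (S (t + h) x - S t x) /\<^sub>R h) \<longlongrightarrow> S t y) (at_right 0)"
    and generator_orbit_left: "t > 0 \<Longrightarrow> ((\<lambda>h. (S t x - S (t - h) x) /\<^sub>R h) \<longlongrightarrow> S t y) (at_right 0)"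
    and generator_invariant: "(S t x, S t y) \<in> generator X S"
proof -
  have x: "x \<in> X" and y: "y \<in> X" and lim: "((\<lambda>h. (S h x - x) /\<^sub>R h) \<longlongrightarrow> y) (at_right 0)"
    using xy by (auto simp: generator_def)
  have pos: "eventually (\<lambda>h. h > 0) (at_right (0::real))"
    by (rule eventually_at_right_less)
  have SX: "S h x \<in> X" if "h \<ge> 0" for h
    by (rule C0_semigroup_closed[OF S that x])
  have qX: "(S h x - x) /\<^sub>R h \<in> X" if "h > 0" for h
    using that by (intro subspace_scale subspace_diff X SX x) simp
  have q: "((\<lambda>h. (S h x - x) /\<^sub>R h - y) \<longlongrightarrow> 0) (at_right 0)"
    using lim by (rule Lim_null[THEN iffD1])
  have qyX: "eventually (\<lambda>h. (S h x - x) /\<^sub>R h - y \<in> X) (at_right 0)"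
    using pos by eventually_elim (intro subspace_diff X qX y)
  have Sq: "S r ((S h x - x) /\<^sub>R h - y) = (S (r + h) x - S r x) /\<^sub>R h - S r y" if "r \<ge> 0" "h > 0" for r h
  proof -
    have "S r ((S h x - x) /\<^sub>R h - y) = S r ((S h x - x) /\<^sub>R h) - S r y"
      by (rule C0_semigroup_diff[OF S that(1) qX[OF that(2)] y])
    also have "S r ((S h x - x) /\<^sub>R h) = S r (S h x - x) /\<^sub>R h"
      by (rule C0_semigroup_scaleR[OF S that(1)]) (use that in \<open>auto intro!: subspace_diff X SX x\<close>)
    also have "S r (S h x - x) = S (r + h) x - S r x"
      using C0_semigroup_diff[OF S that(1) SX x, of h] C0_semigroup_add[OF S that(1) _ x, of h] that by simp
    finally show ?thesis .
  qed
  have "((\<lambda>h. S t ((S h x - x) /\<^sub>R h - y)) \<longlongrightarrow> 0) (at_right 0)"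
    by (rule C0_semigroup_tendsto_0[OF S X q qyX, of _ t]) (use t in simp)
  then have "((\<lambda>h. (S (t + h) x - S t x) /\<^sub>R h - S t y) \<longlongrightarrow> 0) (at_right 0)"
    by (rule Lim_transform_eventually) (use pos in \<open>eventually_elim, simp only: Sq[OF t]\<close>)
  then show right: "((\<lambda>h. (S (t + h) x - S t x) /\<^sub>R h) \<longlongrightarrow> S t y) (at_right 0)"
    by (rule Lim_null[THEN iffD2])
  show "(S t x, S t y) \<in> generator X S"
  proof -
    have "((\<lambda>h. (S h (S t x) - S t x) /\<^sub>R h) \<longlongrightarrow> S t y) (at_right 0)"
      by (rule Lim_transform_eventually[OF right], use pos in eventually_elim)
         (simp add: C0_semigroup_add[OF S _ t x, symmetric] add.commute)
    then show ?thesis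
      using C0_semigroup_closed[OF S t] x y by (simp add: generator_def)
  qed
  \<comment> \<open>The left quotient minus \<open>S t y\<close> equals \<open>S (t - h)\<close>
    applied to the quotient error at time 0, minus \<open>S (t - h)\<close> applied to
    \<open>S h y - y\<close>; both arguments tend to 0.\<close>
  show "((\<lambda>h. (S t x - S (t - h) x) /\<^sub>R h) \<longlongrightarrow> S t y) (at_right 0)" if "t > 0"
  proof (rule Lim_null[THEN iffD2])
    have small: "eventually (\<lambda>h. 0 < h \<and> h < t) (at_right 0)"
      using that by (intro eventually_at_rightI[of 0 t]) auto
    then have r: "eventually (\<lambda>h. 0 \<le> t - h \<and> t - h \<le> t) (at_right 0)"
      by eventually_elim auto
    have "((\<lambda>h. S (t - h) ((S h x - x) /\<^sub>R h - y)) \<longlongrightarrow> 0) (at_right 0)"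
      by (rule C0_semigroup_tendsto_0[OF S X q qyX r])
    moreover have "((\<lambda>h. S (t - h) (S h y - y)) \<longlongrightarrow> 0) (at_right 0)"
    proof (rule C0_semigroup_tendsto_0[OF S X _ _ r])
      show "((\<lambda>h. S h y - y) \<longlongrightarrow> 0) (at_right 0)"
        using C0_semigroup_tendsto[OF S y] by (rule Lim_null[THEN iffD1])
      show "eventually (\<lambda>h. S h y - y \<in> X) (at_right 0)"
        using pos by eventually_elim (intro subspace_diff X y C0_semigroup_closed[OF S], auto)
    qed
    ultimately have "((\<lambda>h. S (t - h) ((S h x - x) /\<^sub>R h - y) - S (t - h) (S h y - y)) \<longlongrightarrow> 0 - 0) (at_right 0)"
      by (rule tendsto_diff)
    then have "((\<lambda>h. S (t - h) ((S h x - x) /\<^sub>R h - y) - S (t - h) (S h y - y)) \<longlongrightarrow> 0) (at_right 0)"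
      by simp
    then show "((\<lambda>h. (S t x - S (t - h) x) /\<^sub>R h - S t y) \<longlongrightarrow> 0) (at_right 0)"
    proof (rule Lim_transform_eventually)
      show "eventually (\<lambda>h. S (t - h) ((S h x - x) /\<^sub>R h - y) - S (t - h) (S h y - y) =
          (S t x - S (t - h) x) /\<^sub>R h - S t y) (at_right 0)"
        using small
      proof eventually_elim
        case (elim h)
        have "S (t - h) (S h y - y) = S t y - S (t - h) y"
          using C0_semigroup_diff[OF S _ C0_semigroup_closed[OF S _ y] y, of "t - h" h]
            C0_semigroup_add[OF S _ _ y, of "t - h" h] elim by simp
        then show ?case
          using Sq[of "t - h" h] elim by simp
      qed
    qed
  qed
qed

lemma semigroup_decay_on_domain:
  fixes X :: "'a::{real_inner,banach} set"
  assumes S: "C0_semigroup X S" and X: "subspace X" "closed X"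
    and diss: "\<And>x y. (x, y) \<in> generator X S \<Longrightarrow> inner y x \<le> - \<alpha> * (norm x)\<^sup>2"
    and xy: "(x, y) \<in> generator X S" and t: "t \<ge> 0"
  shows "norm (S t x) \<le> exp (- \<alpha> * t) * norm x"
proof -
  define u where "u s = S s x" for s
  define \<phi> where "\<phi> s = exp (2 * \<alpha> * s) * inner (u s) (u s)" for s
  have x: "x \<in> X"
    using xy by (simp add: generator_def)
  have nonzero: "eventually (\<lambda>h. h \<noteq> 0) (at (0::real))" "eventually (\<lambda>h. h \<noteq> 0) (at_right (0::real))"
    by (auto simp: eventually_at_filter)
  have q: "((\<lambda>h. (u (s + h) - u s) /\<^sub>R h) \<longlongrightarrow> S s y) (at 0)" if "s > 0" for s
  proof (rule filterlim_split_at)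
    show "((\<lambda>h. (u (s + h) - u s) /\<^sub>R h) \<longlongrightarrow> S s y) (at_right 0)"
      using generator_orbit_right[OF S X xy, of s] that by (simp add: u_def)
    have "((\<lambda>h. (u (s + - h) - u s) /\<^sub>R (- h)) \<longlongrightarrow> S s y) (at_right 0)"
      using generator_orbit_left[OF S X xy, of s] that
      by (simp add: u_def flip: scaleR_minus_right)
    then show "((\<lambda>h. (u (s + h) - u s) /\<^sub>R h) \<longlongrightarrow> S s y) (at_left 0)"
      by (simp add: filterlim_at_left_to_right)
  qed
  \<comment> \<open>A convergent difference quotient forces continuity. The filter is left open
    because time 0 is approached from the right only.\<close>
  have step: "((\<lambda>h. u (s + h)) \<longlongrightarrow> u s) F"
    if "((\<lambda>h. (u (s + h) - u s) /\<^sub>R h) \<longlongrightarrow> S s y) F" "((\<lambda>h. h) \<longlongrightarrow> 0) F"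
      "eventually (\<lambda>h. h \<noteq> 0) F" for s and F :: "real filter"
  proof -
    have "((\<lambda>h. u s + h *\<^sub>R ((u (s + h) - u s) /\<^sub>R h)) \<longlongrightarrow> u s + 0 *\<^sub>R S s y) F"
      by (intro tendsto_intros that)
    then have "((\<lambda>h. u s + h *\<^sub>R ((u (s + h) - u s) /\<^sub>R h)) \<longlongrightarrow> u s) F"
      by simp
    then show ?thesis
      by (rule Lim_transform_eventually) (use that(3) in \<open>eventually_elim, simp\<close>)
  qed
  have deriv: "(\<phi> has_real_derivative
      exp (2 * \<alpha> * s) * (2 * inner (S s y) (u s)) + exp (2 * \<alpha> * s) * (2 * \<alpha>) * inner (u s) (u s)) (at s)"
    if "s > 0" for s
  proof -
    \<comment> \<open>Factorization of a difference of squares: the quotient of the squared norm is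
      the quotient of \<open>u\<close> paired with \<open>u (s + h) + u s\<close>.\<close>
    have "((\<lambda>h. inner ((u (s + h) - u s) /\<^sub>R h) (u (s + h) + u s)) \<longlongrightarrow> inner (S s y) (u s + u s)) (at 0)"
      by (intro tendsto_intros q step nonzero that)
    moreover have "inner ((u (s + h) - u s) /\<^sub>R h) (u (s + h) + u s) =
        (inner (u (s + h)) (u (s + h)) - inner (u s) (u s)) / h" for h
      using inner_commute[of "u s" "u (s + h)"]
      by (simp add: inner_diff_left inner_add_right divide_inverse algebra_simps)
    ultimately have "((\<lambda>s. inner (u s) (u s)) has_real_derivative 2 * inner (S s y) (u s)) (at s)"
      by (simp add: DERIV_def inner_add_right)
    then show ?thesis
      unfolding \<phi>_def by (auto intro!: derivative_eq_intros)
  qed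
  have "\<phi> t \<le> \<phi> 0"
  proof (rule DERIV_nonpos_imp_decreasing_open[OF t])
    fix s assume s: "0 < s" "s < t"
    have "inner (S s y) (u s) \<le> - \<alpha> * inner (u s) (u s)"
      using diss[OF generator_invariant[OF S X xy, of s]] s by (simp add: u_def power2_norm_eq_inner)
    then have "exp (2 * \<alpha> * s) * (2 * inner (S s y) (u s) + 2 * \<alpha> * inner (u s) (u s)) \<le> 0"
      by (intro mult_nonneg_nonpos) auto
    then have "exp (2 * \<alpha> * s) * (2 * inner (S s y) (u s)) + exp (2 * \<alpha> * s) * (2 * \<alpha>) * inner (u s) (u s) \<le> 0"
      by (simp add: algebra_simps)
    then show "\<exists>z. (\<phi> has_real_derivative z) (at s) \<and> z \<le> 0"
      using deriv[OF s(1)] by blast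
  next
    have "isCont \<phi> s" if "s > 0" for s
      using deriv[OF that] by (rule DERIV_isCont)
    \<comment> \<open>The two-sided derivative exists for positive times only, so continuity at the
      left end point is supplied separately from the right difference quotient.\<close>
    moreover have "continuous (at 0 within {0..t}) \<phi>"
    proof -
      have "((\<lambda>h. u (0 + h)) \<longlongrightarrow> u 0) (at_right 0)"
        by (intro step nonzero tendsto_ident_at)
           (use generator_orbit_right[OF S X xy, of 0] in \<open>simp add: u_def\<close>)
      then have "(\<phi> \<longlongrightarrow> \<phi> 0) (at_right 0)"
        unfolding \<phi>_def by (intro tendsto_intros) auto
      then show ?thesis
        unfolding continuous_within by (rule tendsto_mono[rotated]) (auto intro: at_le simp flip: at_within_Ici_at_right)
    qed
    ultimately show "continuous_on {0..t} \<phi>"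
      by (auto simp: continuous_on_eq_continuous_within intro: continuous_at_imp_continuous_at_within)
         (metis continuous_at_imp_continuous_at_within order_le_less)
  qed
  then have "exp (2 * \<alpha> * t) * (norm (S t x))\<^sup>2 \<le> (norm x)\<^sup>2"
    using C0_semigroup_0[OF S x] by (simp add: \<phi>_def u_def power2_norm_eq_inner)
  then have "(exp (\<alpha> * t) * norm (S t x))\<^sup>2 \<le> (norm x)\<^sup>2"
    by (simp add: power_mult_distrib exp_double[symmetric] mult.assoc)
  then have "exp (\<alpha> * t) * norm (S t x) \<le> norm x"
    by (rule power2_le_imp_le) simp
  then show ?thesis
    by (simp add: exp_minus field_simps)
qed

theorem semigroup_decay:
  fixes X :: "'a::{real_inner,banach} set"
  assumes S: "C0_semigroup X S" and X: "subspace X" "closed X"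
    and diss: "\<And>x y. (x, y) \<in> generator X S \<Longrightarrow> inner y x \<le> - \<alpha> * (norm x)\<^sup>2"
    and dense: "X \<subseteq> closure (Domain (generator X S))"
    and x: "x \<in> X" and t: "t \<ge> 0"
  shows "norm (S t x) \<le> exp (- \<alpha> * t) * norm x"
proof -
  obtain z where z: "\<And>n. z n \<in> Domain (generator X S)" "z \<longlonglongrightarrow> x"
    using subsetD[OF dense x] unfolding closure_sequential by blast
  then have zX: "z n \<in> X" for n
    by (auto simp: generator_def)
  have "(\<lambda>n. S t (z n)) \<longlonglongrightarrow> S t x"
    using C0_semigroup_continuous_on[OF S X(1) t] z(2) zX x
    by (auto simp: continuous_on_sequentially o_def)
  then have lim: "(\<lambda>n. norm (S t (z n))) \<longlonglongrightarrow> norm (S t x)"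
    by (rule tendsto_norm)
  have "(\<lambda>n. exp (- \<alpha> * t) * norm (z n)) \<longlonglongrightarrow> exp (- \<alpha> * t) * norm x"
    by (intro tendsto_intros z)
  moreover have "norm (S t (z n)) \<le> exp (- \<alpha> * t) * norm (z n)" for n
    using semigroup_decay_on_domain[OF S X diss _ t] z(1) by blast
  ultimately show ?thesis
    using LIMSEQ_le[OF lim] by blast
qed

section \<open>Completeness of the space of square integrable fields\<close>

lemma box_in_borel: "{x :: real^3. \<forall>i. 0 \<le> x $ i \<and> x $ i < 1} \<in> sets borel"
proof -
  have "{x :: real^3. \<forall>i. 0 \<le> x $ i \<and> x $ i < 1} = (\<Inter>i. {x. 0 \<le> x $ i} \<inter> {x. x $ i < 1})"
    by auto
  moreover have "{x :: real^3. 0 \<le> x $ i} \<inter> {x. x $ i < 1} \<in> sets borel" for i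
    by (intro sets.Int borel_closed borel_open closed_Collect_le open_Collect_less continuous_intros)
  ultimately show ?thesis
    by (auto intro!: sets.finite_INT)
qed

lemma space_torus: "space torus = {x. \<forall>i. 0 \<le> x $ i \<and> x $ i < 1}"
  by (simp add: torus_def space_restrict_space)

lemma emeasure_torus: "emeasure torus (space torus) = 1"
proof -
  let ?Q = "{x :: real^3. \<forall>i. 0 \<le> x $ i \<and> x $ i < 1}"
  have "emeasure lborel ?Q = 1"
  proof (rule antisym)
    have "emeasure lborel ?Q \<le> emeasure lborel (cbox (0 :: real^3) (\<chi> i. 1))"
      by (intro emeasure_mono) (auto simp: mem_box_cart less_imp_le)
    also have "\<dots> = 1"
      by (subst emeasure_lborel_cbox) (auto simp: Basis_vec_def inner_axis intro!: prod.neutral)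
    finally show "emeasure lborel ?Q \<le> 1" .
    have "1 = emeasure lborel (box (0 :: real^3) (\<chi> i. 1))"
      by (subst emeasure_lborel_box) (auto simp: Basis_vec_def inner_axis intro!: prod.neutral)
    also have "\<dots> \<le> emeasure lborel ?Q"
      using box_in_borel by (intro emeasure_mono) (auto simp: mem_box_cart less_imp_le)
    finally show "1 \<le> emeasure lborel ?Q" .
  qed
  then show ?thesis
    using box_in_borel by (simp add: torus_def emeasure_restrict_space space_restrict_space)
qed

lemma finite_measure_torus: "finite_measure torus"
  by (rule finite_measureI) (simp add: emeasure_torus)

lemma measure_torus: "measure torus (space torus) = 1"
  by (simp add: measure_def emeasure_torus)

section \<open>Passage between classes and representatives\<close>

lemma square_integrable_rep_L2: "square_integrable (rep_L2 v)"
  using Quotient3_rep_reflp[OF Quotient3_L2, of v] by (simp add: ae_eq_def)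

lemma abs_L2_rep_L2: "abs_L2 (rep_L2 v) = v"
  by (rule Quotient3_abs_rep[OF Quotient3_L2])

lemma abs_L2_eq_iff:
  assumes "square_integrable f" "square_integrable g"
  shows "abs_L2 f = abs_L2 g \<longleftrightarrow> (AE x in torus. f x = g x)"
  using assms Quotient3_rel[OF Quotient3_L2, of f g] by (auto simp: ae_eq_def)

lemma rep_L2_abs_L2:
  assumes "square_integrable f"
  shows "AE x in torus. rep_L2 (abs_L2 f) x = f x"
  using abs_L2_eq_iff[OF square_integrable_rep_L2 assms, of "abs_L2 f"] abs_L2_rep_L2 by simp

lemma inner_abs_L2:
  assumes "square_integrable f" "square_integrable g"
  shows "inner (abs_L2 f) (abs_L2 g) = (LINT x|torus. f x \<bullet> g x)"
  by (rule inner_L2.abs_eq) (use assms in \<open>simp_all add: ae_eq_def\<close>)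

lemma inner_L2_rep: "inner v w = (LINT x|torus. rep_L2 v x \<bullet> rep_L2 w x)"
  using inner_abs_L2[OF square_integrable_rep_L2 square_integrable_rep_L2, of v w] by (simp add: abs_L2_rep_L2)

lemma abs_L2_add:
  assumes "square_integrable f" "square_integrable g"
  shows "abs_L2 f + abs_L2 g = abs_L2 (\<lambda>x. f x + g x)"
  by (rule plus_L2.abs_eq) (use assms in \<open>simp_all add: ae_eq_def\<close>)

lemma abs_L2_scaleR:
  assumes "square_integrable f"
  shows "c *\<^sub>R abs_L2 f = abs_L2 (\<lambda>x. c *\<^sub>R f x)"
  by (rule scaleR_L2.abs_eq) (use assms in \<open>simp add: ae_eq_def\<close>)

lemma square_integrable_diff:
  assumes "square_integrable f" "square_integrable g"
  shows "square_integrable (\<lambda>x. f x - g x)"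
  using square_integrable_add[OF assms(1) square_integrable_scaleR[OF assms(2), of "-1"]] by simp

lemma abs_L2_diff:
  assumes "square_integrable f" "square_integrable g"
  shows "abs_L2 f - abs_L2 g = abs_L2 (\<lambda>x. f x - g x)"
  unfolding minus_L2_def abs_L2_scaleR[OF assms(2)]
    abs_L2_add[OF assms(1) square_integrable_scaleR[OF assms(2)]] by simp

lemma square_integrable_measurable [measurable_dest]:
  "square_integrable f \<Longrightarrow> f \<in> borel_measurable torus"
  by (simp add: square_integrable_def)

section \<open>Completeness through almost everywhere convergence\<close>

lemma nn_integral_norm_squared:
  assumes "square_integrable f"
  shows "(\<integral>\<^sup>+x. ennreal ((norm (f x))\<^sup>2) \<partial>torus) = ennreal ((norm (abs_L2 f))\<^sup>2)"
proof -
  have "(norm (abs_L2 f))\<^sup>2 = (LINT x|torus. (norm (f x))\<^sup>2)"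
    by (simp add: power2_norm_eq_inner inner_abs_L2 assms)
  then show ?thesis
    using assms by (simp add: nn_integral_eq_integral square_integrable_def)
qed

lemma square_integrableI_nn:
  assumes [measurable]: "f \<in> borel_measurable torus"
    and le: "(\<integral>\<^sup>+x. ennreal ((norm (f x))\<^sup>2) \<partial>torus) \<le> ennreal c"
  shows "square_integrable f"
  unfolding square_integrable_def
  by (intro conjI assms(1) integrableI_bounded) (use le in \<open>auto intro: le_less_trans\<close>)

text \<open>By the inequality \<open>|g| \<le> 2^n |g|^2 + (1/2)^n\<close> on the torus, which has measure 1.\<close>

lemma nn_integral_norm_le:
  assumes g: "square_integrable g" and le: "norm (abs_L2 g) \<le> (1 / 2) ^ n"
  shows "(\<integral>\<^sup>+x. ennreal (norm (g x)) \<partial>torus) \<le> ennreal (2 * (1 / 2) ^ n)"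
proof -
  note [measurable] = square_integrable_measurable[OF g]
  have "(\<integral>\<^sup>+x. ennreal (norm (g x)) \<partial>torus) \<le>
      (\<integral>\<^sup>+x. ennreal (2 ^ n) * ennreal ((norm (g x))\<^sup>2) + ennreal ((1 / 2) ^ n) \<partial>torus)"
  proof (intro nn_integral_mono)
    fix x
    have "0 \<le> (2 ^ n * norm (g x) - 1)\<^sup>2 + 2 ^ n * norm (g x)"
      by simp
    then have "2 ^ n * norm (g x) \<le> 2 ^ n * (2 ^ n * (norm (g x))\<^sup>2 + (1 / 2) ^ n)"
      by (simp add: power2_eq_square algebra_simps power_one_over)
    then have "norm (g x) \<le> 2 ^ n * (norm (g x))\<^sup>2 + (1 / 2) ^ n"
      by (simp add: mult_le_cancel_left_pos)
    then show "ennreal (norm (g x)) \<le> ennreal (2 ^ n) * ennreal ((norm (g x))\<^sup>2) + ennreal ((1 / 2) ^ n)"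
      by (simp flip: ennreal_mult' ennreal_plus)
  qed
  also have "\<dots> = ennreal (2 ^ n) * ennreal ((norm (abs_L2 g))\<^sup>2) + ennreal ((1 / 2) ^ n)"
    by (simp add: nn_integral_add nn_integral_cmult nn_integral_norm_squared[OF g] emeasure_torus)
  also have "\<dots> = ennreal (2 ^ n * (norm (abs_L2 g))\<^sup>2 + (1 / 2) ^ n)"
    by (simp flip: ennreal_mult' ennreal_plus)
  also have "\<dots> \<le> ennreal (2 * (1 / 2) ^ n)"
  proof (rule ennreal_leI)
    have "2 ^ n * (norm (abs_L2 g))\<^sup>2 \<le> 2 ^ n * ((1 / 2) ^ n)\<^sup>2"
      using le by (intro mult_left_mono power_mono) auto
    also have "\<dots> = (1 / 2) ^ n"
      by (simp add: power2_eq_square power_one_over)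
    finally show "2 ^ n * (norm (abs_L2 g))\<^sup>2 + (1 / 2) ^ n \<le> 2 * (1 / 2) ^ n"
      by simp
  qed
  finally show ?thesis .
qed

text \<open>The integrals of the norms of the increments are summable, so almost everywhere the
  increments themselves are absolutely summable and the sequence telescopes to a limit.\<close>

lemma AE_convergent_L2:
  assumes f: "\<And>n. square_integrable (f n)"
    and le: "\<And>n. norm (abs_L2 (f (Suc n)) - abs_L2 (f n)) \<le> (1 / 2) ^ n"
  shows "AE x in torus. convergent (\<lambda>n. f n x)"
proof -
  define g where "g n x = f (Suc n) x - f n x" for n x
  have g: "square_integrable (g n)" for n
    unfolding g_def by (intro square_integrable_diff f)
  note [measurable] = square_integrable_measurable[OF g]
  have "(\<integral>\<^sup>+x. (\<Sum>n. ennreal (norm (g n x))) \<partial>torus) = (\<Sum>n. \<integral>\<^sup>+x. ennreal (norm (g n x)) \<partial>torus)"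
    by (rule nn_integral_suminf) measurable
  also have "\<dots> \<le> (\<Sum>n. ennreal (2 * (1 / 2) ^ n))"
  proof (intro suminf_le summableI nn_integral_norm_le g)
    show "norm (abs_L2 (g n)) \<le> (1 / 2) ^ n" for n
      using le[of n] by (simp add: g_def[abs_def] abs_L2_diff f)
  qed
  also have "\<dots> < \<infinity>"
    by (subst suminf_ennreal2) (auto intro!: summable_mult summable_geometric)
  finally have "AE x in torus. (\<Sum>n. ennreal (norm (g n x))) \<noteq> \<infinity>"
    by (intro nn_integral_PInf_AE) auto
  then show ?thesis
  proof eventually_elim
    case (elim x)
    then have "summable (\<lambda>n. norm (g n x))"
      by (intro summable_suminf_not_top) auto
    then have "summable (\<lambda>n. f (Suc n) x - f n x)"
      unfolding g_def by (rule summable_norm_cancel)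
    then have "convergent (\<lambda>m. f m x - f 0 x)"
      by (simp add: summable_iff_convergent sum_lessThan_telescope[of "\<lambda>n. f n x"])
    then have "convergent (\<lambda>m. (f m x - f 0 x) + f 0 x)"
      by (intro convergent_add convergent_const)
    then show ?case
      by simp
  qed
qed

text \<open>Fatou's lemma carries the Cauchy estimate from \<open>f m - f n\<close> to
  \<open>F - f n\<close>, with \<open>F\<close> the pointwise limit; this gives both square
  integrability of \<open>F\<close> and convergence in norm.\<close>

lemma L2_Cauchy_convergent:
  fixes v :: "nat \<Rightarrow> L2"
  assumes "\<And>n. norm (v (Suc n) - v n) \<le> (1 / 2) ^ n" and Cauchy: "Cauchy v"
  shows "convergent v"
proof -
  define f where "f n = rep_L2 (v n)" for n
  have f: "square_integrable (f n)" and abs_f: "abs_L2 (f n) = v n" for n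
    by (simp_all add: f_def square_integrable_rep_L2 abs_L2_rep_L2)
  define F where "F x = lim (\<lambda>n. f n x)" for x
  note [measurable] = square_integrable_measurable[OF f]
  have F [measurable]: "F \<in> borel_measurable torus"
    unfolding F_def[abs_def] by (rule borel_measurable_lim_metric) measurable
  have lim: "AE x in torus. (\<lambda>n. f n x) \<longlonglongrightarrow> F x"
    using AE_convergent_L2[of f] f assms(1)
    by (auto simp: abs_f F_def convergent_LIMSEQ_iff)
  have fatou: "(\<integral>\<^sup>+x. ennreal ((norm (F x - f n x))\<^sup>2) \<partial>torus) \<le> ennreal (\<epsilon>\<^sup>2)"
    if "\<And>m. m \<ge> n \<Longrightarrow> norm (v m - v n) \<le> \<epsilon>" for n \<epsilon>
  proof -
    have "(\<integral>\<^sup>+x. ennreal ((norm (F x - f n x))\<^sup>2) \<partial>torus) =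
        (\<integral>\<^sup>+x. liminf (\<lambda>m. ennreal ((norm (f m x - f n x))\<^sup>2)) \<partial>torus)"
    proof (rule nn_integral_cong_AE)
      show "AE x in torus. ennreal ((norm (F x - f n x))\<^sup>2) = liminf (\<lambda>m. ennreal ((norm (f m x - f n x))\<^sup>2))"
        using lim
      proof eventually_elim
        case (elim x)
        then have "(\<lambda>m. ennreal ((norm (f m x - f n x))\<^sup>2)) \<longlonglongrightarrow> ennreal ((norm (F x - f n x))\<^sup>2)"
          by (intro tendsto_intros tendsto_ennrealI)
        then show ?case
          by (rule lim_imp_Liminf[OF sequentially_bot, symmetric])
      qed
    qed
    also have "\<dots> \<le> liminf (\<lambda>m. \<integral>\<^sup>+x. ennreal ((norm (f m x - f n x))\<^sup>2) \<partial>torus)"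
      by (rule nn_integral_liminf) measurable
    also have "\<dots> \<le> ennreal (\<epsilon>\<^sup>2)"
    proof (rule Liminf_le)
      have "(\<integral>\<^sup>+x. ennreal ((norm (f m x - f n x))\<^sup>2) \<partial>torus) \<le> ennreal (\<epsilon>\<^sup>2)" if "m \<ge> n" for m
        using \<open>\<And>m. m \<ge> n \<Longrightarrow> norm (v m - v n) \<le> \<epsilon>\<close>[OF that]
        by (subst nn_integral_norm_squared)
           (auto intro!: square_integrable_diff f ennreal_leI power_mono simp: abs_f simp flip: abs_L2_diff[OF f f])
      then show "eventually (\<lambda>m. (\<integral>\<^sup>+x. ennreal ((norm (f m x - f n x))\<^sup>2) \<partial>torus) \<le> ennreal (\<epsilon>\<^sup>2)) sequentially"
        by (auto simp: eventually_sequentially)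
    qed simp
    finally show ?thesis .
  qed
  have tail: "\<exists>N. \<forall>n\<ge>N. \<forall>m\<ge>n. norm (v m - v n) \<le> \<epsilon>" if "\<epsilon> > 0" for \<epsilon>
    using CauchyD[OF Cauchy that] by (meson less_imp_le order_trans)
  obtain N where "\<And>m. m \<ge> N \<Longrightarrow> norm (v m - v N) \<le> 1"
    using tail[of 1] by auto
  then have "square_integrable (\<lambda>x. F x - f N x)"
    by (intro square_integrableI_nn[OF _ fatou]) auto
  then have sq: "square_integrable F"
    using square_integrable_add[OF _ f, of "\<lambda>x. F x - f N x" N] by simp
  have "v \<longlonglongrightarrow> abs_L2 F"
  proof (rule LIMSEQ_I)
    fix r :: real assume "r > 0"
    then obtain N where N: "\<And>n m. n \<ge> N \<Longrightarrow> m \<ge> n \<Longrightarrow> norm (v m - v n) \<le> r / 2"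
      using tail[of "r / 2"] by auto
    have "norm (v n - abs_L2 F) < r" if "n \<ge> N" for n
    proof -
      have "ennreal ((norm (abs_L2 F - v n))\<^sup>2) \<le> ennreal ((r / 2)\<^sup>2)"
        using fatou[of n "r / 2"] N[OF that]
        by (simp add: nn_integral_norm_squared square_integrable_diff sq f abs_f flip: abs_L2_diff)
      then have "(norm (abs_L2 F - v n))\<^sup>2 \<le> (r / 2)\<^sup>2"
        by (subst (asm) ennreal_le_iff) auto
      then have "norm (abs_L2 F - v n) \<le> r / 2"
        by (rule power2_le_imp_le) (use \<open>r > 0\<close> in simp)
      then show ?thesis
        using \<open>r > 0\<close> by (simp add: norm_minus_commute)
    qed
    then show "\<exists>N. \<forall>n\<ge>N. norm (v n - abs_L2 F) < r"
      by blast
  qed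
  then show ?thesis
    by (rule convergentI)
qed

instance L2 :: banach
proof
  fix v :: "nat \<Rightarrow> L2"
  assume v: "Cauchy v"
  have "\<exists>N. \<forall>m\<ge>N. \<forall>n\<ge>N. norm (v m - v n) < (1 / 2) ^ k" for k
    using CauchyD[OF v, of "(1 / 2) ^ k"] by simp
  then obtain N where N: "\<And>k m n. m \<ge> N k \<Longrightarrow> n \<ge> N k \<Longrightarrow> norm (v m - v n) < (1 / 2) ^ k"
    by metis
  \<comment> \<open>Summing all earlier thresholds dominates \<open>N k\<close>, and adding k makes
    the sequence strictly increasing.\<close>
  define r where "r k = k + (\<Sum>i\<le>k. N i)" for k
  have r: "strict_mono r"
    unfolding strict_mono_Suc_iff by (simp add: r_def)
  have "N k \<le> r k" for k
    using member_le_sum[of k "{..k}" N] by (simp add: r_def)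
  then have "norm (v (r (Suc k)) - v (r k)) \<le> (1 / 2) ^ k" for k
    using N[of k "r (Suc k)" "r k"] strict_mono_less[OF r, of k "Suc k"]
    by (meson le_trans less_imp_le lessI)
  then have "convergent (v \<circ> r)"
    using L2_Cauchy_convergent[of "v \<circ> r"] Cauchy_subseq_Cauchy[OF v r] by simp
  then show "convergent v"
    using Cauchy_converges_subseq[OF v r] by (auto simp: convergent_def)
qed

section \<open>Integration over the torus\<close>

lemma space_torus_in_borel: "space torus \<in> sets borel"
  using box_in_borel by (simp add: space_torus)

lemma space_torus_subset_cbox: "space torus \<subseteq> cbox 0 (\<chi> i. 1)"
  by (auto simp: space_torus mem_box_cart less_imp_le)

lemma borel_measurable_torus:
  "f \<in> borel_measurable borel \<Longrightarrow> f \<in> borel_measurable torus"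
  unfolding torus_def by (intro measurable_restrict_space1 measurable_completion) simp

lemma continuous_measurable_torus:
  fixes f :: "real^3 \<Rightarrow> 'a::topological_space"
  shows "continuous_on UNIV f \<Longrightarrow> f \<in> borel_measurable torus"
  by (intro borel_measurable_torus borel_measurable_continuous_onI)

lemma continuous_bounded_torus:
  fixes f :: "real^3 \<Rightarrow> 'a::real_normed_vector"
  assumes "continuous_on UNIV f"
  obtains B where "\<And>x. x \<in> space torus \<Longrightarrow> norm (f x) \<le> B"
proof -
  have "bounded (f ` cbox 0 (\<chi> i. 1))"
    by (intro compact_imp_bounded compact_continuous_image continuous_on_subset[OF assms]) auto
  then show ?thesis
    using that space_torus_subset_cbox by (force simp: bounded_iff)
qed

lemma integrable_torus_bounded:
  fixes f :: "real^3 \<Rightarrow> 'a::{banach, second_countable_topology}"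
  assumes "f \<in> borel_measurable torus" "\<And>x. x \<in> space torus \<Longrightarrow> norm (f x) \<le> B"
  shows "integrable torus f"
  by (intro finite_measure.integrable_const_bound[OF finite_measure_torus, of _ B] AE_I2 assms)

lemma continuous_integrable_torus:
  fixes f :: "real^3 \<Rightarrow> 'a::{banach, second_countable_topology}"
  assumes "continuous_on UNIV f"
  shows "integrable torus f"
  using continuous_bounded_torus[OF assms] integrable_torus_bounded[OF continuous_measurable_torus[OF assms]]
  by metis

lemma integral_torus_lborel:
  fixes f :: "real^3 \<Rightarrow> real"
  assumes f: "f \<in> borel_measurable borel"
  shows "(LINT x|torus. f x) = (LINT x|lborel. indicator (space torus) x * f x)"
proof -
  have "space torus \<inter> space lebesgue \<in> sets lebesgue"
    using space_torus_in_borel by simp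
  then have "(LINT x|torus. f x) = (LINT x|lebesgue. indicator (space torus) x *\<^sub>R f x)"
    unfolding torus_def space_torus[unfolded torus_def] by (rule integral_restrict_space)
  also have "\<dots> = (LINT x|lborel. indicator (space torus) x * f x)"
    using f space_torus_in_borel by (subst integral_completion) auto
  finally show ?thesis .
qed

lemma integrable_lborel_subset_torus:
  fixes f :: "real^3 \<Rightarrow> real"
  assumes "A \<in> sets borel" "A \<subseteq> space torus" "continuous_on UNIV f"
  shows "integrable lborel (\<lambda>x. indicator A x * f x)"
proof -
  have int: "integrable lborel (\<lambda>x. indicator (cbox 0 (\<chi> i. 1)) x *\<^sub>R f x)"
    by (intro borel_integrable_compact continuous_on_subset[OF assms(3)]) auto
  have "integrable lborel (\<lambda>x. indicator A x *\<^sub>R (indicator (cbox 0 (\<chi> i. 1)) x *\<^sub>R f x))"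
    by (rule integrable_mult_indicator[OF _ int]) (simp add: assms(1))
  moreover have "indicator A x *\<^sub>R (indicator (cbox 0 (\<chi> i. 1)) x *\<^sub>R f x) = indicator A x * f x" for x
    using assms(2) space_torus_subset_cbox by (auto simp: indicator_def)
  ultimately show ?thesis
    by (simp only:)
qed

lemma integral_lborel_shift:
  fixes f :: "real^3 \<Rightarrow> real"
  assumes "f \<in> borel_measurable borel"
  shows "(LINT x|lborel. f (c + x)) = (LINT x|lborel. f x)"
  using integral_distr[of "(+) c" lborel borel f] assms by (simp add: lborel_distr_plus)

definition periodic :: "(real^3 \<Rightarrow> real) \<Rightarrow> bool" where
  "periodic f \<longleftrightarrow> (\<forall>i x. f (x + axis i 1) = f x)"

text \<open>The part of the shifted fundamental domain that sticks out is moved back by one period.\<close>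

lemma integral_torus_shift:
  fixes f :: "real^3 \<Rightarrow> real"
  assumes f: "continuous_on UNIV f" "periodic f" and h: "0 \<le> h" "h \<le> 1"
  shows "(LINT x|torus. f (x + axis i h)) = (LINT x|torus. f x)"
proof -
  \<comment> \<open>The shifts by h and by h - 1 along the axis have the same effect on a periodic
    function; the first keeps \<open>Q1\<close> inside the fundamental domain, the second brings
    \<open>Q2\<close> back into it.\<close>
  let ?Q = "space torus" and ?a = "axis i h :: real^3" and ?b = "axis i (h - 1) :: real^3"
  define Q1 where "Q1 = ?Q \<inter> {x. x $ i < 1 - h}"
  define Q2 where "Q2 = ?Q \<inter> {x. 1 - h \<le> x $ i}"
  have Q1: "Q1 \<in> sets borel" "Q1 \<subseteq> ?Q" and Q2: "Q2 \<in> sets borel" "Q2 \<subseteq> ?Q"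
    unfolding Q1_def Q2_def using space_torus_in_borel
    by (auto intro!: sets.Int borel_closed borel_open closed_Collect_le open_Collect_less continuous_intros)
  have Q: "indicator ?Q x = (indicator Q1 x + indicator Q2 x :: real)" for x
    by (auto simp: Q1_def Q2_def indicator_def)
  \<comment> \<open>The two translated pieces again tile the fundamental domain.\<close>
  have Q': "indicator ?Q x = (indicator Q1 (x - ?a) + indicator Q2 (x - ?b) :: real)" for x
  proof (cases "\<forall>j. j \<noteq> i \<longrightarrow> 0 \<le> x $ j \<and> x $ j < 1")
    case True
    then have "x \<in> ?Q \<longleftrightarrow> 0 \<le> x $ i \<and> x $ i < 1"
      by (auto simp: space_torus)
    moreover have "x - ?a \<in> Q1 \<longleftrightarrow> h \<le> x $ i \<and> x $ i < 1"
      using True h by (auto simp: Q1_def space_torus axis_def)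
    moreover have "x - ?b \<in> Q2 \<longleftrightarrow> 0 \<le> x $ i \<and> x $ i < h"
      using True h by (auto simp: Q2_def space_torus axis_def)
    ultimately show ?thesis
      using h by (auto simp: indicator_def)
  next
    case False
    then obtain j where "j \<noteq> i" "\<not> (0 \<le> x $ j \<and> x $ j < 1)"
      by blast
    then have "x \<notin> ?Q" "x - ?a \<notin> ?Q" "x - ?b \<notin> ?Q"
      by (auto simp: space_torus axis_def intro!: exI[of _ j])
    then show ?thesis
      using Q1 Q2 by (auto simp: indicator_def)
  qed
  have cont: "continuous_on UNIV (\<lambda>x. f (x + c))" "continuous_on UNIV (\<lambda>x. f (c + x))" for c
    by (intro continuous_on_compose2[OF f(1)] continuous_intros; simp)+
  have meas: "f \<in> borel_measurable borel" "(\<lambda>x. f (x + c)) \<in> borel_measurable borel" for c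
    using f(1) cont by (auto intro: borel_measurable_continuous_onI)
  have int: "integrable lborel (\<lambda>x. indicator A x * f (x + c))"
    if "A \<in> sets borel" "A \<subseteq> ?Q" for A c
    by (rule integrable_lborel_subset_torus[OF that cont(1)])
  have int': "integrable lborel (\<lambda>x. indicator A (x - c) * f x)"
    if A: "A \<in> sets borel" "A \<subseteq> ?Q" for A c
  proof -
    have "integrable (distr lborel borel ((+) (- c))) (\<lambda>x. indicator A x * f (x + c))"
      using int[OF A] by (simp add: lborel_distr_plus)
    then have "integrable lborel (\<lambda>x. indicator A (- c + x) * f (- c + x + c))"
      by (rule integrable_distr[rotated]) simp
    then show ?thesis
      by simp
  qed
  have shift: "(LINT x|lborel. indicator A x * f (x + c)) = (LINT x|lborel. indicator A (x - c) * f x)"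
    if "A \<in> sets borel" for A c
    using integral_lborel_shift[of "\<lambda>x. indicator A x * f (x + c)" "- c"] that meas by simp
  have "f (x + ?a) = f (x + ?b)" for x
  proof -
    have "x + ?b + axis i 1 = x + ?a"
      by (simp add: vec_eq_iff axis_def)
    then show ?thesis
      using f(2) by (metis periodic_def)
  qed
  then have "(LINT x|torus. f (x + ?a)) =
      (LINT x|lborel. indicator Q1 x * f (x + ?a) + indicator Q2 x * f (x + ?b))"
    by (simp add: integral_torus_lborel meas Q distrib_right)
  also have "\<dots> = (LINT x|lborel. indicator Q1 x * f (x + ?a)) + (LINT x|lborel. indicator Q2 x * f (x + ?b))"
    by (intro Bochner_Integration.integral_add int Q1 Q2)
  also have "\<dots> = (LINT x|lborel. indicator Q1 (x - ?a) * f x) + (LINT x|lborel. indicator Q2 (x - ?b) * f x)"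
    by (simp add: shift Q1 Q2)
  also have "\<dots> = (LINT x|lborel. indicator Q1 (x - ?a) * f x + indicator Q2 (x - ?b) * f x)"
    by (intro Bochner_Integration.integral_add[symmetric] int' Q1 Q2)
  also have "\<dots> = (LINT x|torus. f x)"
    by (simp add: integral_torus_lborel meas Q' distrib_right)
  finally show ?thesis .
qed

section \<open>Partial derivatives of periodic functions have mean zero\<close>

lemma has_real_derivative_along_axis:
  assumes "f differentiable (at (x + axis i t))"
  shows "((\<lambda>t. f (x + axis i t)) has_real_derivative partial_deriv i f (x + axis i t)) (at t)"
proof -
  define e :: "real^3" where "e = axis i 1"
  have axis: "axis i s = s *\<^sub>R e" for s
    by (simp add: e_def vec_eq_iff axis_def)
  let ?D = "frechet_derivative f (at (x + t *\<^sub>R e))"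
  have D: "(f has_derivative ?D) (at (x + t *\<^sub>R e))"
    using assms frechet_derivative_works unfolding axis by blast
  have "((\<lambda>s. x + s *\<^sub>R e) has_derivative (\<lambda>s. s *\<^sub>R e)) (at t)"
    by (auto intro!: derivative_eq_intros)
  from has_derivative_compose[OF this D]
  have "((\<lambda>s. f (x + s *\<^sub>R e)) has_derivative (\<lambda>s. ?D (s *\<^sub>R e))) (at t)" .
  moreover have "?D (s *\<^sub>R e) = s * ?D e" for s
    using linear_cmul[OF has_derivative_linear[OF D], of s e] by simp
  ultimately show ?thesis
    unfolding axis partial_deriv_def e_def[symmetric]
    by (simp add: has_field_derivative_def mult_commute_abs)
qed

text \<open>Difference quotients have integral 0 by translation invariance, and they converge to the
  partial derivative under a bound from the mean value theorem.\<close>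

lemma integral_partial_deriv:
  assumes f: "\<And>x. f differentiable (at x)" "continuous_on UNIV (partial_deriv i f)" "periodic f"
  shows "(LINT x|torus. partial_deriv i f x) = 0"
proof -
  have cont: "continuous_on UNIV f"
    using f(1) differentiable_imp_continuous_within by (metis continuous_at_imp_continuous_on)
  define h where "h n = 1 / real (Suc n)" for n
  have h: "0 < h n" "h n \<le> 1" for n
    by (simp_all add: h_def)
  have h0: "h \<longlonglongrightarrow> 0"
    unfolding h_def using LIMSEQ_inverse_real_of_nat by (simp add: inverse_eq_divide)
  define q where "q n x = (f (x + axis i (h n)) - f x) / h n" for n x
  have cont_shift: "continuous_on UNIV (\<lambda>x. f (x + c))" for c
    by (intro continuous_on_compose2[OF cont] continuous_intros) auto
  have cont_q: "continuous_on UNIV (q n)" for n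
    unfolding q_def using h[of n] by (intro continuous_intros cont_shift cont) auto
  \<comment> \<open>Side length 2, because the intermediate point of the mean value theorem may
    leave the fundamental domain by up to 1.\<close>
  have "bounded (partial_deriv i f ` cbox 0 (\<chi> i. 2))"
    by (intro compact_imp_bounded compact_continuous_image continuous_on_subset[OF f(2)]) auto
  then obtain B where B: "\<And>x. x \<in> cbox 0 (\<chi> i. 2) \<Longrightarrow> norm (partial_deriv i f x) \<le> B"
    by (force simp: bounded_iff)
  have "(\<lambda>n. LINT x|torus. q n x) \<longlonglongrightarrow> (LINT x|torus. partial_deriv i f x)"
  proof (rule integral_dominated_convergence[where w="\<lambda>_. B"])
    show "partial_deriv i f \<in> borel_measurable torus" "q n \<in> borel_measurable torus" for n
      using f(2) cont_q by (auto intro: continuous_measurable_torus)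
    show "integrable torus (\<lambda>_. B)"
      by (intro continuous_integrable_torus continuous_intros)
    show "AE x in torus. (\<lambda>n. q n x) \<longlonglongrightarrow> partial_deriv i f x"
    proof (intro AE_I2)
      fix x
      have axis0: "axis i 0 = (0 :: real^3)"
        by (simp add: vec_eq_iff axis_def)
      have "((\<lambda>t. f (x + axis i t)) has_real_derivative partial_deriv i f (x + axis i 0)) (at 0)"
        by (rule has_real_derivative_along_axis[OF f(1)])
      then have "((\<lambda>t. (f (x + axis i t) - f x) / t) \<longlongrightarrow> partial_deriv i f x) (at 0)"
        by (simp add: DERIV_def axis0)
      moreover have "filterlim h (at 0) sequentially"
        using h0 h(1) by (intro filterlim_atI) (auto intro!: always_eventually simp: less_imp_neq[symmetric])
      ultimately show "(\<lambda>n. q n x) \<longlonglongrightarrow> partial_deriv i f x"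
        unfolding q_def by (rule filterlim_compose)
    qed
    show "AE x in torus. norm (q n x) \<le> B" for n
    proof (intro AE_I2)
      fix x assume x: "x \<in> space torus"
      obtain t where t: "0 < t" "t < h n"
        "f (x + axis i (h n)) - f (x + axis i 0) = (h n - 0) * partial_deriv i f (x + axis i t)"
        using MVT2[OF h(1)[of n], of "\<lambda>t. f (x + axis i t)" "\<lambda>t. partial_deriv i f (x + axis i t)"]
          has_real_derivative_along_axis[OF f(1)] by blast
      have axis0: "axis i 0 = (0 :: real^3)"
        by (simp add: vec_eq_iff axis_def)
      have "q n x = partial_deriv i f (x + axis i t)"
        using t(3) h[of n] unfolding axis0 by (simp add: q_def)
      moreover have "x + axis i t \<in> cbox 0 (\<chi> i. 2)"
        unfolding mem_box_cart
      proof
        fix j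
        have "0 \<le> x $ j" "x $ j < 1"
          using x by (auto simp: space_torus)
        then show "0 $ j \<le> (x + axis i t) $ j \<and> (x + axis i t) $ j \<le> (\<chi> i. 2) $ j"
          using t(1,2) h(2)[of n] by (auto simp: axis_def)
      qed
      ultimately show "norm (q n x) \<le> B"
        using B by simp
    qed
  qed
  moreover have "(LINT x|torus. q n x) = 0" for n
  proof -
    have "(LINT x|torus. f (x + axis i (h n)) - f x) = 0"
      using integral_torus_shift[OF cont f(3), of "h n" i] h[of n]
      by (subst Bochner_Integration.integral_diff)
         (auto intro: continuous_integrable_torus cont cont_shift)
    then show ?thesis
      by (simp add: q_def)
  qed
  ultimately show ?thesis
    by (simp add: LIMSEQ_const_iff)
qed

section \<open>The functions cas, their orthogonality and their derivatives\<close>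

definition phase :: "int^3 \<Rightarrow> real^3 \<Rightarrow> real" where
  "phase k x = 2 * pi * (\<Sum>i\<in>UNIV. of_int (k $ i) * x $ i)"

text \<open>Kernel of the Hartley transform: one real function per frequency, so no half of the
  lattice has to be singled out as it would be for cosine and sine pairs.\<close>

definition cas :: "int^3 \<Rightarrow> real^3 \<Rightarrow> real" where
  "cas k x = cos (phase k x) + sin (phase k x)"

lemma phase_add_axis: "phase k (x + axis i h) = phase k x + 2 * pi * (of_int (k $ i) * h)"
proof -
  have "(\<Sum>j\<in>UNIV. real_of_int (k $ j) * (x + axis i h) $ j) =
      (\<Sum>j\<in>UNIV. of_int (k $ j) * x $ j + (if j = i then of_int (k $ i) * h else 0))"
    by (intro sum.cong) (auto simp: axis_def algebra_simps)
  then show ?thesis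
    by (simp add: phase_def sum.distrib distrib_left)
qed

lemma phase_add: "phase (k + l) x = phase k x + phase l x"
  and phase_diff: "phase (k - l) x = phase k x - phase l x"
  and phase_minus: "phase (- k) x = - phase k x"
  and phase_0: "phase 0 x = 0"
  by (simp_all add: phase_def algebra_simps sum.distrib sum_subtractf sum_negf)

lemma continuous_phase [continuous_intros]: "continuous_on S (phase k)"
  unfolding phase_def by (intro continuous_intros)

lemma continuous_cas [continuous_intros]: "continuous_on S (cas k)"
  unfolding cas_def by (intro continuous_intros)

lemma periodic_phase: "periodic (\<lambda>x. cos (phase k x))" "periodic (\<lambda>x. sin (phase k x))"
  by (simp_all add: periodic_def phase_add_axis cos_add sin_add)

lemma periodic_cas: "periodic (cas k)"
  using periodic_phase[of k] by (simp add: periodic_def cas_def)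

lemma cas_0: "cas 0 x = 1"
  by (simp add: cas_def phase_0)

lemma cos_phase_eq: "cos (phase k x) = (cas k x + cas (- k) x) / 2"
  and sin_phase_eq: "sin (phase k x) = (cas k x - cas (- k) x) / 2"
  by (simp_all add: cas_def phase_minus)

lemma cas_mult: "cas k x * cas l x = cos (phase (k - l) x) + sin (phase (k + l) x)"
  by (simp add: cas_def phase_add phase_diff cos_diff sin_add algebra_simps)

lemma integral_cos_sin_phase:
  assumes "k \<noteq> 0"
  shows "(LINT x|torus. cos (phase k x)) = 0" "(LINT x|torus. sin (phase k x)) = 0"
proof -
  obtain i where i: "k $ i \<noteq> 0"
    using assms by (auto simp: vec_eq_iff)
  \<comment> \<open>Half a wavelength in a direction with \<open>k $ i\<close> nonzero: this shift
    reverses the sign of cosine and sine, so each integral equals its own negative.\<close>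
  define h where "h = 1 / (2 * real_of_int \<bar>k $ i\<bar>)"
  have h: "0 \<le> h" "h \<le> 1"
    using i by (auto simp: h_def divide_simps)
  have "2 * pi * (of_int (k $ i) * h) = pi \<or> 2 * pi * (of_int (k $ i) * h) = - pi"
    using i by (cases "k $ i > 0") (auto simp: h_def)
  then have "cos (2 * pi * (of_int (k $ i) * h)) = - 1" "sin (2 * pi * (of_int (k $ i) * h)) = 0"
    by (metis cos_minus cos_pi, metis sin_minus sin_pi neg_0_equal_iff_equal)
  then have flip: "cos (phase k (x + axis i h)) = - cos (phase k x)"
    "sin (phase k (x + axis i h)) = - sin (phase k x)" for x
    by (simp_all add: phase_add_axis cos_add sin_add)
  have "(LINT x|torus. cos (phase k x)) = - (LINT x|torus. cos (phase k x))"
    using integral_torus_shift[OF _ periodic_phase(1) h, of k i]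
    by (simp add: flip continuous_intros)
  then show "(LINT x|torus. cos (phase k x)) = 0"
    by simp
  have "(LINT x|torus. sin (phase k x)) = - (LINT x|torus. sin (phase k x))"
    using integral_torus_shift[OF _ periodic_phase(2) h, of k i]
    by (simp add: flip continuous_intros)
  then show "(LINT x|torus. sin (phase k x)) = 0"
    by simp
qed

lemma integral_cas_mult: "(LINT x|torus. cas k x * cas l x) = (if k = l then 1 else 0)"
proof -
  have int: "integrable torus (\<lambda>x. cos (phase k x))" "integrable torus (\<lambda>x. sin (phase k x))" for k
    by (intro continuous_integrable_torus continuous_intros)+
  have "(LINT x|torus. cos (phase k x)) = (if k = 0 then 1 else 0)" for k
    by (cases "k = 0") (auto simp: integral_cos_sin_phase phase_0 measure_torus)
  moreover have "(LINT x|torus. sin (phase k x)) = 0" for k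
    by (cases "k = 0") (auto simp: integral_cos_sin_phase phase_0)
  ultimately show ?thesis
    by (simp add: cas_mult int)
qed

lemma has_derivative_cas:
  "(cas k has_derivative (\<lambda>d. cas (- k) x * phase k d)) (at x)"
proof -
  have "(phase k has_derivative phase k) (at x)"
    unfolding phase_def
    by (intro bounded_linear_imp_has_derivative bounded_linear_const_mult bounded_linear_sum bounded_linear_vec_nth)
  then show ?thesis
    unfolding cas_def[abs_def] phase_minus by (auto intro!: derivative_eq_intros simp: algebra_simps)
qed

lemma partial_deriv_cas: "partial_deriv i (cas k) = (\<lambda>x. 2 * pi * of_int (k $ i) * cas (- k) x)"
proof
  fix x
  have "phase k (axis i 1) = 2 * pi * of_int (k $ i)"
    using phase_add_axis[of k 0 i 1] by (simp add: phase_def)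
  then show "partial_deriv i (cas k) x = 2 * pi * of_int (k $ i) * cas (- k) x"
    unfolding partial_deriv_def frechet_derivative_at[OF has_derivative_cas[of k x], symmetric] by simp
qed

lemma differentiable_cas: "cas k differentiable (at x)"
  using has_derivative_cas by (rule differentiableI)

lemma partial_deriv_cmult:
  assumes "f differentiable (at x)"
  shows "partial_deriv i (\<lambda>x. c * f x) x = c * partial_deriv i f x"
proof -
  have "(f has_derivative frechet_derivative f (at x)) (at x)"
    using assms frechet_derivative_works by blast
  then have "((\<lambda>x. c * f x) has_derivative (\<lambda>d. c * frechet_derivative f (at x) d)) (at x)"
    by (rule has_derivative_mult_right)
  from frechet_derivative_at[OF this, symmetric] show ?thesis
    by (simp add: partial_deriv_def)
qed

lemma partial_deriv_mult:
  assumes f: "f differentiable (at x)" and g: "g differentiable (at x)"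
  shows "partial_deriv i (\<lambda>x. f x * g x) x = partial_deriv i f x * g x + f x * partial_deriv i g x"
proof -
  have "(f has_derivative frechet_derivative f (at x)) (at x)" "(g has_derivative frechet_derivative g (at x)) (at x)"
    using assms frechet_derivative_works by blast+
  from has_derivative_mult[OF this] have "((\<lambda>x. f x * g x) has_derivative
      (\<lambda>d. f x * frechet_derivative g (at x) d + frechet_derivative f (at x) d * g x)) (at x)" .
  from frechet_derivative_at[OF this, symmetric] show ?thesis
    by (simp add: partial_deriv_def)
qed

lemma test_function_cas: "test_function (cas k)"
proof -
  \<comment> \<open>Differentiation changes both the factor and the frequency, so the induction runs
    over all multiples of all the functions.\<close>
  have "C_k n (\<lambda>x. c * cas k x)" for n c k
  proof (induction n arbitrary: c k)
    case 0
    then show ?case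
      by (simp add: continuous_intros)
  next
    case (Suc n)
    have "partial_deriv i (\<lambda>x. c * cas k x) = (\<lambda>x. (c * (2 * pi * of_int (k $ i))) * cas (- k) x)" for i
      using partial_deriv_cas[of i k] by (simp add: partial_deriv_cmult[OF differentiable_cas] fun_eq_iff)
    then show ?case
      using Suc differentiable_cas by (auto intro!: differentiable_mult)
  qed
  from this[of _ 1 k] show ?thesis
    using periodic_cas[of k] by (simp add: test_function_def periodic_def)
qed

lemma test_functionD:
  assumes "test_function \<phi>"
  shows test_function_continuous: "continuous_on UNIV \<phi>"
    and test_function_differentiable: "\<phi> differentiable (at x)"
    and test_function_continuous_partial: "continuous_on UNIV (partial_deriv i \<phi>)"
    and test_function_periodic: "periodic \<phi>"
proof -
  have "C_k 0 \<phi>" "C_k (Suc 0) \<phi>"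
    using assms by (auto simp: test_function_def simp del: C_k.simps)
  then show "continuous_on UNIV \<phi>" "\<phi> differentiable (at x)" "continuous_on UNIV (partial_deriv i \<phi>)"
    by auto
  show "periodic \<phi>"
    using assms by (simp add: test_function_def periodic_def)
qed

text \<open>Integration by parts: the product of \<open>\<phi>\<close> and \<open>cas k\<close> is
  periodic, so its partial derivative has integral 0.\<close>

lemma integral_partial_deriv_cas:
  assumes "test_function \<phi>"
  shows "(LINT x|torus. partial_deriv i \<phi> x * cas k x) =
    - (2 * pi * of_int (k $ i)) * (LINT x|torus. \<phi> x * cas (- k) x)"
proof -
  note \<phi> = test_functionD[OF assms]
  have pd: "partial_deriv i (\<lambda>x. \<phi> x * cas k x) =
      (\<lambda>x. partial_deriv i \<phi> x * cas k x + (2 * pi * of_int (k $ i)) * (\<phi> x * cas (- k) x))"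
    by (simp add: fun_eq_iff partial_deriv_mult[OF \<phi>(2) differentiable_cas] partial_deriv_cas)
  have "(LINT x|torus. partial_deriv i (\<lambda>x. \<phi> x * cas k x) x) = 0"
  proof (rule integral_partial_deriv)
    show "continuous_on UNIV (partial_deriv i (\<lambda>x. \<phi> x * cas k x))"
      unfolding pd by (intro continuous_intros \<phi>)
    show "periodic (\<lambda>x. \<phi> x * cas k x)"
      using \<phi>(4) periodic_cas[of k] by (simp add: periodic_def)
  qed (intro differentiable_mult \<phi> differentiable_cas)
  moreover have "integrable torus (\<lambda>x. partial_deriv i \<phi> x * cas k x)" "integrable torus (\<lambda>x. \<phi> x * cas (- k) x)"
    by (intro continuous_integrable_torus continuous_intros \<phi>)+
  ultimately show ?thesis
    unfolding pd by simp
qed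

section \<open>The Fourier basis\<close>

definition axis_field :: "(real^3 \<Rightarrow> real) \<Rightarrow> 3 \<Rightarrow> L2" where
  "axis_field \<phi> j = abs_L2 (\<lambda>x. \<phi> x *\<^sub>R axis j 1)"

lemma square_integrable_axis_field:
  assumes "continuous_on UNIV \<phi>"
  shows "square_integrable (\<lambda>x. \<phi> x *\<^sub>R axis j 1)"
  unfolding square_integrable_def
  by (intro conjI continuous_measurable_torus continuous_integrable_torus continuous_intros assms)

lemma inner_axis_field:
  assumes "continuous_on UNIV \<phi>"
  shows "inner v (axis_field \<phi> j) = (LINT x|torus. \<phi> x * rep_L2 v x $ j)"
proof -
  have "inner v (axis_field \<phi> j) = (LINT x|torus. rep_L2 v x \<bullet> (\<phi> x *\<^sub>R axis j 1))"
    unfolding axis_field_def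
    using inner_abs_L2[OF square_integrable_rep_L2 square_integrable_axis_field[OF assms], of v j]
    by (simp add: abs_L2_rep_L2)
  then show ?thesis
    by (simp add: inner_axis)
qed

lemma integrable_mult_rep_L2:
  assumes "continuous_on UNIV \<phi>"
  shows "integrable torus (\<lambda>x. \<phi> x * rep_L2 v x $ j)"
  using square_integrable_inner[OF square_integrable_rep_L2 square_integrable_axis_field[OF assms], of v j]
  by (simp add: inner_axis)

lemma inner_axis_field_axis_field:
  assumes "continuous_on UNIV \<phi>" "continuous_on UNIV \<psi>"
  shows "inner (axis_field \<phi> i) (axis_field \<psi> j) = (if i = j then LINT x|torus. \<phi> x * \<psi> x else 0)"
  unfolding axis_field_def
  by (subst inner_abs_L2) (auto simp: square_integrable_axis_field assms inner_axis_axis mult.commute)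

text \<open>Turns the vector-valued integrals in \<open>has_weak_deriv\<close> and \<open>H\<close>
  into inner products with fields along one axis.\<close>

lemma integral_scaleR_rep_L2:
  assumes "continuous_on UNIV \<phi>"
  shows "(LINT x|torus. \<phi> x *\<^sub>R rep_L2 v x) $ j = inner v (axis_field \<phi> j)"
proof -
  have [measurable]: "\<phi> \<in> borel_measurable torus" "rep_L2 v \<in> borel_measurable torus"
    using continuous_measurable_torus[OF assms] square_integrable_measurable[OF square_integrable_rep_L2] .
  have "integrable torus (\<lambda>x. \<phi> x *\<^sub>R rep_L2 v x)"
  proof (rule Bochner_Integration.integrable_bound)
    show "integrable torus (\<lambda>x. (\<phi> x)\<^sup>2 + (norm (rep_L2 v x))\<^sup>2)"
      using square_integrable_rep_L2[of v]
      by (intro Bochner_Integration.integrable_add continuous_integrable_torus[of "\<lambda>x. (\<phi> x)\<^sup>2"]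
          continuous_intros assms) (simp add: square_integrable_def)
    have "\<bar>a\<bar> * b \<le> a\<^sup>2 + b\<^sup>2" if "b \<ge> 0" for a b :: real
      using sum_squares_bound[of "\<bar>a\<bar>" b] mult_nonneg_nonneg[of "\<bar>a\<bar>" b] that
      unfolding power2_abs by linarith
    then show "AE x in torus. norm (\<phi> x *\<^sub>R rep_L2 v x) \<le> norm ((\<phi> x)\<^sup>2 + (norm (rep_L2 v x))\<^sup>2)"
      by simp
  qed measurable
  then have "(LINT x|torus. \<phi> x *\<^sub>R rep_L2 v x) $ j = (LINT x|torus. (\<phi> x *\<^sub>R rep_L2 v x) $ j)"
    by (intro integral_bounded_linear[symmetric] bounded_linear_vec_nth)
  then show ?thesis
    by (simp add: inner_axis_field[OF assms])
qed

section \<open>Trigonometric polynomials and completeness of the Fourier basis\<close>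

inductive trig_poly :: "(real^3 \<Rightarrow> real) \<Rightarrow> bool" where
  trig_poly_cas: "trig_poly (cas k)"
| trig_poly_cmult: "trig_poly p \<Longrightarrow> trig_poly (\<lambda>x. c * p x)"
| trig_poly_add: "trig_poly p \<Longrightarrow> trig_poly q \<Longrightarrow> trig_poly (\<lambda>x. p x + q x)"

lemma trig_poly_const: "trig_poly (\<lambda>x. c)"
  using trig_poly_cmult[OF trig_poly_cas, of c 0] by (simp add: cas_0)

lemma trig_poly_cos: "trig_poly (\<lambda>x. cos (phase k x))"
  using trig_poly_add[OF trig_poly_cmult trig_poly_cmult, OF trig_poly_cas trig_poly_cas, of "1 / 2" k "1 / 2" "- k"]
  by (simp add: cos_phase_eq add_divide_distrib)

lemma trig_poly_sin: "trig_poly (\<lambda>x. sin (phase k x))"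
  using trig_poly_add[OF trig_poly_cmult trig_poly_cmult, OF trig_poly_cas trig_poly_cas, of "1 / 2" k "- 1 / 2" "- k"]
  by (simp add: sin_phase_eq diff_divide_distrib)

lemma trig_poly_sum:
  "finite I \<Longrightarrow> (\<And>i. i \<in> I \<Longrightarrow> trig_poly (p i)) \<Longrightarrow> trig_poly (\<lambda>x. \<Sum>i\<in>I. p i x)"
  by (induction I rule: finite_induct) (auto intro: trig_poly_const trig_poly_add)

lemma trig_poly_mult:
  assumes "trig_poly p" "trig_poly q"
  shows "trig_poly (\<lambda>x. p x * q x)"
  using assms(1)
proof induction
  case (trig_poly_cas k)
  from assms(2) show ?case
  proof induction
    case (trig_poly_cas l)
    have "trig_poly (\<lambda>x. cos (phase (k - l) x) + sin (phase (k + l) x))"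
      by (rule trig_poly_add[OF trig_poly_cos trig_poly_sin])
    then show ?case
      by (simp add: cas_mult)
  next
    case (trig_poly_cmult p c)
    from trig_poly.trig_poly_cmult[OF trig_poly_cmult.IH, of c] show ?case
      by (simp add: algebra_simps)
  next
    case (trig_poly_add p q)
    from trig_poly.trig_poly_add[OF trig_poly_add.IH] show ?case
      by (simp add: algebra_simps)
  qed
next
  case (trig_poly_cmult p c)
  from trig_poly.trig_poly_cmult[OF trig_poly_cmult.IH, of c] show ?case
    by (simp add: algebra_simps)
next
  case (trig_poly_add p q)
  from trig_poly.trig_poly_add[OF trig_poly_add.IH] show ?case
    by (simp add: algebra_simps)
qed

lemma trig_poly_continuous: "trig_poly p \<Longrightarrow> continuous_on UNIV p"
  by (induction rule: trig_poly.induct) (auto intro!: continuous_intros)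

text \<open>Maps the torus into a product of three circles in six-dimensional space, where
  polynomials in the coordinates become trigonometric polynomials.\<close>

definition circle_coords :: "real^3 \<Rightarrow> (real^3) \<times> (real^3)" where
  "circle_coords x = ((\<chi> i. cos (phase (axis i 1) x)), (\<chi> i. sin (phase (axis i 1) x)))"

lemma phase_axis: "phase (axis i 1) x = 2 * pi * x $ i"
proof -
  have "(\<Sum>j\<in>UNIV. real_of_int ((axis i 1 :: int^3) $ j) * x $ j) = (\<Sum>j\<in>UNIV. if j = i then x $ j else 0)"
    by (intro sum.cong) (auto simp: axis_def)
  then show ?thesis
    by (simp add: phase_def)
qed

lemma continuous_circle_coords: "continuous_on S circle_coords"
  unfolding circle_coords_def by (intro continuous_intros)

text \<open>Equal coordinates differ by an integer, and the half-open domain leaves only the integer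
  0.\<close>

lemma inj_on_circle_coords: "inj_on circle_coords (space torus)"
proof (rule inj_onI)
  fix x y assume x: "x \<in> space torus" and y: "y \<in> space torus" and eq: "circle_coords x = circle_coords y"
  have "x $ i = y $ i" for i
  proof -
    have "cos (2 * pi * x $ i) = cos (2 * pi * y $ i)" "sin (2 * pi * x $ i) = sin (2 * pi * y $ i)"
      using eq by (auto simp: circle_coords_def phase_axis vec_eq_iff)
    then obtain n :: int where "2 * pi * x $ i = 2 * pi * y $ i + 2 * pi * n"
      using sin_cos_eq_iff by metis
    then have "2 * pi * (x $ i) = 2 * pi * (y $ i + n)"
      by (simp add: distrib_left)
    then have n: "x $ i = y $ i + n"
      by simp
    moreover have "0 \<le> x $ i" "x $ i < 1" "0 \<le> y $ i" "y $ i < 1"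
      using x y by (auto simp: space_torus)
    ultimately have "real_of_int n < 1" "real_of_int n > -1"
      by linarith+
    then have "n = 0"
      by linarith
    with n show ?thesis
      by simp
  qed
  then show "x = y"
    by (simp add: vec_eq_iff)
qed

text \<open>A linear functional of the coordinates is a combination of three cosines and three
  sines; products are handled by \<open>trig_poly_mult\<close>.\<close>

lemma trig_poly_polynomial:
  assumes "real_polynomial_function R"
  shows "trig_poly (\<lambda>x. R (circle_coords x))"
  using assms
proof induction
  case (linear f)
  interpret bounded_linear f by fact
  have vec: "u = (\<Sum>i\<in>UNIV. u $ i *\<^sub>R axis i 1)" for u :: "real^3"
    using basis_expansion[of u] by (simp add: scalar_mult_eq_scaleR)
  have split: "f (u, w) = (\<Sum>i\<in>UNIV. u $ i * f (axis i 1, 0)) + (\<Sum>i\<in>UNIV. w $ i * f (0, axis i 1))"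
    for u w :: "real^3"
  proof -
    have "(u, w) = (\<Sum>i\<in>UNIV. u $ i *\<^sub>R (axis i 1, 0)) + (\<Sum>i\<in>UNIV. w $ i *\<^sub>R (0, axis i 1))"
      by (simp add: sum_prod vec[symmetric])
    then show ?thesis
      by (simp only: add sum scaleR real_scaleR_def)
  qed
  have "(\<lambda>x. f (circle_coords x)) = (\<lambda>x. (\<Sum>i\<in>UNIV. f (axis i 1, 0) * cos (phase (axis i 1) x)) +
      (\<Sum>i\<in>UNIV. f (0, axis i 1) * sin (phase (axis i 1) x)))"
    using split[of "fst (circle_coords x)" "snd (circle_coords x)" for x]
    by (intro ext) (simp add: circle_coords_def mult.commute)
  moreover have "trig_poly \<dots>"
    by (intro trig_poly_add trig_poly_sum trig_poly_cmult trig_poly_cos trig_poly_sin) auto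
  ultimately show ?case
    by simp
qed (auto intro: trig_poly_const trig_poly_add trig_poly_mult)

text \<open>Six coordinates of modulus at most 1. The bound fixes the compact ball on which
  polynomials approximate.\<close>

lemma bounded_circle_coords: "norm (circle_coords x) \<le> 6"
proof -
  have "norm (circle_coords x) \<le> norm (fst (circle_coords x)) + norm (snd (circle_coords x))"
    by (metis norm_Pair_le prod.collapse)
  also have "\<dots> \<le> (\<Sum>i\<in>(UNIV::3 set). 1) + (\<Sum>i\<in>(UNIV::3 set). 1)"
    unfolding circle_coords_def fst_conv snd_conv
    by (intro add_mono order_trans[OF norm_le_l1_cart] sum_mono) auto
  finally show ?thesis
    by simp
qed

text \<open>Stone--Weierstrass on the image of the torus under \<^const>\<open>circle_coords\<close>.\<close>

lemma orthogonal_trig_poly_continuous: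
  fixes F :: "(real^3) \<times> (real^3) \<Rightarrow> real"
  assumes g: "integrable torus g" and trig: "\<And>p. trig_poly p \<Longrightarrow> (LINT x|torus. p x * g x) = 0"
    and F: "continuous_on UNIV F"
  shows "(LINT x|torus. F (circle_coords x) * g x) = 0"
proof -
  have [measurable]: "g \<in> borel_measurable torus"
    using g by auto
  have int: "integrable torus (\<lambda>x. f x * g x)" if "continuous_on UNIV f" for f :: "real^3 \<Rightarrow> real"
  proof -
    obtain B where B: "\<And>x. x \<in> space torus \<Longrightarrow> norm (f x) \<le> B"
      using continuous_bounded_torus[OF \<open>continuous_on UNIV f\<close>] by metis
    show ?thesis
    proof (rule Bochner_Integration.integrable_bound)
      show "integrable torus (\<lambda>x. B * norm (g x))"
        using g by simp
      show "(\<lambda>x. f x * g x) \<in> borel_measurable torus"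
        using continuous_measurable_torus[OF \<open>continuous_on UNIV f\<close>] by measurable
      show "AE x in torus. norm (f x * g x) \<le> norm (B * norm (g x))"
      proof (rule AE_I2)
        fix x assume "x \<in> space torus"
        then have "\<bar>f x\<bar> \<le> \<bar>B\<bar>"
          using B[of x] by simp
        then show "norm (f x * g x) \<le> norm (B * norm (g x))"
          by (simp add: abs_mult mult_right_mono)
      qed
    qed
  qed
  have contF: "continuous_on UNIV (\<lambda>x. F (circle_coords x))"
    by (rule continuous_on_compose2[OF F continuous_circle_coords]) auto
  define C where "C = (LINT x|torus. norm (g x))"
  have "\<bar>LINT x|torus. F (circle_coords x) * g x\<bar> \<le> \<epsilon> * C" if "\<epsilon> > 0" for \<epsilon>
  proof -
    obtain R where R: "real_polynomial_function R"
      "\<And>z. z \<in> cball 0 6 \<Longrightarrow> \<bar>F z - R z\<bar> < \<epsilon>"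
      using Stone_Weierstrass_real_polynomial_function[OF compact_cball continuous_on_subset[OF F] \<open>\<epsilon> > 0\<close>, of 0 6]
      by auto
    let ?p = "\<lambda>x. R (circle_coords x)"
    have p: "trig_poly ?p"
      by (rule trig_poly_polynomial[OF R(1)])
    have "(LINT x|torus. F (circle_coords x) * g x) = (LINT x|torus. F (circle_coords x) * g x) - (LINT x|torus. ?p x * g x)"
      using trig[OF p] by simp
    also have "\<dots> = (LINT x|torus. F (circle_coords x) * g x - ?p x * g x)"
      by (intro Bochner_Integration.integral_diff[symmetric] int contF trig_poly_continuous p)
    also have "\<bar>\<dots>\<bar> \<le> (LINT x|torus. norm (F (circle_coords x) * g x - ?p x * g x))"
      unfolding real_norm_def[symmetric] by (rule integral_norm_bound)
    also have "\<dots> \<le> (LINT x|torus. \<epsilon> * norm (g x))"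
    proof (rule integral_mono)
      show "integrable torus (\<lambda>x. norm (F (circle_coords x) * g x - ?p x * g x))"
        by (intro integrable_norm Bochner_Integration.integrable_diff int contF trig_poly_continuous p)
      show "integrable torus (\<lambda>x. \<epsilon> * norm (g x))"
        using g by simp
      fix x
      have "\<bar>F (circle_coords x) - ?p x\<bar> \<le> \<epsilon>"
        using R(2)[of "circle_coords x"] bounded_circle_coords[of x] by simp
      then show "norm (F (circle_coords x) * g x - ?p x * g x) \<le> \<epsilon> * norm (g x)"
        by (simp add: abs_mult mult_right_mono flip: left_diff_distrib)
    qed
    finally show ?thesis
      by (simp add: C_def)
  qed
  then have "\<bar>LINT x|torus. F (circle_coords x) * g x\<bar> \<le> \<epsilon>" if "\<epsilon> > 0" for \<epsilon>
  proof -
    have C: "C \<ge> 0"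
      unfolding C_def by (rule integral_nonneg_AE) simp
    then have "\<bar>LINT x|torus. F (circle_coords x) * g x\<bar> \<le> \<epsilon> / (C + 1) * C"
      using \<open>\<And>\<epsilon>. \<epsilon> > 0 \<Longrightarrow> \<bar>LINT x|torus. F (circle_coords x) * g x\<bar> \<le> \<epsilon> * C\<close>[of "\<epsilon> / (C + 1)"] that
      by simp
    also have "\<dots> \<le> \<epsilon>"
      using C that by (simp add: field_simps)
    finally show ?thesis .
  qed
  then show ?thesis
    using field_le_epsilon[of "\<bar>LINT x|torus. F (circle_coords x) * g x\<bar>" 0] by simp
qed

text \<open>The image of a compact \<open>L\<close> is closed, so the indicator of \<open>L\<close>
  is the limit of continuous cut-offs of the distance to that image; injectivity keeps the image of
  a point outside \<open>L\<close> at positive distance.\<close>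

lemma orthogonal_trig_poly_compact:
  assumes g: "integrable torus g" and trig: "\<And>p. trig_poly p \<Longrightarrow> (LINT x|torus. p x * g x) = 0"
    and L: "compact L" "L \<subseteq> space torus"
  shows "(LINT x|torus. indicator L x * g x) = 0"
proof (cases "L = {}")
  case False
  have [measurable]: "g \<in> borel_measurable torus"
    using g by auto
  let ?K = "circle_coords ` L"
  have "compact ?K"
    by (rule compact_continuous_image[OF continuous_circle_coords L(1)])
  then have K: "closed ?K"
    by (rule compact_imp_closed)
  define F where "F n z = max 0 (1 - real n * infdist z ?K)" for n and z :: "(real^3) \<times> (real^3)"
  have F: "continuous_on UNIV (F n)" for n
    unfolding F_def by (intro continuous_intros)
  have F01: "\<bar>F n z\<bar> \<le> 1" for n z
    using infdist_nonneg[of z ?K] by (simp add: F_def)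
  have cont: "continuous_on UNIV (\<lambda>x. F n (circle_coords x))" for n
    by (rule continuous_on_compose2[OF F continuous_circle_coords]) auto
  have "(\<lambda>n. LINT x|torus. F n (circle_coords x) * g x) \<longlonglongrightarrow> (LINT x|torus. indicator L x * g x)"
  proof (rule integral_dominated_convergence[where w="\<lambda>x. norm (g x)"])
    have "L \<in> sets torus"
      unfolding torus_def
      using L compact_imp_closed[OF L(1)] by (auto simp: sets_restrict_space_iff space_torus[symmetric] space_torus_in_borel)
    then show "(\<lambda>x. indicator L x * g x) \<in> borel_measurable torus"
      by measurable
    show "(\<lambda>x. F n (circle_coords x) * g x) \<in> borel_measurable torus" for n
      using continuous_measurable_torus[OF cont] by measurable
    show "integrable torus (\<lambda>x. norm (g x))"
      using g by simp
    show "AE x in torus. norm (F n (circle_coords x) * g x) \<le> norm (g x)" for n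
      by (intro AE_I2) (simp add: abs_mult mult_left_le_one_le F01)
    show "AE x in torus. (\<lambda>n. F n (circle_coords x) * g x) \<longlonglongrightarrow> indicator L x * g x"
    proof (intro AE_I2 tendsto_mult tendsto_const)
      fix x assume x: "x \<in> space torus"
      show "(\<lambda>n. F n (circle_coords x)) \<longlonglongrightarrow> indicator L x"
      proof (cases "x \<in> L")
        case True
        then show ?thesis
          by (simp add: F_def)
      next
        case xL: False
        then have "circle_coords x \<notin> ?K"
          using inj_on_circle_coords x L(2) by (auto simp: inj_on_def)
        then have d: "infdist (circle_coords x) ?K > 0"
          using K False infdist_pos_not_in_closed by blast
        then obtain N where N: "1 / infdist (circle_coords x) ?K \<le> real N"
          using real_arch_simple by blast
        have "F n (circle_coords x) = 0" if "n \<ge> N" for n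
        proof -
          have "1 \<le> real N * infdist (circle_coords x) ?K"
            using N d by (simp add: pos_divide_le_eq)
          also have "\<dots> \<le> real n * infdist (circle_coords x) ?K"
            using d that by (intro mult_right_mono) auto
          finally show ?thesis
            by (simp add: F_def)
        qed
        then have "(\<lambda>n. F n (circle_coords x)) \<longlonglongrightarrow> 0"
          by (intro tendsto_eventually) (auto simp: eventually_sequentially)
        then show ?thesis
          using xL by simp
      qed
    qed
  qed
  moreover have "(LINT x|torus. F n (circle_coords x) * g x) = 0" for n
    by (rule orthogonal_trig_poly_continuous[OF g trig F])
  ultimately show ?thesis
    by (simp add: LIMSEQ_const_iff)
qed simp

text \<open>The set where g is positive is, up to a null set, a countable union of compact sets; on
  each of them a positive function has integral 0, so each is null.\<close>

lemma AE_nonpos_torus: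
  fixes g :: "real^3 \<Rightarrow> real"
  assumes g: "integrable torus g"
    and zero: "\<And>L. compact L \<Longrightarrow> L \<subseteq> space torus \<Longrightarrow> (LINT x|torus. indicator L x * g x) = 0"
  shows "AE x in torus. g x \<le> 0"
proof -
  have [measurable]: "g \<in> borel_measurable torus"
    using g by auto
  define A where "A = {x \<in> space torus. 0 < g x}"
  have "A \<in> sets torus"
    unfolding A_def by measurable
  then have "A \<in> sets lebesgue"
    unfolding torus_def by (subst (asm) sets_restrict_space_iff) (auto simp: box_in_borel)
  then obtain C T where CT: "fsigma C" "T \<in> null_sets lebesgue" "C \<union> T = A"
    using lebesgue_set_almost_fsigma by metis
  obtain L :: "nat \<Rightarrow> (real^3) set" where L: "range L \<subseteq> Collect compact" "C = \<Union>(range L)"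
    using CT(1) unfolding fsigma_Union_compact by blast
  have "AE x in torus. x \<notin> L n" for n
  proof -
    have Ln: "compact (L n)" "L n \<subseteq> A"
      using L CT(3) by auto
    then have sub: "L n \<subseteq> space torus"
      by (auto simp: A_def)
    have [measurable]: "L n \<in> sets torus"
      unfolding torus_def
      using sub compact_imp_closed[OF Ln(1)] by (auto simp: sets_restrict_space_iff space_torus[symmetric] space_torus_in_borel)
    have "integrable torus (\<lambda>x. indicator (L n) x * g x)"
      using integrable_mult_indicator[OF _ g, of "L n"] by simp
    moreover have "AE x in torus. 0 \<le> indicator (L n) x * g x"
      using Ln(2) by (auto simp: A_def indicator_def intro!: AE_I2 less_imp_le)
    ultimately have "AE x in torus. indicator (L n) x * g x = 0"
      using zero[OF Ln(1) sub] integral_nonneg_eq_0_iff_AE by blast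
    then show ?thesis
      by eventually_elim (use Ln(2) in \<open>auto simp: A_def\<close>)
  qed
  then have "AE x in torus. \<forall>n. x \<notin> L n"
    by (simp add: AE_all_countable)
  moreover have "AE x in torus. x \<notin> T"
    unfolding torus_def
    using AE_not_in[OF CT(2)] by (subst AE_restrict_space_iff) (auto simp: box_in_borel)
  moreover have "AE x in torus. x \<in> space torus"
    by simp
  ultimately show ?thesis
  proof eventually_elim
    case (elim x)
    then have "x \<notin> A"
      using CT(3) L(2) by auto
    then show ?case
      using elim by (auto simp: A_def)
  qed
qed

text \<open>Applied to each component and to its negative, \<open>AE_nonpos_torus\<close> makes that
  component vanish almost everywhere.\<close>

lemma axis_field_cas_total:
  assumes v: "\<And>k j. inner v (axis_field (cas k) j) = 0"
  shows "v = 0"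
proof -
  have "AE x in torus. rep_L2 v x $ j = 0" for j
  proof -
    let ?g = "\<lambda>x. rep_L2 v x $ j"
    have int: "integrable torus (\<lambda>x. p x * ?g x)" if "trig_poly p" for p
      using trig_poly_continuous[OF that] by (rule integrable_mult_rep_L2)
    from int[OF trig_poly_const[of 1]] have g: "integrable torus ?g"
      by simp
    have trig: "(LINT x|torus. p x * ?g x) = 0" if "trig_poly p" for p
      using that
    proof induction
      case (trig_poly_cas k)
      then show ?case
        using v[of k j] by (simp add: inner_axis_field continuous_intros)
    next
      case (trig_poly_cmult p c)
      then show ?case
        by (simp add: mult.assoc)
    next
      case (trig_poly_add p q)
      then show ?case
        by (simp add: distrib_right int)
    qed
    have "AE x in torus. ?g x \<le> 0"
      by (rule AE_nonpos_torus[OF g orthogonal_trig_poly_compact[OF g trig]])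
    moreover have "AE x in torus. - ?g x \<le> 0"
    proof (rule AE_nonpos_torus)
      show "(LINT x|torus. indicator L x * - ?g x) = 0" if "compact L" "L \<subseteq> space torus" for L
        using orthogonal_trig_poly_compact[OF g trig that] by simp
    qed (use g in simp)
    ultimately show ?thesis
      by eventually_elim simp
  qed
  then have "AE x in torus. \<forall>j. rep_L2 v x $ j = 0"
    by (subst AE_all_countable) simp
  then have "AE x in torus. rep_L2 v x = 0"
    by eventually_elim (simp add: vec_eq_iff)
  then have "abs_L2 (rep_L2 v) = abs_L2 (\<lambda>x. 0)"
    by (subst abs_L2_eq_iff) (auto simp: square_integrable_rep_L2 square_integrable_zero)
  then show ?thesis
    by (simp add: abs_L2_rep_L2 zero_L2_def)
qed

definition mode :: "(int^3) \<times> 3 \<Rightarrow> L2" where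
  "mode = (\<lambda>(k, j). axis_field (cas k) j)"

global_interpretation fourier: orthonormal_basis mode
proof
  show "inner (mode i) (mode j) = (if i = j then 1 else 0)" for i j
    by (cases i; cases j)
       (auto simp: mode_def inner_axis_field_axis_field continuous_intros integral_cas_mult)
  show "x = 0" if "\<And>i. inner x (mode i) = 0" for x
    by (rule axis_field_cas_total) (use that in \<open>auto simp: mode_def\<close>)
qed

section \<open>The damped Stokes semigroup\<close>

text \<open>The instance of the weak derivative identity for the test function \<open>cas k\<close>,
  read off in component j.\<close>

definition weak_deriv_coeffs :: "3 \<Rightarrow> L2 \<Rightarrow> L2 \<Rightarrow> bool" where
  "weak_deriv_coeffs i v g \<longleftrightarrow>
     (\<forall>k j. inner g (mode (k, j)) = - (2 * pi * of_int (k $ i)) * inner v (mode (- k, j)))"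

definition reflect :: "(int^3) \<times> 3 \<Rightarrow> (int^3) \<times> 3" where
  "reflect = (\<lambda>(k, j). (- k, j))"

lemma bij_reflect: "bij reflect"
  by (rule involuntory_imp_bij) (auto simp: reflect_def)

text \<open>Integration by parts in Fourier space: Parseval for \<open>v\<close> and
  \<open>p\<close>, reindexed by the reflection, is termwise the negative of Parseval for
  \<open>g\<close> and \<open>u\<close>.\<close>

lemma weak_deriv_coeffs_skew:
  assumes g: "weak_deriv_coeffs i v g" and p: "weak_deriv_coeffs i u p"
  shows "inner g u = - inner v p"
proof -
  have "((\<lambda>n. inner v (mode (reflect n)) * inner p (mode (reflect n))) has_sum inner v p) UNIV"
    using fourier.parseval[of v p] has_sum_reindex_bij_betw[OF bij_reflect, of "\<lambda>n. inner v (mode n) * inner p (mode n)"]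
    by simp
  moreover have "inner v (mode (reflect n)) * inner p (mode (reflect n)) = - (inner g (mode n) * inner u (mode n))" for n
    using g p by (cases n) (simp add: reflect_def weak_deriv_coeffs_def)
  ultimately have "((\<lambda>n. - (inner g (mode n) * inner u (mode n))) has_sum inner v p) UNIV"
    by (simp only:)
  moreover have "((\<lambda>n. - (inner g (mode n) * inner u (mode n))) has_sum - inner g u) UNIV"
    by (simp add: has_sum_uminus fourier.parseval)
  ultimately have "inner v p = - inner g u"
    by (rule has_sum_unique)
  then show ?thesis
    by simp
qed

lemma weak_deriv_coeffs_axis_field:
  assumes "test_function \<phi>"
  shows "weak_deriv_coeffs i (axis_field \<phi> j) (axis_field (partial_deriv i \<phi>) j)"
  unfolding weak_deriv_coeffs_def mode_def prod.case
  using test_functionD[OF assms] integral_partial_deriv_cas[OF assms]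
  by (simp add: inner_axis_field_axis_field continuous_cas)

lemma inner_axis_field_cmult:
  assumes "continuous_on UNIV \<phi>"
  shows "inner v (axis_field (\<lambda>x. c * \<phi> x) j) = c * inner v (axis_field \<phi> j)"
  using assms by (simp add: inner_axis_field continuous_intros mult.assoc)

lemma inner_partial_deriv_cas:
  "inner v (axis_field (partial_deriv i (cas k)) j) = 2 * pi * of_int (k $ i) * inner v (mode (- k, j))"
  unfolding partial_deriv_cas mode_def prod.case by (rule inner_axis_field_cmult[OF continuous_cas])

text \<open>A test function has its classical derivative as derivative in the sense of coefficients,
  so skew symmetry extends the identity from the functions \<open>cas k\<close> to every test
  function without any approximation.\<close>

lemma has_weak_deriv_iff: "has_weak_deriv i v g \<longleftrightarrow> weak_deriv_coeffs i v g"
proof -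
  have *: "has_weak_deriv i v g \<longleftrightarrow> (\<forall>\<phi>. test_function \<phi> \<longrightarrow>
      (\<forall>j. inner v (axis_field (partial_deriv i \<phi>) j) = - inner g (axis_field \<phi> j)))"
    unfolding has_weak_deriv_def
    by (intro all_cong1 imp_cong refl)
       (simp add: vec_eq_iff integral_scaleR_rep_L2 test_function_continuous test_function_continuous_partial)
  show ?thesis
  proof
    assume "has_weak_deriv i v g"
    then have "inner v (axis_field (partial_deriv i (cas k)) j) = - inner g (axis_field (cas k) j)" for k j
      using * test_function_cas by blast
    then have "inner g (mode (k, j)) = - inner v (axis_field (partial_deriv i (cas k)) j)" for k j
      by (simp add: mode_def)
    then show "weak_deriv_coeffs i v g"
      by (simp add: weak_deriv_coeffs_def inner_partial_deriv_cas)
  next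
    assume g: "weak_deriv_coeffs i v g"
    show "has_weak_deriv i v g"
      unfolding * using weak_deriv_coeffs_skew[OF g weak_deriv_coeffs_axis_field] by simp
  qed
qed

lemma weak_deriv_eqI:
  assumes "weak_deriv_coeffs i v g"
  shows "weak_deriv i v = g"
  unfolding weak_deriv_def has_weak_deriv_iff
proof (rule the_equality)
  show "weak_deriv_coeffs i v g"
    by (rule assms)
  fix g' assume "weak_deriv_coeffs i v g'"
  with assms show "g' = g"
    by (intro fourier.eqI) (auto simp: weak_deriv_coeffs_def)
qed

lemma weak_deriv_H1:
  assumes "v \<in> H1"
  shows "weak_deriv_coeffs i v (weak_deriv i v)"
  using assms weak_deriv_eqI unfolding H1_def has_weak_deriv_iff by fastforce

section \<open>Divergence-free fields and the Leray projector in Fourier space\<close>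

text \<open>Parseval grouped by frequency. Divergence and projection act on the three coefficients
  at each k separately, so orthogonality is a question about vectors in three dimensions.\<close>

lemma inner_eq_0_fibrewise:
  assumes "\<And>k. (\<Sum>j\<in>UNIV. inner v (mode (k, j)) * inner w (mode (k, j))) = 0"
  shows "inner v w = 0"
proof -
  let ?f = "\<lambda>n. inner v (mode n) * inner w (mode n)"
  have f: "(?f has_sum inner v w) (UNIV \<times> UNIV)"
    using fourier.parseval[of v w] by simp
  then have "?f summable_on (UNIV \<times> UNIV)"
    by (auto simp: summable_on_def)
  then have "infsum (\<lambda>k. infsum (\<lambda>j. ?f (k, j)) UNIV) UNIV = infsum ?f (UNIV \<times> UNIV)"
    by (rule infsum_Sigma_banach)
  then show ?thesis
    using infsumI[OF f] by (simp add: assms)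
qed

lemma divergence_free_iff:
  "divergence_free v \<longleftrightarrow> (\<forall>k. (\<Sum>j\<in>UNIV. of_int (k $ j) * inner v (mode (k, j))) = 0)"
proof -
  have *: "divergence_free v \<longleftrightarrow> (\<forall>\<phi>. test_function \<phi> \<longrightarrow> (\<Sum>j\<in>UNIV. inner v (axis_field (partial_deriv j \<phi>) j)) = 0)"
    unfolding divergence_free_def
    by (intro all_cong1 imp_cong refl)
       (simp add: inner_axis_field test_function_continuous_partial integrable_mult_rep_L2)
  show ?thesis
  proof
    assume div: "divergence_free v"
    show "\<forall>k. (\<Sum>j\<in>UNIV. of_int (k $ j) * inner v (mode (k, j))) = 0"
    proof
      fix k
      \<comment> \<open>The derivative reflects the frequency, so \<open>cas (- k)\<close> is the
        function that tests the coefficients at k.\<close>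
      have "(\<Sum>j\<in>UNIV. inner v (axis_field (partial_deriv j (cas (- k))) j)) = 0"
        using div * test_function_cas by blast
      then have "(\<Sum>j\<in>UNIV. - (2 * pi) * (of_int (k $ j) * inner v (mode (k, j)))) = 0"
        by (simp add: inner_partial_deriv_cas mult.assoc)
      then show "(\<Sum>j\<in>UNIV. of_int (k $ j) * inner v (mode (k, j))) = 0"
        unfolding sum_distrib_left[symmetric] by simp
    qed
  next
    assume k: "\<forall>k. (\<Sum>j\<in>UNIV. of_int (k $ j) * inner v (mode (k, j))) = 0"
    show "divergence_free v"
      unfolding *
    proof (intro allI impI)
      fix \<phi> assume \<phi>: "test_function \<phi>"
      \<comment> \<open>The gradient of \<open>\<phi>\<close>: its coefficient vector at k is a
        multiple of k itself, hence orthogonal to that of \<open>v\<close>.\<close>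
      let ?w = "\<Sum>i\<in>UNIV. axis_field (partial_deriv i \<phi>) i"
      define c where "c k = - (2 * pi) * (LINT x|torus. \<phi> x * cas (- k) x)" for k
      have "inner (axis_field (partial_deriv i \<phi>) i) (mode (k, j)) = (if i = j then of_int (k $ j) * c k else 0)" for i j k
        using test_functionD[OF \<phi>] integral_partial_deriv_cas[OF \<phi>]
        by (simp add: mode_def inner_axis_field_axis_field continuous_cas c_def)
      then have "inner ?w (mode (k, j)) = of_int (k $ j) * c k" for k j
        by (simp add: inner_sum_left)
      then have "(\<Sum>j\<in>UNIV. inner v (mode (k, j)) * inner ?w (mode (k, j))) = 
          c k * (\<Sum>j\<in>UNIV. of_int (k $ j) * inner v (mode (k, j)))" for k
        by (simp add: sum_distrib_left mult_ac)
      then have "inner v ?w = 0"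
        using k by (intro inner_eq_0_fibrewise) simp
      then show "(\<Sum>j\<in>UNIV. inner v (axis_field (partial_deriv j \<phi>) j)) = 0"
        by (simp add: inner_sum_right)
    qed
  qed
qed

lemma mem_H_iff:
  "v \<in> H \<longleftrightarrow> (\<forall>k. (\<Sum>j\<in>UNIV. of_int (k $ j) * inner v (mode (k, j))) = 0) \<and>
    (\<forall>j. inner v (mode (0, j)) = 0)"
proof -
  have "(LINT x|torus. rep_L2 v x) = 0 \<longleftrightarrow> (\<forall>j. inner v (mode (0, j)) = 0)"
    using integral_scaleR_rep_L2[OF continuous_cas, of 0 v] by (simp add: vec_eq_iff mode_def cas_0)
  then show ?thesis
    by (simp add: H_def divergence_free_iff)
qed

lemma subspace_H: "subspace H"
  unfolding subspace_def
  by (auto simp: mem_H_iff inner_add_left distrib_left sum.distrib mult.left_commute simp flip: sum_distrib_left)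

lemma closed_H: "closed H"
proof -
  have "H = {v. \<forall>k. (\<Sum>j\<in>UNIV. of_int (k $ j) * inner v (mode (k, j))) = 0} \<inter> {v. \<forall>j. inner v (mode (0, j)) = 0}"
    by (auto simp: mem_H_iff)
  also have "closed \<dots>"
    by (intro closed_Int closed_Collect_all closed_Collect_eq continuous_intros)
  finally show ?thesis .
qed

text \<open>A factor depending on k alone comes out of the divergence sum. Used for the Laplacian,
  the diagonal semigroup and the approximants in the density proof.\<close>

lemma radial_multiplier_H:
  assumes v: "v \<in> H" and w: "\<And>k j. inner w (mode (k, j)) = m k * inner v (mode (k, j))"
  shows "w \<in> H"
proof -
  have "(\<Sum>j\<in>UNIV. of_int (k $ j) * inner w (mode (k, j))) =
      m k * (\<Sum>j\<in>UNIV. of_int (k $ j) * inner v (mode (k, j)))" for k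
    by (simp add: w sum_distrib_left mult_ac)
  then show ?thesis
    using v by (simp add: mem_H_iff w)
qed

definition norm_sq :: "int^3 \<Rightarrow> real" where
  "norm_sq k = (\<Sum>i\<in>UNIV. (of_int (k $ i))\<^sup>2)"

lemma norm_sq_nonneg: "norm_sq k \<ge> 0"
  by (simp add: norm_sq_def sum_nonneg)

lemma component_sq_le: "(of_int (k $ i))\<^sup>2 \<le> norm_sq k"
  unfolding norm_sq_def by (rule member_le_sum) auto

lemma norm_sq_eq_0_iff: "norm_sq k = 0 \<longleftrightarrow> k = 0"
  by (simp add: norm_sq_def sum_nonneg_eq_0_iff vec_eq_iff)

text \<open>Multiplier bound for the Leray projector and for recovering second derivatives from the
  Laplacian; at k = 0 the quotient is 0 by the convention for division.\<close>

lemma component_mult_le: "\<bar>of_int (k $ i) * of_int (k $ j) / norm_sq k\<bar> \<le> 1"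
proof (cases "k = 0")
  case False
  let ?a = "real_of_int (k $ i)" and ?b = "real_of_int (k $ j)"
  have "2 * (\<bar>?a\<bar> * \<bar>?b\<bar>) \<le> ?a\<^sup>2 + ?b\<^sup>2"
    using sum_squares_bound[of "\<bar>?a\<bar>" "\<bar>?b\<bar>"] by simp
  then have "\<bar>?a * ?b\<bar> \<le> norm_sq k"
    using component_sq_le[of k i] component_sq_le[of k j] by (simp add: abs_mult)
  then show ?thesis
    using norm_sq_nonneg[of k] False norm_sq_eq_0_iff[of k] by (simp add: abs_divide divide_le_eq_1)
qed simp

text \<open>Multiplier bound for recovering first derivatives from the Laplacian. Integrality of k
  is essential: |a| <= a^2 holds for integers.\<close>

lemma component_le: "\<bar>of_int (k $ i) / (2 * pi * norm_sq k)\<bar> \<le> 1"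
proof (cases "k = 0")
  case False
  have pos: "norm_sq k > 0"
    using False norm_sq_nonneg[of k] norm_sq_eq_0_iff[of k] by simp
  have "\<bar>real_of_int (k $ i)\<bar> \<le> (of_int (k $ i))\<^sup>2"
  proof -
    have "\<bar>a\<bar> \<le> a\<^sup>2" for a :: int
      using mult_left_mono[of 1 "\<bar>a\<bar>" "\<bar>a\<bar>"]
      by (cases "a = 0") (simp_all add: power2_eq_square abs_mult_self_eq)
    then have "real_of_int \<bar>k $ i\<bar> \<le> real_of_int ((k $ i)\<^sup>2)"
      by (simp only: of_int_le_iff)
    then show ?thesis
      by simp
  qed
  also have "\<dots> \<le> norm_sq k"
    by (rule component_sq_le)
  also have "\<dots> \<le> 2 * pi * norm_sq k"
    using pos pi_ge_two by simp
  finally show ?thesis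
    using pos by (simp add: abs_mult divide_le_eq_1)
qed (simp add: norm_sq_def)

text \<open>In Fourier space \<^const>\<open>P\<close> subtracts from each coefficient vector its component along \<open>k\<close>. The
  entries \<open>v (k, j + d)\<close> are produced by cyclic shifts of the coordinate index \<open>j\<close>.\<close>

lemma projection_exists:
  obtains u where "u \<in> H" "\<And>w. w \<in> H \<Longrightarrow> inner (v - u) w = 0"
proof -
  define c where "c k = (\<Sum>l\<in>UNIV. of_int (k $ l) * inner v (mode (k, l))) / norm_sq k" for k
  \<comment> \<open>Removes the zero frequency, since fields in \<open>H\<close> have mean
    zero.\<close>
  obtain y where y: "\<And>n. inner y (mode n) = (if fst n = 0 then 0 else 1) * inner v (mode (id n))"
    by (rule fourier.weighted_permutation_exists[OF bij_id, of "\<lambda>n. if fst n = 0 then 0 else 1" 1 v]) auto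
  have "\<exists>z. \<forall>k j. inner z (mode (k, j)) =
      of_int (k $ j) * of_int (k $ (j + d)) / norm_sq k * inner v (mode (k, j + d))" for d
  proof -
    let ?\<sigma> = "\<lambda>n :: (int^3) \<times> 3. (fst n, snd n + d)"
    have "bij ?\<sigma>"
      by (rule bij_betw_byWitness[where f'="\<lambda>n. (fst n, snd n - d)"]) auto
    then obtain z where "\<And>n. inner z (mode n) =
        of_int (fst n $ snd n) * of_int (fst n $ (snd n + d)) / norm_sq (fst n) * inner v (mode (?\<sigma> n))"
      by (rule fourier.weighted_permutation_exists[of ?\<sigma>
            "\<lambda>n. of_int (fst n $ snd n) * of_int (fst n $ (snd n + d)) / norm_sq (fst n)" 1 v])
         (rule component_mult_le, blast)
    then show ?thesis
      by (intro exI[of _ z]) simp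
  qed
  then obtain z where z: "\<And>d k j. inner (z d) (mode (k, j)) =
      of_int (k $ j) * of_int (k $ (j + d)) / norm_sq k * inner v (mode (k, j + d))"
    by metis
  define u where "u = y - (\<Sum>d\<in>UNIV. z d)"
  have u: "inner u (mode (k, j)) = (if k = 0 then 0 else inner v (mode (k, j)) - of_int (k $ j) * c k)" for k j
  proof -
    have "(\<Sum>d\<in>UNIV. inner (z d) (mode (k, j))) =
        of_int (k $ j) / norm_sq k * (\<Sum>d\<in>UNIV. of_int (k $ (j + d)) * inner v (mode (k, j + d)))"
      by (simp add: z sum_distrib_left mult_ac)
    also have "(\<Sum>d\<in>UNIV. of_int (k $ (j + d)) * inner v (mode (k, j + d))) =
        (\<Sum>l\<in>UNIV. of_int (k $ l) * inner v (mode (k, l)))"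
      by (rule sum.reindex_bij_witness[of _ "\<lambda>l. l - j" "\<lambda>d. j + d"]) auto
    finally show ?thesis
      by (simp add: u_def inner_diff_left inner_sum_left y c_def)
  qed
  show ?thesis
  proof
    show "u \<in> H"
      unfolding mem_H_iff
    proof (intro conjI allI)
      fix k
      show "(\<Sum>j\<in>UNIV. of_int (k $ j) * inner u (mode (k, j))) = 0"
      proof (cases "k = 0")
        case False
        then have "(\<Sum>j\<in>UNIV. of_int (k $ j) * inner u (mode (k, j))) =
            (\<Sum>j\<in>UNIV. of_int (k $ j) * inner v (mode (k, j))) - norm_sq k * c k"
          by (simp add: u right_diff_distrib sum_subtractf norm_sq_def sum_distrib_left power2_eq_square mult_ac)
        then show ?thesis
          using False norm_sq_eq_0_iff[of k] by (simp add: c_def)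
      qed simp
    qed (simp add: u)
    show "inner (v - u) w = 0" if w: "w \<in> H" for w
    proof (rule inner_eq_0_fibrewise)
      fix k
      show "(\<Sum>j\<in>UNIV. inner (v - u) (mode (k, j)) * inner w (mode (k, j))) = 0"
      proof (cases "k = 0")
        case False
        \<comment> \<open>At k the difference \<open>v - u\<close> is the multiple
          \<open>c k\<close> of k, and the coefficient vector of \<open>w\<close> is orthogonal to
          k.\<close>
        then have "(\<Sum>j\<in>UNIV. inner (v - u) (mode (k, j)) * inner w (mode (k, j))) =
            c k * (\<Sum>j\<in>UNIV. of_int (k $ j) * inner w (mode (k, j)))"
          by (simp add: u inner_diff_left sum_distrib_left mult_ac)
        then show ?thesis
          using w by (simp add: mem_H_iff)
      qed (use w in \<open>simp add: mem_H_iff\<close>)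
    qed
  qed
qed

lemma P_eqI:
  assumes "u \<in> H" "\<And>w. w \<in> H \<Longrightarrow> inner (v - u) w = 0"
  shows "P v = u"
  unfolding P_def orthogonal_projector_def
proof (rule the_equality)
  show "u \<in> H \<and> (\<forall>w\<in>H. inner (v - u) w = 0)"
    using assms by blast
  fix u' assume u': "u' \<in> H \<and> (\<forall>w\<in>H. inner (v - u') w = 0)"
  then have "u' - u \<in> H"
    using assms(1) subspace_diff[OF subspace_H] by blast
  then have "inner (v - u) (u' - u) - inner (v - u') (u' - u) = 0"
    using assms(2) u' by simp
  then have "inner (u' - u) (u' - u) = 0"
    by (simp flip: inner_diff_left)
  then show "u' = u"
    by simp
qed

lemma P_in_H: "P v \<in> H"
  and P_orthogonal: "w \<in> H \<Longrightarrow> inner (v - P v) w = 0"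
  using projection_exists[of v] P_eqI by metis+

lemma P_id: "v \<in> H \<Longrightarrow> P v = v"
  by (rule P_eqI) auto

lemma inner_P: "w \<in> H \<Longrightarrow> inner (P v) w = inner v w"
  using P_orthogonal[of w v] by (simp add: inner_diff_left)

lemma bounded_linear_P: "bounded_linear P"
proof (rule bounded_linear_intro)
  show "P (v + w) = P v + P w" for v w
    by (rule P_eqI) (auto simp: subspace_add[OF subspace_H] P_in_H inner_P inner_add_left inner_diff_left)
  show "P (r *\<^sub>R v) = r *\<^sub>R P v" for r v
    by (rule P_eqI) (auto simp: subspace_scale[OF subspace_H] P_in_H inner_P inner_diff_left)
  show "norm (P v) \<le> norm v * 1" for v
  proof -
    have "norm (P v) * norm (P v) = inner v (P v)"
      using inner_P[OF P_in_H, of v v] by (simp add: power2_norm_eq_inner flip: power2_eq_square)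
    also have "\<dots> \<le> norm v * norm (P v)"
      by (rule norm_cauchy_schwarz)
    finally show ?thesis
      by (cases "P v = 0") auto
  qed
qed

section \<open>The Stokes operator in Fourier space\<close>

lemma laplacian_coeffs:
  assumes "v \<in> H2"
  shows "inner (laplacian v) (mode (k, j)) = - (4 * pi\<^sup>2 * norm_sq k) * inner v (mode (k, j))"
proof -
  have v: "v \<in> H1" and d: "weak_deriv i v \<in> H1" for i
    using assms by (auto simp: H2_def)
  have "inner (weak_deriv i (weak_deriv i v)) (mode (k, j)) = - (4 * pi\<^sup>2) * (of_int (k $ i))\<^sup>2 * inner v (mode (k, j))" for i
    using weak_deriv_H1[OF v, of i] weak_deriv_H1[OF d, of i i]
    by (simp add: weak_deriv_coeffs_def power2_eq_square)
  then show ?thesis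
    by (simp add: laplacian_def inner_sum_left norm_sq_def sum_distrib_left sum_distrib_right sum_negf)
qed

lemma inner_laplacian:
  assumes "v \<in> H2"
  shows "inner (laplacian v) v = - (norm_grad v)\<^sup>2"
proof -
  have v: "v \<in> H1" and d: "weak_deriv i v \<in> H1" for i
    using assms by (auto simp: H2_def)
  have "inner (weak_deriv i (weak_deriv i v)) v = - (norm (weak_deriv i v))\<^sup>2" for i
    using weak_deriv_coeffs_skew[OF weak_deriv_H1[OF d] weak_deriv_H1[OF v], of i i]
    by (simp add: power2_norm_eq_inner)
  then show ?thesis
    by (simp add: laplacian_def inner_sum_left norm_grad_def sum_negf sum_nonneg)
qed

text \<open>Elliptic regularity: a vector \<open>z\<close> with the formal coefficients of the
  Laplacian suffices, because every first and second derivative arises from \<open>z\<close> by a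
  multiplier bounded by 1, combined with the reflection for first derivatives.\<close>

lemma mem_H2I:
  assumes z: "\<And>k j. inner z (mode (k, j)) = - (4 * pi\<^sup>2 * norm_sq k) * inner v (mode (k, j))"
  shows "v \<in> H2"
proof -
  have "\<exists>g. weak_deriv_coeffs i v g" for i
  proof -
    obtain g where g: "\<And>n. inner g (mode n) =
        of_int (fst n $ i) / (2 * pi * norm_sq (fst n)) * inner z (mode (reflect n))"
      by (rule fourier.weighted_permutation_exists[OF bij_reflect,
            of "\<lambda>n. of_int (fst n $ i) / (2 * pi * norm_sq (fst n))" 1 z]) (rule component_le, blast)
    have "norm_sq (- k) = norm_sq k" for k
      by (simp add: norm_sq_def)
    then have "inner g (mode (k, j)) = - (2 * pi * of_int (k $ i)) * inner v (mode (- k, j))" for k j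
      using norm_sq_eq_0_iff[of k] by (cases "k = 0") (simp_all add: g reflect_def z power2_eq_square)
    then show ?thesis
      by (auto simp: weak_deriv_coeffs_def)
  qed
  then have v: "v \<in> H1"
    by (simp add: H1_def has_weak_deriv_iff)
  have "\<exists>g. weak_deriv_coeffs l (weak_deriv i v) g" for i l
  proof -
    obtain g where g: "\<And>n. inner g (mode n) =
        of_int (fst n $ l) * of_int (fst n $ i) / norm_sq (fst n) * inner z (mode (id n))"
      by (rule fourier.weighted_permutation_exists[OF bij_id,
            of "\<lambda>n. of_int (fst n $ l) * of_int (fst n $ i) / norm_sq (fst n)" 1 z]) (rule component_mult_le, blast)
    have "inner g (mode (k, j)) = - (2 * pi * of_int (k $ l)) * inner (weak_deriv i v) (mode (- k, j))" for k j
      using norm_sq_eq_0_iff[of k] weak_deriv_H1[OF v, of i]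
      by (cases "k = 0") (simp_all add: g z power2_eq_square weak_deriv_coeffs_def)
    then show ?thesis
      by (auto simp: weak_deriv_coeffs_def)
  qed
  with v show ?thesis
    by (simp add: H2_def H1_def has_weak_deriv_iff)
qed

definition stokes_eigenvalue :: "real \<Rightarrow> (int^3) \<times> 3 \<Rightarrow> real" where
  "stokes_eigenvalue \<nu> n = \<nu> * (4 * pi\<^sup>2 * norm_sq (fst n))"

lemma stokes_eigenvalue_nonneg: "\<nu> > 0 \<Longrightarrow> stokes_eigenvalue \<nu> n \<ge> 0"
  using norm_sq_nonneg[of "fst n"] by (simp add: stokes_eigenvalue_def)

lemma A0_coeffs:
  assumes "v \<in> dom_A0"
  shows A0_in_H: "A0 \<nu> v \<in> H"
    and inner_A0_mode: "inner (A0 \<nu> v) (mode n) = - stokes_eigenvalue \<nu> n * inner v (mode n)"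
    and inner_A0: "inner (A0 \<nu> v) v = - \<nu> * (norm_grad v)\<^sup>2"
proof -
  have v: "v \<in> H2" "v \<in> H"
    using assms by (auto simp: dom_A0_def)
  \<comment> \<open>On the torus the Laplacian preserves \<open>H\<close>, so the projector in
    \<open>A0\<close> acts as the identity here.\<close>
  have "laplacian v \<in> H"
    by (rule radial_multiplier_H[OF v(2) laplacian_coeffs[OF v(1)]])
  then have A0: "A0 \<nu> v = \<nu> *\<^sub>R laplacian v"
    by (simp add: A0_def P_id)
  show "A0 \<nu> v \<in> H"
    unfolding A0_def by (rule subspace_scale[OF subspace_H P_in_H])
  show "inner (A0 \<nu> v) (mode n) = - stokes_eigenvalue \<nu> n * inner v (mode n)"
    by (cases n) (simp add: A0 laplacian_coeffs[OF v(1)] stokes_eigenvalue_def)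
  show "inner (A0 \<nu> v) v = - \<nu> * (norm_grad v)\<^sup>2"
    by (simp add: A0 inner_laplacian[OF v(1)])
qed

text \<open>Matches the maximal domain found in \<open>generator_diagonal_semigroup\<close> with the
  Sobolev domain of the Stokes operator.\<close>

lemma A0_graph_iff:
  assumes "\<nu> > 0" "v \<in> H"
  shows "(\<forall>n. inner z (mode n) = - stokes_eigenvalue \<nu> n * inner v (mode n)) \<longleftrightarrow> v \<in> dom_A0 \<and> z = A0 \<nu> v"
    (is "?l \<longleftrightarrow> ?r")
proof
  assume l: ?l
  have "v \<in> H2"
    by (rule mem_H2I[of "(1 / \<nu>) *\<^sub>R z"]) (use l assms(1) in \<open>simp add: stokes_eigenvalue_def\<close>)
  then have v: "v \<in> dom_A0"
    using assms(2) by (simp add: dom_A0_def)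
  moreover have "z = A0 \<nu> v"
    by (rule fourier.eqI) (simp add: l inner_A0_mode[OF v])
  ultimately show ?r ..
qed (auto simp: inner_A0_mode)

text \<open>The approximant \<open>y a\<close> is the image of \<open>v\<close> under the
  resolvent-type operator (1 - a Laplacian)^(-1), a multiplier with values in (0, 1]. It lies in the
  domain because \<open>a * (s k * m a k)\<close> is at most 1, and it tends to \<open>v\<close> as
  a decreases to 0.\<close>

lemma dense_dom_A0: "H \<subseteq> closure dom_A0"
proof
  fix v assume v: "v \<in> H"
  define s where "s k = 4 * pi\<^sup>2 * norm_sq k" for k
  have s: "s k \<ge> 0" for k
    using norm_sq_nonneg[of k] by (simp add: s_def)
  define m where "m a k = 1 / (1 + a * s k)" for a k
  have m: "0 \<le> m a k" "m a k \<le> 1" "a * (s k * m a k) \<le> 1" if "a > 0" for a k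
    using s[of k] that by (auto simp: m_def divide_simps add_pos_nonneg)
  have "\<exists>y. \<forall>n. inner y (mode n) = m a (fst n) * inner v (mode n)" if "a > 0" for a
    using fourier.weighted_permutation_exists[OF bij_id, of "\<lambda>n. m a (fst n)" 1 v] m[OF that] by (metis abs_of_nonneg id_apply)
  then obtain y where y: "\<And>a n. a > 0 \<Longrightarrow> inner (y a) (mode n) = m a (fst n) * inner v (mode n)"
    by metis
  have "y a \<in> dom_A0" if "a > 0" for a
  proof -
    have "\<bar>- (s (fst n) * m a (fst n))\<bar> \<le> 1 / a" for n :: "(int^3) \<times> 3"
      using m(1,3)[OF that, of "fst n"] s[of "fst n"] that by (simp add: pos_le_divide_eq mult.commute)
    then obtain z where "\<And>n. inner z (mode n) = - (s (fst n) * m a (fst n)) * inner v (mode (id n))"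
      by (rule fourier.weighted_permutation_exists[OF bij_id, of "\<lambda>n. - (s (fst n) * m a (fst n))" "1 / a" v]) blast+
    then have "y a \<in> H2"
      by (intro mem_H2I[of z]) (simp add: y[OF that] s_def)
    moreover have "y a \<in> H"
      by (rule radial_multiplier_H[OF v, of _ "m a"]) (simp add: y[OF that])
    ultimately show ?thesis
      by (simp add: dom_A0_def)
  qed
  moreover have "((\<lambda>a. y a - v) \<longlongrightarrow> 0) (at_right 0)"
  proof (rule fourier.multiplier_tendsto_0[where C=1 and x=v and m="\<lambda>a n. m a (fst n) - 1"])
    fix n :: "(int^3) \<times> 3"
    have "((\<lambda>a. m a (fst n) - 1) \<longlongrightarrow> 1 / (1 + 0 * s (fst n)) - 1) (at_right 0)"
      unfolding m_def by (intro tendsto_intros) auto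
    then show "((\<lambda>a. m a (fst n) - 1) \<longlongrightarrow> 0) (at_right 0)"
      by simp
  next
    have "\<bar>m a (fst n) - 1\<bar> \<le> 1" if "a > 0" for a and n :: "(int^3) \<times> 3"
      using m[OF that, of "fst n"] by (simp add: abs_le_iff)
    then show "eventually (\<lambda>a. \<forall>n :: (int^3) \<times> 3. \<bar>m a (fst n) - 1\<bar> \<le> 1) (at_right 0)"
      by (auto simp: eventually_at_filter)
    show "eventually (\<lambda>a. \<forall>n. inner (y a - v) (mode n) = (m a (fst n) - 1) * inner v (mode n)) (at_right 0)"
      by (auto simp: eventually_at_filter y inner_diff_left algebra_simps)
  qed
  then have "(y \<longlongrightarrow> v) (at_right 0)"
    by (rule Lim_null[THEN iffD2])
  ultimately show "v \<in> closure dom_A0"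
    by (intro Lim_in_closed_set[OF closed_closure, of y dom_A0 "at_right 0", simplified])
       (auto simp: eventually_at_filter closure_subset[THEN subsetD])
qed

section \<open>Multiplication by bounded functions and the damping operator\<close>

lemma L_infinity_cmult: "L_infinity m \<Longrightarrow> L_infinity (\<lambda>x. c * m x)"
proof -
  assume "L_infinity m"
  then obtain C where C: "m \<in> borel_measurable torus" "AE x in torus. \<bar>m x\<bar> \<le> C"
    by (auto simp: L_infinity_def)
  have "AE x in torus. \<bar>c * m x\<bar> \<le> \<bar>c\<bar> * C"
    using C(2) by eventually_elim (simp add: abs_mult mult_left_mono)
  with C(1) show ?thesis
    by (auto simp: L_infinity_def)
qed

lemma square_integrable_multiply:
  assumes m: "m \<in> borel_measurable torus" "AE x in torus. \<bar>m x\<bar> \<le> C" and f: "square_integrable f"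
  shows "square_integrable (\<lambda>x. m x *\<^sub>R f x)"
  unfolding square_integrable_def
proof
  note [measurable] = m(1) square_integrable_measurable[OF f]
  show "(\<lambda>x. m x *\<^sub>R f x) \<in> borel_measurable torus"
    by measurable
  show "integrable torus (\<lambda>x. (norm (m x *\<^sub>R f x))\<^sup>2)"
  proof (rule Bochner_Integration.integrable_bound)
    show "integrable torus (\<lambda>x. C\<^sup>2 * (norm (f x))\<^sup>2)"
      using f by (simp add: square_integrable_def)
    show "AE x in torus. norm ((norm (m x *\<^sub>R f x))\<^sup>2) \<le> norm (C\<^sup>2 * (norm (f x))\<^sup>2)"
      using m(2)
    proof eventually_elim
      case (elim x)
      then show ?case
        using power_mono[OF elim, of 2] by (simp add: power_mult_distrib mult_right_mono)
    qed
  qed measurable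
qed

text \<open>Independence of the representative that \<open>multiply\<close> picks.\<close>

lemma multiply_eqI:
  assumes m: "m \<in> borel_measurable torus" "AE x in torus. \<bar>m x\<bar> \<le> C"
    and f: "square_integrable f" "AE x in torus. f x = rep_L2 v x"
  shows "multiply m v = abs_L2 (\<lambda>x. m x *\<^sub>R f x)"
  unfolding multiply_def
proof (subst abs_L2_eq_iff)
  show "AE x in torus. m x *\<^sub>R rep_L2 v x = m x *\<^sub>R f x"
    using f(2) by eventually_elim simp
qed (intro square_integrable_multiply[OF m] f square_integrable_rep_L2)+

lemma norm_multiply_le:
  assumes m: "m \<in> borel_measurable torus" "AE x in torus. \<bar>m x\<bar> \<le> C"
  shows "norm (multiply m v) \<le> \<bar>C\<bar> * norm v"
proof -
  let ?f = "rep_L2 v"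
  note f = square_integrable_rep_L2[of v]
  note mf = square_integrable_multiply[OF m f]
  have "(norm (multiply m v))\<^sup>2 = (LINT x|torus. (norm (m x *\<^sub>R ?f x))\<^sup>2)"
    by (simp only: power2_norm_eq_inner multiply_def inner_abs_L2[OF mf mf])
  also have "\<dots> \<le> (LINT x|torus. C\<^sup>2 * (norm (?f x))\<^sup>2)"
  proof (rule integral_mono_AE)
    show "AE x in torus. (norm (m x *\<^sub>R ?f x))\<^sup>2 \<le> C\<^sup>2 * (norm (?f x))\<^sup>2"
      using m(2)
    proof eventually_elim
      case (elim x)
      then show ?case
        using power_mono[OF elim, of 2] by (simp add: power_mult_distrib mult_right_mono)
    qed
  qed (use f mf in \<open>simp_all only: square_integrable_def integrable_mult_right\<close>)
  also have "\<dots> = (\<bar>C\<bar> * norm v)\<^sup>2"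
    by (simp add: power_mult_distrib power2_norm_eq_inner inner_L2_rep[of v v])
  finally show ?thesis
    by (rule power2_le_imp_le) simp
qed

lemma bounded_linear_multiply:
  assumes "L_infinity m"
  shows "bounded_linear (multiply m)"
proof -
  obtain C where m: "m \<in> borel_measurable torus" "AE x in torus. \<bar>m x\<bar> \<le> C"
    using assms by (auto simp: L_infinity_def)
  note sq = square_integrable_rep_L2
  note mult_sq = square_integrable_multiply[OF m sq]
  show ?thesis
  proof (rule bounded_linear_intro)
    fix v w :: L2 and r :: real
    have "AE x in torus. rep_L2 v x + rep_L2 w x = rep_L2 (v + w) x"
      using rep_L2_abs_L2[OF square_integrable_add[OF sq sq], of v w]
      by (simp add: abs_L2_add[OF sq sq, symmetric] abs_L2_rep_L2 eq_commute)
    then have "multiply m (v + w) = abs_L2 (\<lambda>x. m x *\<^sub>R (rep_L2 v x + rep_L2 w x))"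
      by (intro multiply_eqI[OF m] square_integrable_add sq)
    then show "multiply m (v + w) = multiply m v + multiply m w"
      by (simp add: multiply_def abs_L2_add[OF mult_sq mult_sq] scaleR_add_right)
    have "AE x in torus. r *\<^sub>R rep_L2 v x = rep_L2 (r *\<^sub>R v) x"
      using rep_L2_abs_L2[OF square_integrable_scaleR[OF sq], of r v]
      by (simp add: abs_L2_scaleR[OF sq, symmetric] abs_L2_rep_L2 eq_commute)
    then have "multiply m (r *\<^sub>R v) = abs_L2 (\<lambda>x. m x *\<^sub>R r *\<^sub>R rep_L2 v x)"
      by (intro multiply_eqI[OF m] square_integrable_scaleR sq)
    then show "multiply m (r *\<^sub>R v) = r *\<^sub>R multiply m v"
      by (simp add: multiply_def abs_L2_scaleR[OF mult_sq] mult.commute)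
    show "norm (multiply m v) \<le> norm v * \<bar>C\<bar>"
      using norm_multiply_le[OF m, of v] by (simp add: mult.commute)
  qed
qed

lemma bounded_linear_damping:
  assumes "L_infinity chi"
  shows "bounded_linear (damping K chi)"
  unfolding damping_def[abs_def]
  by (rule bounded_linear_compose[OF bounded_linear_P bounded_linear_multiply[OF L_infinity_cmult[OF assms]]])

text \<open>Pairing with \<open>v\<close> in \<open>H\<close> removes the projector; nonnegativity
  almost everywhere then allows \<open>chi\<close> to be split into two square roots.\<close>

lemma inner_damping:
  assumes chi: "L_infinity chi" "AE x in torus. 0 \<le> chi x" and v: "v \<in> H"
  shows "inner (damping K chi v) v = K * (norm (multiply (\<lambda>x. sqrt (chi x)) v))\<^sup>2"
proof -
  obtain C where C: "chi \<in> borel_measurable torus" "AE x in torus. \<bar>chi x\<bar> \<le> C"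
    using chi(1) by (auto simp: L_infinity_def)
  let ?f = "rep_L2 v"
  note f = square_integrable_rep_L2[of v]
  have "AE x in torus. \<bar>sqrt (chi x)\<bar> \<le> sqrt C"
    using chi(2) C(2) by eventually_elim simp
  with C(1) have r: "(\<lambda>x. sqrt (chi x)) \<in> borel_measurable torus" "AE x in torus. \<bar>sqrt (chi x)\<bar> \<le> sqrt C"
    by simp_all
  have c: "AE x in torus. \<bar>K * chi x\<bar> \<le> \<bar>K\<bar> * C"
    using C(2) by eventually_elim (simp add: abs_mult mult_left_mono)
  have Kchi: "square_integrable (\<lambda>x. (K * chi x) *\<^sub>R ?f x)"
    by (rule square_integrable_multiply[OF _ c f]) (use C(1) in measurable)
  have root: "square_integrable (\<lambda>x. sqrt (chi x) *\<^sub>R ?f x)"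
    by (rule square_integrable_multiply[OF r f])
  note [measurable] = C(1) square_integrable_measurable[OF f]
  have "inner (damping K chi v) v = inner (abs_L2 (\<lambda>x. (K * chi x) *\<^sub>R ?f x)) (abs_L2 ?f)"
    by (simp add: damping_def inner_P[OF v] multiply_def abs_L2_rep_L2)
  also have "\<dots> = (LINT x|torus. ((K * chi x) *\<^sub>R ?f x) \<bullet> ?f x)"
    by (rule inner_abs_L2[OF Kchi f])
  also have "\<dots> = (LINT x|torus. K * ((sqrt (chi x) *\<^sub>R ?f x) \<bullet> (sqrt (chi x) *\<^sub>R ?f x)))"
  proof (rule integral_cong_AE)
    show "AE x in torus. ((K * chi x) *\<^sub>R ?f x) \<bullet> ?f x = K * ((sqrt (chi x) *\<^sub>R ?f x) \<bullet> (sqrt (chi x) *\<^sub>R ?f x))"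
      using chi(2) by eventually_elim simp
  qed measurable
  also have "\<dots> = K * (norm (multiply (\<lambda>x. sqrt (chi x)) v))\<^sup>2"
    by (simp only: power2_norm_eq_inner multiply_def inner_abs_L2[OF root root] integral_mult_right_zero)
  finally show ?thesis .
qed

section \<open>Generation on \<open>H\<close> and the decay estimate\<close>

lemma C0_semigroup_restrict:
  assumes S: "C0_semigroup UNIV S" and X: "\<And>t x. t \<ge> 0 \<Longrightarrow> x \<in> X \<Longrightarrow> S t x \<in> X"
  shows "C0_semigroup X S"
  unfolding C0_semigroup_def
proof (intro conjI allI impI ballI)
  show "\<exists>M. \<forall>x\<in>X. norm (S t x) \<le> M * norm x" if "t \<ge> 0" for t
    using C0_semigroup_bounded[OF S that] by auto
qed (simp_all add: X C0_semigroupD[OF S])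

text \<open>The perturbation argument runs on the whole space; invariance of \<open>H\<close> under
  \<open>T\<close>, \<open>B\<close> and the Duhamel integral then permits the restriction.\<close>

lemma generates_damped_stokes:
  assumes \<nu>: "\<nu> > 0" and chi: "L_infinity chi"
  shows "\<exists>S. generates H dom_A0 (\<lambda>v. A0 \<nu> v - damping K chi v) S"
proof -
  define T where "T = fourier.diagonal_semigroup (stokes_eigenvalue \<nu>)"
  define B where "B = (\<lambda>v. - damping K chi v)"
  note \<Lambda> = stokes_eigenvalue_nonneg[OF \<nu>]
  have B: "bounded_linear B"
    unfolding B_def by (rule bounded_linear_minus[OF bounded_linear_damping[OF chi]])
  have BH: "B v \<in> H" for v
    unfolding B_def damping_def by (rule subspace_neg[OF subspace_H P_in_H])
  interpret perturbed_contraction_semigroup T B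
  proof (rule perturbed_contraction_semigroup.intro)
    show "C0_semigroup UNIV T"
      unfolding T_def by (rule fourier.C0_diagonal_semigroup[OF \<Lambda>])
    show "norm (T t x) \<le> norm x" if "t \<ge> 0" for t x
      unfolding T_def by (rule fourier.norm_diagonal_semigroup_le[OF \<Lambda> that])
  qed (rule B)
  have TH: "T t v \<in> H" if "t \<ge> 0" "v \<in> H" for t v
    by (rule radial_multiplier_H[OF that(2), of _ "\<lambda>k. exp (- t * (\<nu> * (4 * pi\<^sup>2 * norm_sq k)))"])
       (use fourier.inner_diagonal_semigroup[of "stokes_eigenvalue \<nu>", OF \<Lambda> that(1)] in
         \<open>simp add: T_def, simp add: stokes_eigenvalue_def\<close>)
  have SH: "S t v \<in> H" if t: "t \<ge> 0" and v: "v \<in> H" for t v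
  proof -
    let ?f = "\<lambda>s. T (t - s) (B (S s v))"
    have "?f integrable_on {0..t}"
      by (rule integrable_duhamel) (rule continuous_on_subset[OF S_continuous], auto)
    \<comment> \<open>The integral stays in \<open>H\<close> because the bounded operator
      \<open>P\<close> commutes with it and fixes the integrand.\<close>
    then have "P (integral {0..t} ?f) = integral {0..t} (P \<circ> ?f)"
      by (rule integral_linear[OF _ bounded_linear_P, symmetric])
    also have "\<dots> = integral {0..t} ?f"
      by (rule integral_cong) (simp add: P_id TH BH)
    finally have "integral {0..t} ?f \<in> H"
      using P_in_H by metis
    then show ?thesis
      using subspace_add[OF subspace_H TH[OF t v]] by (simp add: S_eq[OF t] duhamel_def)
  qed
  have gen: "generator H S = {(v, A0 \<nu> v - damping K chi v) | v. v \<in> dom_A0}"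
  proof (intro set_eqI)
    fix p :: "L2 \<times> L2"
    obtain v w where p: "p = (v, w)"
      by (cases p)
    \<comment> \<open>Both generators use the same limit, so restricting only adds that both entries
      belong to \<open>H\<close>.\<close>
    have "p \<in> generator H S \<longleftrightarrow> v \<in> H \<and> w \<in> H \<and> (v, w) \<in> generator UNIV S"
      by (auto simp: p generator_def)
    also have "(v, w) \<in> generator UNIV S \<longleftrightarrow> (v, w - B v) \<in> generator UNIV T"
      by (auto simp: generator_S) (metis diff_add_cancel)
    also have "\<dots> \<longleftrightarrow> (\<forall>n. inner (w - B v) (mode n) = - stokes_eigenvalue \<nu> n * inner v (mode n))"
      unfolding T_def fourier.generator_diagonal_semigroup[OF \<Lambda>] by simp
    also have "v \<in> H \<and> w \<in> H \<and> \<dots> \<longleftrightarrow> v \<in> H \<and> w \<in> H \<and> v \<in> dom_A0 \<and> w - B v = A0 \<nu> v"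
      using A0_graph_iff[OF \<nu>] by blast
    also have "\<dots> \<longleftrightarrow> v \<in> dom_A0 \<and> w = A0 \<nu> v + B v"
    proof -
      have "A0 \<nu> v + B v \<in> H" if "v \<in> dom_A0"
        by (rule subspace_add[OF subspace_H A0_in_H[OF that] BH])
      moreover have "v \<in> H" if "v \<in> dom_A0"
        using that by (simp add: dom_A0_def)
      ultimately show ?thesis
        by (auto simp: algebra_simps)
    qed
    finally show "p \<in> generator H S \<longleftrightarrow> p \<in> {(v, A0 \<nu> v - damping K chi v) | v. v \<in> dom_A0}"
      by (auto simp: p B_def)
  qed
  show ?thesis
    unfolding generates_def using C0_semigroup_restrict[OF C0_semigroup_S SH] gen by blast
qed

theorem theorem4p3:
  fixes \<nu> K\<^sub>m\<^sub>i\<^sub>n \<alpha> :: real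
    and \<omega> :: "(real^3) set"
    and chi :: "real^3 \<Rightarrow> real"
  assumes "\<nu> > 0"
    and "\<omega> \<in> sets torus"
    and "L_infinity chi"
    and "AE x in torus. 0 \<le> chi x"
    and "K\<^sub>m\<^sub>i\<^sub>n \<ge> 0"
    and "\<alpha> > 0"
    and "\<forall>v\<in>V. \<nu> * (norm_grad v)\<^sup>2 + K\<^sub>m\<^sub>i\<^sub>n * (norm (multiply (\<lambda>x. sqrt (chi x)) v))\<^sup>2
                 \<ge> \<alpha> * (norm v)\<^sup>2"
  shows "(\<exists>S. generates H dom_A0 (\<lambda>v. A0 \<nu> v - damping K\<^sub>m\<^sub>i\<^sub>n chi v) S) \<and>
         (\<forall>S. generates H dom_A0 (\<lambda>v. A0 \<nu> v - damping K\<^sub>m\<^sub>i\<^sub>n chi v) S \<longrightarrow>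
            (\<forall>v\<^sub>0\<in>H. \<forall>t\<ge>0. norm (S t v\<^sub>0) \<le> exp (- \<alpha> * t) * norm v\<^sub>0))"
proof (intro conjI allI impI ballI)
  show "\<exists>S. generates H dom_A0 (\<lambda>v. A0 \<nu> v - damping K\<^sub>m\<^sub>i\<^sub>n chi v) S"
    by (rule generates_damped_stokes[OF assms(1,3)])
next
  fix S :: "real \<Rightarrow> L2 \<Rightarrow> L2" and v\<^sub>0 and t :: real
  assume S: "generates H dom_A0 (\<lambda>v. A0 \<nu> v - damping K\<^sub>m\<^sub>i\<^sub>n chi v) S" and v0: "v\<^sub>0 \<in> H" and t: "0 \<le> t"
  then have semigroup: "C0_semigroup H S"
    and gen: "generator H S = {(v, A0 \<nu> v - damping K\<^sub>m\<^sub>i\<^sub>n chi v) | v. v \<in> dom_A0}"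
    by (auto simp: generates_def)
  have diss: "inner w v \<le> - \<alpha> * (norm v)\<^sup>2" if "(v, w) \<in> generator H S" for v w
  proof -
    have v: "v \<in> dom_A0" and w: "w = A0 \<nu> v - damping K\<^sub>m\<^sub>i\<^sub>n chi v"
      using that by (auto simp: gen)
    have vH: "v \<in> H" and vV: "v \<in> V"
      using v by (auto simp: dom_A0_def V_def H2_def)
    \<comment> \<open>Exactly the negative of the left-hand side of the coercivity hypothesis, which
      applies because the domain is contained in \<open>V\<close>.\<close>
    have "inner w v = - (\<nu> * (norm_grad v)\<^sup>2 + K\<^sub>m\<^sub>i\<^sub>n * (norm (multiply (\<lambda>x. sqrt (chi x)) v))\<^sup>2)"
      by (simp add: w inner_diff_left inner_A0[OF v] inner_damping[OF assms(3,4) vH])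
    with assms(7) vV show ?thesis
      by fastforce
  qed
  have "Domain (generator H S) = dom_A0"
    by (auto simp: gen)
  then have dense: "H \<subseteq> closure (Domain (generator H S))"
    using dense_dom_A0 by simp
  show "norm (S t v\<^sub>0) \<le> exp (- \<alpha> * t) * norm v\<^sub>0"
    by (rule semigroup_decay[OF semigroup subspace_H closed_H diss dense v0 t])
qed

end
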